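(* Let $m\in\mathbb{C}\setminus\{-1\}$ and let $x$ be a positive real number. Then $$\sum_{k=1}^{\lfloor x\rfloor}k^{m}=\frac{1}{m+1}x^{m+1}+\zeta(-m)+\frac{x^{m+1}}{m+1}\sum_{k=1}^{\infty}(-1)^{k}\frac{\sum_{l=1}^{k}\binom{m+1}{l}S^{(1)}_{k}(l)B_{l}(\{x\})}{(x+1)(x+2)\cdots(x+k)}.$$ More generally, for every $a\in\mathbb{N}_{0}$, $$\sum_{k=1}^{\lfloor x\rfloor}k^{m}=\frac{1}{m+1}x^{m+1}+\zeta(-m)+\frac{1}{m+1}\sum_{k=1}^{a}(-1)^{k}\binom{m+1}{k}B_{k}(\{x\})x^{m-k+1}+\frac{x^{m-a+1}}{m+1}\sum_{k=1}^{\infty}(-1)^{k+a}\frac{\sum_{l=1}^{k}\binom{m+1}{l+a}S^{(1)}_{k}(l)B_{l+a}(\{x\})}{(x+1)(x+2)\cdots(x+k)},$$ and, if $m_{1}:=\operatorname{Re}(m)\geq-1$ (still $m\neq-1$), the special case $$\sum_{k=1}^{\lfloor x\rfloor}k^{m}=\frac{1}{m+1}x^{m+1}+\zeta(-m)+\frac{1}{m+1}\sum_{k=1}^{\lfloor m_{1}+1\rfloor}(-1)^{k}\binom{m+1}{k}B_{k}(\{x\})x^{m-k+1}+(-1)^{\lfloor m_{1}+1\rfloor}\frac{x^{m-\lfloor m_{1}+1\rfloor+1}}{m+1}\sum_{k=1}^{\infty}(-1)^{k}\frac{\sum_{l=1}^{k}\binom{m+1}{l+\lfloor m_{1}+1\rfloor}S^{(1)}_{k}(l)B_{l+\lfloor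 m_{1}+1\rfloor}(\{x\})}{(x+1)(x+2)\cdots(x+k)}.$$ Moreover, for $m=-1$, for every positive real number $x$ and every $a\in\mathbb{N}_{0}$, $$\sum_{k=1}^{\lfloor x\rfloor}\frac{1}{k}=\log(x)+\gamma-\sum_{k=1}^{a}\frac{B_{k}(\{x\})}{kx^{k}}+\frac{1}{x^{a}}\sum_{k=1}^{\infty}(-1)^{k+1}\frac{\sum_{l=1}^{k}\frac{(-1)^{l}}{l+a}S^{(1)}_{k}(l)B_{l+a}(\{x\})}{(x+1)(x+2)\cdots(x+k)}.$$ In particular, for every positive real number $x$, $$\sum_{k=1}^{\lfloor x\rfloor}\frac{1}{k}=\log(x)+\gamma+\sum_{k=1}^{\infty}(-1)^{k+1}\frac{\sum_{l=1}^{k}\frac{(-1)^{l}}{l}S_{k}^{(1)}(l)B_{l}(\{x\})}{(x+1)(x+2)\cdots(x+k)}$$ and $$\sum_{k=1}^{\lfloor x\rfloor}\frac{1}{k}=\log(x)+\gamma-\frac{B_{1}(\{x\})}{x}+\sum_{k=1}^{\infty}(-1)^{k+1}\frac{\sum_{l=1}^{k}\frac{(-1)^{l}}{l+1}S_{k}^{(1)}(l)B_{l+1}(\{x\})}{x(x+1)(x+2)\cdots(x+k)}.$$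
   Context: $\mathbb{N}_0=\{0,1,2,\ldots\}$; $\lfloor x\rfloor$ is the floor and $\{x\}=x-\lfloor x\rfloor$ the fractional part of $x$; empty sums are $0$. $\zeta$ is the (meromorphically continued) Riemann zeta function and $\gamma$ is Euler's constant. For $t>0$ and $w\in\mathbb{C}$, $t^{w}=e^{w\log t}$ with real logarithm. Stirling numbers of the first kind (signed): for integers $k\ge l\ge 0$, $S^{(1)}_k(l)$ is defined by $z(z+1)\cdots(z+k-1)=(-1)^{k}\sum_{l=0}^{k}(-1)^{l}S_{k}^{(1)}(l)z^{l}$, and $S^{(1)}_k(l)=0$ for $l>k$. Binomial coefficients: $\binom{z}{s}=\frac{\Gamma(z+1)}{\Gamma(s+1)\Gamma(z-s+1)}$ for complex $z,s$; for $s=k\in\mathbb{N}_0$ this is $\binom{z}{k}=\frac{z(z-1)\cdots(z-k+1)}{k!}$, which is also the meaning when the gamma functions have poles. Bernoulli polynomials: $\frac{te^{xt}}{e^{t}-1}=\sum_{n=0}^{\infty}\frac{B_{n}(x)}{n!}t^{n}$ for $|t|<2\pi$. *)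

theory Defs
  imports
    "HOL-Complex_Analysis.Complex_Analysis"
    "HOL-Combinatorics.Stirling"
begin

text \<open>
  The Riemann zeta function is the unique holomorphic continuation of the Dirichlet series to
  the plane without \<open>1\<close>. The value at the pole \<open>1\<close> is fixed to \<open>0\<close> only
  to make the description unique as a total function.
\<close>
definition is_zeta :: "(complex \<Rightarrow> complex) \<Rightarrow> bool" where
  "is_zeta f \<longleftrightarrow>
     f holomorphic_on - {1} \<and>
     (\<forall>s. Re s > 1 \<longrightarrow> (\<lambda>n. 1 / of_nat (Suc n) powr s) sums f s) \<and>
     f 1 = 0"

definition zeta :: "complex \<Rightarrow> complex" where
  "zeta = (THE f. is_zeta f)"

lemma is_zeta_unique:
  assumes "is_zeta f" "is_zeta g"
  shows   "f = g"
proof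
  fix z
  show "f z = g z"
  proof (cases "z = 1")
    case True
    with assms show ?thesis by (simp add: is_zeta_def)
  next
    case False
    have hol: "(\<lambda>w. f w - g w) holomorphic_on - {1}"
      using assms by (auto simp: is_zeta_def intro!: holomorphic_intros)
    have conn: "connected (- {1 :: complex})"
      by (intro path_connected_imp_connected path_connected_punctured_universe) simp
    have "f z - g z = 0"
    proof (rule analytic_continuation_open[of "{s. Re s > 1}" "- {1}" "\<lambda>w. f w - g w" "\<lambda>_. 0"])
      show "open {s. Re s > 1}" by (simp add: open_halfspace_Re_gt)
      show "open (- {1 :: complex})" by auto
      show "{s. Re s > 1} \<noteq> {}" by (auto intro!: exI[of _ 2])
      show "connected (- {1 :: complex})" by (rule conn)
      show "{s. Re s > 1} \<subseteq> - {1 :: complex}" by auto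
      show "(\<lambda>w. f w - g w) holomorphic_on - {1}" by (rule hol)
      show "f s - g s = 0" if "s \<in> {s. Re s > 1}" for s
        using assms that by (auto simp: is_zeta_def dest: sums_unique2)
    qed (use False in auto)
    thus ?thesis by simp
  qed
qed

lemma zeta_eqI: "is_zeta f \<Longrightarrow> zeta = f"
  unfolding zeta_def by (rule the_equality) (auto intro: is_zeta_unique)

text \<open>
  \<open>stirling\<close> in the library is unsigned; the signed numbers are characterised by
  \<open>pochhammer_eq_sum_stirling1\<close> below.
\<close>
definition stirling1 :: "nat \<Rightarrow> nat \<Rightarrow> int" where
  "stirling1 k l = (- 1) ^ (k + l) * int (stirling k l)"

lemma stirling1_eq_0: "l > k \<Longrightarrow> stirling1 k l = 0"
  by (simp add: stirling1_def)

lemma pochhammer_eq_sum_stirling1: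
  fixes z :: "'a :: comm_ring_1"
  shows "pochhammer z k = (- 1) ^ k * (\<Sum>l=0..k. (- 1) ^ l * of_int (stirling1 k l) * z ^ l)"
proof -
  have "(\<Sum>l=0..k. (- 1) ^ l * of_int (stirling1 k l) * z ^ l) =
        (\<Sum>l=0..k. (- 1) ^ k * (of_nat (stirling k l) * z ^ l))"
    by (intro sum.cong refl)
       (simp add: stirling1_def power_add mult.assoc mult.left_commute flip: power_mult_distrib)
  also have "\<dots> = (- 1) ^ k * pochhammer z k"
    by (simp add: atLeast0AtMost stirling_pochhammer flip: sum_distrib_left)
  finally show ?thesis
    by (simp add: mult.assoc[symmetric] flip: power_mult_distrib)
qed

text \<open>
  \<open>bernpoly n x\<close> is \<open>n!\<close> times the \<open>n\<close>-th coefficient of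
  \<open>t * exp (x * t) / (exp t - 1)\<close> as a formal power series in \<open>t\<close>; the
  removable singularity at \<open>0\<close> is cancelled by the division of formal power series.
\<close>
definition bernpoly :: "nat \<Rightarrow> real \<Rightarrow> real" where
  "bernpoly n x = fact n * fps_nth (fps_X * fps_exp x / (fps_exp 1 - 1)) n"

lemma bernpoly_fps:
  "Abs_fps (\<lambda>n. of_real (bernpoly n x) / fact n) * (fps_exp 1 - 1) =
     fps_X * fps_exp (of_real x :: complex)"
proof -
  define B :: "real fps" where "B = fps_X * fps_exp x / (fps_exp 1 - 1)"
  have nz: "fps_exp 1 - 1 \<noteq> (0 :: real fps)"
    by (auto simp: fps_eq_iff intro!: exI[of _ 1])
  have "subdegree (fps_exp 1 - 1 :: real fps) = 1"
    by (rule subdegreeI) auto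
  hence "(fps_exp 1 - 1 :: real fps) dvd fps_X * fps_exp x"
    using nz by (subst fps_dvd_iff) auto
  hence "B * (fps_exp 1 - 1) = fps_X * fps_exp x"
    by (simp add: B_def)
  hence eq: "complex_of_real (fps_nth (B * (fps_exp 1 - 1)) n) =
             complex_of_real (fps_nth (fps_X * fps_exp x) n)" for n
    by simp
  have B: "of_real (bernpoly n x) / fact n = complex_of_real (fps_nth B n)" for n
    by (simp add: bernpoly_def B_def)
  show ?thesis
  proof (rule fps_ext)
    fix n
    have e: "complex_of_real (fps_nth (fps_exp 1 - 1) j) = fps_nth (fps_exp 1 - 1) j" for j
      by simp
    show "fps_nth (Abs_fps (\<lambda>n. of_real (bernpoly n x) / fact n) * (fps_exp 1 - 1)) n =
          fps_nth (fps_X * fps_exp (of_real x :: complex)) n"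
      using eq[of n] by (simp add: B fps_mult_nth e if_distrib[of complex_of_real] del: fps_sub_nth cong: if_cong)
  qed
qed

lemma bernpoly_sums:
  fixes t :: complex
  assumes "norm t < 2 * pi" "t \<noteq> 0"
  shows   "(\<lambda>n. of_real (bernpoly n x) / fact n * t ^ n) sums
             (t * exp (of_real x * t) / (exp t - 1))"
proof -
  define C where "C = Abs_fps (\<lambda>n. complex_of_real (bernpoly n x) / fact n)"
  define f where "f = (\<lambda>t::complex. if t = 0 then 1 else t * exp (of_real x * t) / (exp t - 1))"
  have nz: "fps_exp 1 - 1 \<noteq> (0 :: complex fps)"
    by (auto simp: fps_eq_iff intro!: exI[of _ 1])
  have sd: "subdegree (fps_exp 1 - 1 :: complex fps) = 1"
    by (rule subdegreeI) auto
  have C: "C = fps_X * fps_exp (of_real x) / (fps_exp 1 - 1)"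
    using nz by (simp add: C_def flip: bernpoly_fps)
  have f: "f has_fps_expansion C"
    unfolding f_def C using nz sd
    by (intro has_fps_expansion_divide fps_expansion_intros) auto
  have "exp z \<noteq> 1" if "norm z < 2 * pi" "z \<noteq> 0" for z :: complex
  proof
    assume "exp z = 1"
    then obtain n :: int where n: "Re z = 0" "Im z = of_int (2 * n) * pi"
      by (auto simp: exp_eq_1)
    hence "norm z = 2 * pi * \<bar>of_int n\<bar>"
      by (simp add: cmod_eq_Im abs_mult)
    with that(1) have "\<bar>real_of_int n\<bar> < 1" by simp
    hence "n = 0" by linarith
    with n that(2) show False by (simp add: complex_eq_iff)
  qed
  hence "f holomorphic_on ball 0 (2 * pi) - {0}"
    unfolding f_def
    by (subst holomorphic_cong[OF refl, of _ _ "\<lambda>t. t * exp (of_real x * t) / (exp t - 1)"])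
       (auto intro!: holomorphic_intros)
  moreover have "isCont f 0"
    using f by (rule has_fps_expansion_imp_continuous)
  ultimately have "f holomorphic_on eball 0 (ereal (2 * pi))"
    using no_isolated_singularity'[of "{0}" f "ball 0 (2 * pi)"]
    by (auto simp: isCont_def intro: tendsto_within_subset)
  hence "(\<lambda>n. fps_nth C n * t ^ n) sums f t"
    using has_fps_expansion_imp_sums_complex[OF f, of "ereal (2 * pi)" t] assms by simp
  thus ?thesis
    using assms by (simp add: C_def f_def)
qed

end

theory Submission
  imports Defs "HOL-Probability.Distributions" "HOL-Real_Asymp.Real_Asymp"
begin

text \<open>
  For \<open>l \<ge> 1\<close> put \<open>c\<^sub>l = (-1)\<^sup>l (m+1 choose l) B\<^sub>l(\<theta>) / (m+1)\<close>, with \<open>\<theta>\<close> the fractional part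
  of \<open>x\<close>. If \<open>\<Phi>(t) = \<Sum>\<^sub>l c\<^sub>l t^l / l!\<close>, the coefficients of \<open>\<Phi>(-log(1 - s))\<close> are
  the Stirling transforms of \<open>c\<close>
  divided by \<open>k!\<close>, and the inverse factorial series is \<open>x\<close> times the Laplace transform of \<open>\<Phi>\<close>,
  computed in the variable \<open>s = 1 - exp(-t)\<close>. A Beta integral writes \<open>\<Phi>\<close>, up to finitely many
  terms and derivatives, as an average over \<open>u \<in> [0,1]\<close> of \<open>g(u t)\<close> with
  \<open>g(w) = w exp(\<theta> w) / (exp w - 1)\<close>. As \<open>g\<close> grows slowly in a horizontal strip, Cauchy's formula
  on the circle of radius \<open>1 - 1/k\<close> bounds the coefficients by \<open>k powr (\<epsilon> - 1)\<close>, locally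
  uniformly in \<open>m\<close>. Hence the series converges for all \<open>x > 0\<close> to an entire function of \<open>m\<close>.
  For \<open>-3 < m < -2\<close> expanding \<open>g\<close> into exponentials evaluates it as the tail
  \<open>\<Sum>\<^sub>n\<^sub>>\<^sub>x n powr m\<close>. Analytic continuation in \<open>m\<close> gives the continuation of zeta
  (take \<open>x = 1\<close>) and the formula for all \<open>m \<noteq> -1\<close>; at \<open>m = -1\<close> one passes to the limit
  \<open>m \<rightarrow> -1\<close>, the constant being found from \<open>x \<rightarrow> \<infinity>\<close>. The terms with \<open>k \<le> a\<close> are split off by
  the recursion of the Stirling numbers, which telescopes.
\<close>

section \<open>Coefficients of functions of a logarithm\<close>

text \<open>The denominators \<open>pochhammer (x + 1) k\<close> exceed k! only by about k^x, and x
  may be arbitrarily small. A maximum estimate for the coefficients of \<Phi>(-log(1 - s)) gives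
  k^\<epsilon>, which is too weak by a full power of k. Two derivatives are therefore taken first:
  they divide the estimate by k^2, and the resulting 1/(1 - s)^2 has mean 1/(1 - r^2) over |s| = r,
  of order k, although its maximum is of order k^2. The map s -> -log(1 - s) sends the unit disc
  into |Im t| < pi/2 with Re t unbounded above, so \<Phi> is needed far outside its Taylor disc. The
  Beta integral supplies that continuation: the factor Gamma(l - 1 - m) of c_l, divided by (l + p)!,
  is a moment of a weight on [0,1], so only dilations of one fixed kernel remain. The strips are
  nested: half-width 2 holds the image of the disc, half-width 4 leaves room for Cauchy circles of
  radius 1, and half-width 5 still avoids the poles 2 pi i n with n nonzero. Dilation by u in [0,1]
  maps each strip into itself, so all bounds are uniform in u.\<close>

definition stirling_transform :: "(nat \<Rightarrow> 'a :: comm_semiring_1) \<Rightarrow> nat \<Rightarrow> 'a" where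
  "stirling_transform C k = (\<Sum>l\<le>k. of_nat (stirling k l) * C l)"

lemma stirling_transform_0 [simp]: "stirling_transform C 0 = C 0"
  by (simp add: stirling_transform_def)

text \<open>The recurrence of the Stirling numbers, summed. It serves twice: as the induction step
  for derivatives of a function of -log(1 - s), and as the relation that telescopes in
  \<open>factorial_series_shift\<close>.\<close>

lemma stirling_transform_Suc:
  "stirling_transform C (Suc k) =
     of_nat k * stirling_transform C k + stirling_transform (\<lambda>l. C (Suc l)) k"
proof -
  have "stirling_transform C (Suc k) =
          (\<Sum>l\<le>k. of_nat k * (of_nat (stirling k (Suc l)) * C (Suc l)) + of_nat (stirling k l) * C (Suc l))"
    by (simp add: stirling_transform_def sum.atMost_Suc_shift algebra_simps del: sum.atMost_Suc)
  also have "\<dots> = of_nat k * (\<Sum>l\<le>k. of_nat (stirling k (Suc l)) * C (Suc l)) + stirling_transform (\<lambda>l. C (Suc l)) k"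
    by (simp add: sum.distrib sum_distrib_left stirling_transform_def)
  also have "of_nat k * (\<Sum>l\<le>k. of_nat (stirling k (Suc l)) * C (Suc l)) = of_nat k * stirling_transform C k"
  \<comment> \<open>Shifting the index drops \<open>stirling k 0\<close>, which is 0 only for k > 0;
    for k = 0 the outer factor k makes both sides vanish.\<close>
  proof (cases k)
    case (Suc n)
    have "(\<Sum>l\<le>k. of_nat (stirling k l) * C l) = (\<Sum>l\<le>Suc k. of_nat (stirling k l) * C l)"
      by simp
    also have "\<dots> = (\<Sum>l\<le>k. of_nat (stirling k (Suc l)) * C (Suc l))"
      using Suc by (subst sum.atMost_Suc_shift) simp
    finally show ?thesis by (simp add: stirling_transform_def)
  qed auto
  finally show ?thesis .
qed

definition hstrip :: "real \<Rightarrow> complex set" where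
  "hstrip r = {t. \<bar>Im t\<bar> < r}"

lemma open_hstrip [intro, simp]: "open (hstrip r)"
  unfolding hstrip_def by (intro open_Collect_less continuous_intros)

lemma ball_subset_hstrip: "\<bar>Im t\<bar> + e \<le> r \<Longrightarrow> ball t e \<subseteq> hstrip r"
proof
  fix z assume *: "\<bar>Im t\<bar> + e \<le> r" "z \<in> ball t e"
  have "\<bar>Im (t - z)\<bar> < e"
    using abs_Im_le_cmod[of "t - z"] * unfolding mem_ball dist_norm by linarith
  thus "z \<in> hstrip r"
    using * by (simp add: hstrip_def)
qed

text \<open>1 - s has positive real part, so the imaginary part is even below pi/2; the round bound
  2 is all that is used later.\<close>

lemma neg_Ln_strip:
  assumes "norm s < 1"
  shows   "1 - s \<notin> \<real>\<^sub>\<le>\<^sub>0" "\<bar>Im (-Ln (1 - s))\<bar> < 2"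
proof -
  have re: "Re (1 - s) > 0"
    using complex_Re_le_cmod[of s] assms by simp
  thus "1 - s \<notin> \<real>\<^sub>\<le>\<^sub>0"
    by (auto simp: complex_nonpos_Reals_iff)
  have "\<bar>Im (Ln (1 - s))\<bar> < pi / 2"
    using re Re_Ln_pos_lt[of "1 - s"] by (metis complex.sel(1) less_irrefl zero_complex.code)
  thus "\<bar>Im (-Ln (1 - s))\<bar> < 2"
    using pi_less_4 by simp
qed

context
  fixes F :: "complex \<Rightarrow> complex"
  assumes hol: "F holomorphic_on hstrip 4"
begin

lemma has_field_derivative_comp_neg_Ln:
  assumes "norm s < 1"
  shows   "((\<lambda>s. (deriv ^^ a) F (-Ln (1 - s))) has_field_derivative
              (deriv ^^ Suc a) F (-Ln (1 - s)) / (1 - s)) (at s)"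
proof -
  have "(deriv ^^ a) F holomorphic_on hstrip 4"
    by (intro holomorphic_higher_deriv hol) auto
  moreover have "-Ln (1 - s) \<in> hstrip 4"
    using neg_Ln_strip[OF assms] by (simp add: hstrip_def)
  ultimately have *: "((deriv ^^ a) F has_field_derivative (deriv ^^ Suc a) F (-Ln (1 - s))) (at (-Ln (1 - s)))"
    using holomorphic_derivI[OF _ open_hstrip] by auto
  have "((\<lambda>s. -Ln (1 - s)) has_field_derivative 1 / (1 - s)) (at s)"
    by (rule derivative_eq_intros refl neg_Ln_strip assms | simp)+
       (use neg_Ln_strip[OF assms] in \<open>auto simp: divide_inverse\<close>)
  from DERIV_chain2[OF * this] show ?thesis
    by simp
qed

text \<open>With t = -log(1 - s) one has d/dt = (1 - s) d/ds, and (1 - s)^k (d/ds)^k is the rising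
  factorial D(D + 1)...(D + k - 1) in D = d/dt, whose coefficients are the unsigned Stirling
  numbers. The point s stays general because the induction differentiates in it.\<close>

lemma higher_deriv_comp_neg_Ln:
  assumes "norm s < 1"
  shows   "(deriv ^^ k) (\<lambda>s. (deriv ^^ a) F (-Ln (1 - s))) s =
             stirling_transform (\<lambda>l. (deriv ^^ (l + a)) F (-Ln (1 - s))) k / (1 - s) ^ k"
  using assms
proof (induction k arbitrary: s)
  case (Suc k)
  have nz: "1 - s \<noteq> 0" using neg_Ln_strip[OF Suc.prems] by auto
  \<comment> \<open>The quotient rule leaves the exponent \<open>k - 1\<close>, which truncates at k
    = 0; its factor k is 0 there.\<close>
  have *: "(A / d * d ^ k - B * - (of_nat k * d ^ (k - 1))) / (d ^ k * d ^ k) =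
             (of_nat k * B + A) / d ^ Suc k" if "d \<noteq> 0" for A B d :: complex
    using that by (cases k) (auto simp: field_simps)
  have ev: "eventually (\<lambda>s. norm s < 1) (nhds s)"
    using Suc.prems eventually_nhds_in_open[of "ball 0 1" s] by simp
  have "((\<lambda>s. stirling_transform (\<lambda>l. (deriv ^^ (l + a)) F (-Ln (1 - s))) k) has_field_derivative
          stirling_transform (\<lambda>l. (deriv ^^ (Suc l + a)) F (-Ln (1 - s)) / (1 - s)) k) (at s)"
    unfolding stirling_transform_def
    by (intro DERIV_sum DERIV_cmult) (use has_field_derivative_comp_neg_Ln[OF Suc.prems] in simp)
  moreover have "stirling_transform (\<lambda>l. (deriv ^^ (Suc l + a)) F (-Ln (1 - s)) / (1 - s)) k =
      stirling_transform (\<lambda>l. (deriv ^^ (Suc l + a)) F (-Ln (1 - s))) k / (1 - s)"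
    by (simp add: stirling_transform_def sum_divide_distrib)
  moreover have "((\<lambda>s. (1 - s) ^ k) has_field_derivative - (of_nat k * (1 - s) ^ (k - 1))) (at s)"
    by (rule derivative_eq_intros refl | simp)+
  ultimately have "((\<lambda>s. stirling_transform (\<lambda>l. (deriv ^^ (l + a)) F (-Ln (1 - s))) k / (1 - s) ^ k) has_field_derivative
       (stirling_transform (\<lambda>l. (deriv ^^ (Suc l + a)) F (-Ln (1 - s))) k / (1 - s) * (1 - s) ^ k - 
        stirling_transform (\<lambda>l. (deriv ^^ (l + a)) F (-Ln (1 - s))) k * - (of_nat k * (1 - s) ^ (k - 1))) / ((1 - s) ^ k * (1 - s) ^ k)) (at s)"
    using nz by (intro DERIV_divide) auto
  also have "(stirling_transform (\<lambda>l. (deriv ^^ (Suc l + a)) F (-Ln (1 - s))) k / (1 - s) * (1 - s) ^ k - 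
        stirling_transform (\<lambda>l. (deriv ^^ (l + a)) F (-Ln (1 - s))) k * - (of_nat k * (1 - s) ^ (k - 1))) / ((1 - s) ^ k * (1 - s) ^ k)
      = stirling_transform (\<lambda>l. (deriv ^^ (l + a)) F (-Ln (1 - s))) (Suc k) / (1 - s) ^ Suc k"
    using *[OF nz] by (simp add: stirling_transform_Suc)
  finally have D: "((\<lambda>s. stirling_transform (\<lambda>l. (deriv ^^ (l + a)) F (-Ln (1 - s))) k / (1 - s) ^ k) has_field_derivative
      stirling_transform (\<lambda>l. (deriv ^^ (l + a)) F (-Ln (1 - s))) (Suc k) / (1 - s) ^ Suc k) (at s)" .
  have "(deriv ^^ Suc k) (\<lambda>s. (deriv ^^ a) F (-Ln (1 - s))) s =
          deriv (\<lambda>s. stirling_transform (\<lambda>l. (deriv ^^ (l + a)) F (-Ln (1 - s))) k / (1 - s) ^ k) s"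
    unfolding funpow.simps o_def
    by (intro deriv_cong_ev eventually_mono[OF ev] Suc.IH refl) auto
  also have "\<dots> = stirling_transform (\<lambda>l. (deriv ^^ (l + a)) F (-Ln (1 - s))) (Suc k) / (1 - s) ^ Suc k"
    by (rule DERIV_imp_deriv[OF D])
  finally show ?case .
qed simp

text \<open>Taylor expansion in s on the unit disc: on exponential generating functions, the
  Stirling transform is composition with -log(1 - s).\<close>

lemma sums_comp_neg_Ln:
  assumes "norm s < 1"
  shows   "(\<lambda>k. stirling_transform (\<lambda>l. (deriv ^^ l) F 0) k / fact k * s ^ k) sums F (-Ln (1 - s))"
proof -
  have "(\<lambda>s. F (-Ln (1 - s))) holomorphic_on ball 0 1"
    using has_field_derivative_comp_neg_Ln[where a = 0, unfolded funpow_0]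
    by (subst holomorphic_on_open) (fastforce simp del: funpow.simps)+
  from holomorphic_power_series[OF this, of s] show ?thesis
    using higher_deriv_comp_neg_Ln[of 0 _ 0] assms by simp
qed

end

text \<open>On the circle \<open>cnj s = r\<^sup>2 / s\<close>, which turns the mean value into a Cauchy integral.\<close>
lemma has_integral_inverse_norm_square_circle:
  assumes "0 < r" "r < 1"
  shows   "((\<lambda>x. 1 / norm (1 - circlepath 0 r x) ^ 2) has_integral 1 / (1 - r\<^sup>2)) {0..1}"
proof -
  have r2: "r\<^sup>2 < r" using assms by (simp add: power2_eq_square)
  have nz: "1 - u \<noteq> 0" if "norm u \<le> r" for u :: complex
    using that assms by auto
  have "((\<lambda>u. (1 / (1 - u)) / (u - of_real (r\<^sup>2))) has_contour_integral
           (2 * of_real pi * \<i> * (1 / (1 - of_real (r\<^sup>2))))) (circlepath 0 r)"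
    using nz assms r2
    by (intro Cauchy_integral_circlepath continuous_intros holomorphic_intros)
       (auto simp: norm_power)
  hence "((\<lambda>x. 1 / (1 - circlepath 0 r x) / (circlepath 0 r x - of_real (r\<^sup>2)) *
           (2 * pi * \<i> * r * exp (2 * of_real pi * \<i> * x))) has_integral
           (2 * of_real pi * \<i> * (1 / (1 - of_real (r\<^sup>2))))) {0..1}"
    unfolding has_contour_integral_def
    by (rule has_integral_eq[rotated]) (simp add: vector_derivative_circlepath01)
  hence "((\<lambda>x. 1 / (1 - circlepath 0 r x) / (circlepath 0 r x - of_real (r\<^sup>2)) *
           (2 * pi * \<i> * r * exp (2 * of_real pi * \<i> * x)) / (2 * of_real pi * \<i>)) has_integral
           (2 * of_real pi * \<i> * (1 / (1 - of_real (r\<^sup>2)))) / (2 * of_real pi * \<i>)) {0..1}"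
    by (rule has_integral_divide)
  also have "(2 * of_real pi * \<i> * (1 / (1 - of_real (r\<^sup>2)))) / (2 * of_real pi * \<i>) =
               complex_of_real (1 / (1 - r\<^sup>2))"
    by simp
  also have "((\<lambda>x. 1 / (1 - circlepath 0 r x) / (circlepath 0 r x - of_real (r\<^sup>2)) *
           (2 * pi * \<i> * r * exp (2 * of_real pi * \<i> * x)) / (2 * of_real pi * \<i>)) has_integral
           complex_of_real (1 / (1 - r\<^sup>2))) {0..1} \<longleftrightarrow> ((\<lambda>x. complex_of_real (1 / norm (1 - circlepath 0 r x) ^ 2)) has_integral
               complex_of_real (1 / (1 - r\<^sup>2))) {0..1}"
  proof (rule has_integral_cong)
    fix x :: real
    define s where "s = circlepath 0 r x"
    define e where "e = exp (2 * of_real pi * \<i> * x)"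
    have s: "s = r * e" by (simp add: s_def e_def circlepath)
    have ns: "norm s = r" using assms by (simp add: s norm_mult e_def norm_exp_eq_Re)
    have s0: "s \<noteq> 0" using assms by (simp add: s e_def)
    have cs: "cnj s = r\<^sup>2 / s"
      using complex_norm_square[of s] s0 ns by (simp add: field_simps)
    have "s - of_real (r\<^sup>2) = s * cnj (1 - s)"
      using s0 by (simp add: cs field_simps)
    moreover have "1 / u / (s * v) * s = 1 / (u * v)" for u v
      using s0 by simp
    ultimately have "1 / (1 - s) / (s - of_real (r\<^sup>2)) * s = 1 / ((1 - s) * cnj (1 - s))"
      by (simp only:)
    also have "\<dots> = of_real (1 / norm (1 - s) ^ 2)"
      by (subst complex_norm_square[symmetric]) simp
    finally show "1 / (1 - circlepath 0 r x) / (circlepath 0 r x - of_real (r\<^sup>2)) *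
           (2 * pi * \<i> * r * exp (2 * of_real pi * \<i> * x)) / (2 * of_real pi * \<i>) =
           complex_of_real (1 / norm (1 - circlepath 0 r x) ^ 2)"
      by (simp add: s_def[symmetric] e_def[symmetric]) (simp add: s)
  qed
  finally show ?thesis
    by (drule_tac has_integral_Re) (simp only: Re_complex_of_real)
qed

text \<open>The Cauchy estimate with the mean of 1/|1 - s|^2 in place of its maximum, so that 1/(1 -
  r^2) appears instead of 1/(1 - r)^2.\<close>

lemma norm_higher_deriv_le_double_pole:
  assumes hol: "f holomorphic_on ball 0 1" and r: "0 < r" "r < 1"
  assumes bd: "\<And>s. norm s = r \<Longrightarrow> norm (f s) \<le> B / norm (1 - s) ^ 2"
  shows   "norm ((deriv ^^ n) f 0) \<le> fact n * B / (r ^ n * (1 - r\<^sup>2))"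
proof -
  define D where "D = (deriv ^^ n) f 0"
  have sub: "cball 0 r \<subseteq> ball (0::complex) 1" using r by auto
  have "((\<lambda>u. f u / (u - 0) ^ Suc n) has_contour_integral (2 * pi * \<i> / fact n * D)) (circlepath 0 r)"
    unfolding D_def using r sub
    by (intro Cauchy_has_contour_integral_higher_derivative_circlepath
              holomorphic_on_imp_continuous_on holomorphic_on_subset[OF hol]) auto
  hence "((\<lambda>x. f (circlepath 0 r x) / (circlepath 0 r x) ^ Suc n * (2 * pi * \<i> * r * exp (2 * of_real pi * \<i> * x)))
           has_integral (2 * pi * \<i> / fact n * D)) {0..1}"
    unfolding has_contour_integral_def
    by (rule has_integral_eq[rotated]) (simp add: vector_derivative_circlepath01)
  hence int: "((\<lambda>x. 2 * pi * \<i> * (f (circlepath 0 r x) / (circlepath 0 r x) ^ n))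
           has_integral (2 * pi * \<i> / fact n * D)) {0..1}"
    by (rule has_integral_eq[rotated]) (use r in \<open>simp add: circlepath\<close>)
  have int2: "((\<lambda>x. 2 * pi * B / r ^ n * (1 / norm (1 - circlepath 0 r x) ^ 2)) has_integral
           2 * pi * B / r ^ n * (1 / (1 - r\<^sup>2))) {0..1}"
    by (intro has_integral_mult_right has_integral_inverse_norm_square_circle r)
  have "norm (2 * pi * \<i> / fact n * D) \<le> 2 * pi * B / r ^ n * (1 / (1 - r\<^sup>2))"
    unfolding integral_unique[OF int, symmetric] integral_unique[OF int2, symmetric]
  proof (rule integral_norm_bound_integral)
    fix x :: real assume "x \<in> {0..1}"
    have ns: "norm (circlepath 0 r x) = r"
      using r by (simp add: circlepath norm_mult norm_exp_eq_Re)
    have "norm (2 * pi * \<i> * (f (circlepath 0 r x) / (circlepath 0 r x) ^ n)) =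
            2 * pi / r ^ n * norm (f (circlepath 0 r x))"
      by (simp add: norm_mult norm_divide norm_power ns)
    also have "\<dots> \<le> 2 * pi / r ^ n * (B / norm (1 - circlepath 0 r x) ^ 2)"
      using r by (intro mult_left_mono bd ns) auto
    finally show "norm (2 * pi * \<i> * (f (circlepath 0 r x) / (circlepath 0 r x) ^ n)) \<le>
            2 * pi * B / r ^ n * (1 / norm (1 - circlepath 0 r x) ^ 2)"
      by simp
  qed (use int int2 in auto)
  also have "norm (2 * pi * \<i> / fact n * D) = 2 * pi / fact n * norm D"
    by (simp add: norm_mult norm_divide)
  finally have "fact n / (2 * pi) * (2 * pi / fact n * norm D) \<le>
                  fact n / (2 * pi) * (2 * pi * B / r ^ n * (1 / (1 - r\<^sup>2)))"
    by (intro mult_left_mono) auto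
  thus ?thesis
    by (simp add: D_def)
qed

text \<open>With j = k - 1 the value is (1 + 1/j)^(-j), hence at least 1/e.\<close>

lemma one_minus_inverse_power_ge:
  assumes "k \<ge> (2 :: nat)"
  shows   "(1 - 1 / real k) ^ (k - 1) \<ge> 1 / 3"
proof -
  obtain j where j: "k = Suc j" "j > 0" using assms by (cases k) auto
  have "(1 + 1 / real j) ^ j \<le> exp (1 / real j) ^ j"
    by (intro power_mono) auto
  also have "\<dots> = exp 1"
    using j by (simp flip: exp_of_nat_mult)
  also have "\<dots> \<le> 3" by (rule exp_le)
  finally have "(1 + 1 / real j) ^ j \<le> 3" .
  moreover have "1 - 1 / real k = inverse (1 + 1 / real j)"
    using j by (simp add: field_simps)
  ultimately show ?thesis
    using j by (simp add: power_inverse field_simps add_pos_pos)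
qed

text \<open>The constant collects (a + 2)! and e from Cauchy circles of radius 1, 4 from
  2^\<epsilon> \<le> 2 and from the two summands of the second derivative, 3 from (1 - 1/k)^(k - 1)
  \<ge> 1/3, and 2 from k \<le> 2(k - 1).\<close>

lemma norm_stirling_transform_le:
  assumes hol: "F holomorphic_on hstrip 4"
  assumes bd: "\<And>t. t \<in> hstrip 4 \<Longrightarrow> norm (F t) \<le> A * exp (\<epsilon> * \<bar>Re t\<bar>)"
  assumes \<epsilon>: "0 < \<epsilon>" "\<epsilon> \<le> 1" and k: "k > 0"
  shows   "norm (stirling_transform (\<lambda>l. (deriv ^^ (l + a)) F 0) k) \<le>
             24 * exp 1 * fact (a + 2) * A * fact k * real k powr (\<epsilon> - 1)"
proof -
  have A: "A \<ge> 0"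
    using order_trans[OF norm_ge_zero bd[of 0]] by (simp add: hstrip_def)
  have bd': "norm ((deriv ^^ n) F t) \<le> fact n * A * exp 1 * exp (\<epsilon> * \<bar>Re t\<bar>)" if t: "\<bar>Im t\<bar> \<le> 2" for n t
  proof -
    \<comment> \<open>Circles of radius 1 about points with |Im t| \<le> 2 stay within |Im| \<le> 3,
      and moving Re t by 1 costs at most exp \<epsilon> \<le> e.\<close>
    have sub: "cball t 1 \<subseteq> hstrip 4"
      using ball_subset_hstrip[of t "3/2" 4] t by force
    have "norm ((deriv ^^ n) F t) \<le> fact n * (A * exp 1 * exp (\<epsilon> * \<bar>Re t\<bar>)) / 1 ^ n"
    proof (rule Cauchy_inequality)
      show "F holomorphic_on ball t 1"
        using sub by (intro holomorphic_on_subset[OF hol]) auto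
      show "continuous_on (cball t 1) F"
        using sub by (intro holomorphic_on_imp_continuous_on holomorphic_on_subset[OF hol]) auto
      fix z assume z: "norm (t - z) = 1"
      have "\<bar>Re z\<bar> \<le> \<bar>Re t\<bar> + 1"
        using abs_Re_le_cmod[of "t - z"] z by auto
      hence "\<epsilon> * \<bar>Re z\<bar> \<le> \<epsilon> * (\<bar>Re t\<bar> + 1)"
        using \<epsilon> by (intro mult_left_mono) auto
      also have "\<dots> \<le> 1 + \<epsilon> * \<bar>Re t\<bar>"
        using \<epsilon> by (simp add: algebra_simps)
      finally have "exp (\<epsilon> * \<bar>Re z\<bar>) \<le> exp 1 * exp (\<epsilon> * \<bar>Re t\<bar>)"
        by (simp flip: exp_add)
      moreover have "z \<in> hstrip 4"
        using sub z by (auto simp: dist_norm)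
      ultimately show "norm (F z) \<le> A * exp 1 * exp (\<epsilon> * \<bar>Re t\<bar>)"
        using A order_trans[OF bd[of z] mult_left_mono[of _ "exp 1 * exp (\<epsilon> * \<bar>Re t\<bar>)" A]]
        by (simp add: mult_ac)
    qed auto
    thus ?thesis by (simp add: mult_ac)
  qed
  show ?thesis
  \<comment> \<open>Two of the k derivatives are split off below, so k = 1 is settled directly by
    one derivative at 0.\<close>
  proof (cases "k = 1")
    case True
    have "norm ((deriv ^^ Suc a) F 0) \<le> 1 * (exp 1 * A) * fact (Suc a)"
      using bd'[of 0 "Suc a"] by (simp add: mult_ac del: funpow.simps fact_Suc)
    also have "\<dots> \<le> 24 * (exp 1 * A) * fact (a + 2)"
      using A by (intro mult_mono fact_mono) auto
    finally show ?thesis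
      using True by (simp add: stirling_transform_def mult_ac del: funpow.simps fact_Suc)
  next
    case False
    then obtain n where n: "k = n + 2"
      using k by (intro that[of "k - 2"]) auto
    define r where "r = 1 - 1 / real k"
    have r: "0 < r" "r < 1" using n by (auto simp: r_def field_simps)
    define \<psi> where "\<psi> = (\<lambda>s. (deriv ^^ a) F (-Ln (1 - s)))"
    have hol\<psi>: "\<psi> holomorphic_on ball 0 1"
      unfolding \<psi>_def using has_field_derivative_comp_neg_Ln[OF hol, of _ a]
      by (subst holomorphic_on_open) (fastforce simp del: funpow.simps)+
    define B where "B = 4 * exp 1 * fact (a + 2) * A * real k powr \<epsilon>"
    have "norm ((deriv ^^ n) ((deriv ^^ 2) \<psi>) 0) \<le> fact n * B / (r ^ n * (1 - r\<^sup>2))"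
    proof (rule norm_higher_deriv_le_double_pole)
      show "(deriv ^^ 2) \<psi> holomorphic_on ball 0 1"
        by (intro holomorphic_higher_deriv hol\<psi>) auto
      fix s :: complex assume s: "norm s = r"
      hence s1: "norm s < 1" using r by simp
      have "1 - r \<le> norm (1 - s)" "norm (1 - s) \<le> 2"
        using norm_triangle_ineq2[of 1 s] norm_triangle_ineq4[of 1 s] s r by auto
      hence ns: "1 / real k \<le> norm (1 - s)" "norm (1 - s) \<le> 2" by (auto simp: r_def)
      have pos: "norm (1 - s) > 0" using ns k by (meson divide_pos_pos less_le_trans of_nat_0_less_iff zero_less_one)
      \<comment> \<open>Since |1 - s| lies between 1/k and 2, exponential growth in Re t turns into
        the mere power k^\<epsilon> on this circle.\<close>
      have "\<bar>Re (-Ln (1 - s))\<bar> = \<bar>ln (norm (1 - s))\<bar>"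
        using pos by (simp add: Re_Ln)
      also have "\<dots> \<le> ln (2 * real k)"
      proof -
        have "ln (norm (1 - s)) \<le> ln (2 * real k)"
          using ns pos k by (subst ln_le_cancel_iff) auto
        moreover have "ln (1 / (2 * real k)) \<le> ln (norm (1 - s))"
          using ns pos k by (subst ln_le_cancel_iff) (auto simp: field_simps)
        hence "- ln (2 * real k) \<le> ln (norm (1 - s))"
          using k by (simp add: ln_div)
        ultimately show ?thesis by linarith
      qed
      finally have "exp (\<epsilon> * \<bar>Re (-Ln (1 - s))\<bar>) \<le> exp (\<epsilon> * ln (2 * real k))"
        using \<epsilon> by simp
      also have "\<dots> = 2 powr \<epsilon> * real k powr \<epsilon>"
        using k by (simp add: powr_def ln_mult ring_distribs flip: exp_add)
      also have "2 powr \<epsilon> \<le> (2 powr 1 :: real)"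
        using \<epsilon> by (intro powr_mono) auto
      finally have e: "exp (\<epsilon> * \<bar>Re (-Ln (1 - s))\<bar>) \<le> 2 * real k powr \<epsilon>"
        by (simp add: mult_right_mono)
      have b: "norm ((deriv ^^ m) F (-Ln (1 - s))) \<le> 2 * exp 1 * fact (a + 2) * A * real k powr \<epsilon>"
        if "m \<le> a + 2" for m
      proof -
        have "norm ((deriv ^^ m) F (-Ln (1 - s))) \<le> fact m * A * exp 1 * exp (\<epsilon> * \<bar>Re (-Ln (1 - s))\<bar>)"
          using neg_Ln_strip[OF s1] by (intro bd') auto
        also have "\<dots> \<le> fact (a + 2) * A * exp 1 * (2 * real k powr \<epsilon>)"
          using A that by (intro mult_mono e fact_mono) auto
        finally show ?thesis by (simp only: mult_ac)
      qed
      \<comment> \<open>For two derivatives the rising factorial is D(D + 1), so exactly the orders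
        a + 1 and a + 2 occur.\<close>
      have "(deriv ^^ 2) \<psi> s = ((deriv ^^ Suc a) F (-Ln (1 - s)) + (deriv ^^ Suc (Suc a)) F (-Ln (1 - s))) / (1 - s) ^ 2"
        unfolding \<psi>_def using s1
        by (subst higher_deriv_comp_neg_Ln[OF hol])
           (auto simp: eval_nat_numeral stirling_transform_Suc simp del: funpow.simps)
      also have "norm \<dots> \<le> (norm ((deriv ^^ Suc a) F (-Ln (1 - s))) + norm ((deriv ^^ Suc (Suc a)) F (-Ln (1 - s)))) / norm (1 - s) ^ 2"
        unfolding norm_divide norm_power
        by (intro divide_right_mono norm_triangle_ineq) auto
      also have "\<dots> \<le> B / norm (1 - s) ^ 2"
        using b[of "Suc a"] b[of "Suc (Suc a)"]
        by (intro divide_right_mono) (auto simp: B_def simp del: funpow.simps)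
      finally show "norm ((deriv ^^ 2) \<psi> s) \<le> B / norm (1 - s) ^ 2" .
    qed (use r in auto)
    also have "(deriv ^^ n) ((deriv ^^ 2) \<psi>) 0 = (deriv ^^ k) \<psi> 0"
      unfolding n funpow_add o_def by simp
    also have "\<dots> = stirling_transform (\<lambda>l. (deriv ^^ (l + a)) F 0) k"
      unfolding \<psi>_def by (subst higher_deriv_comp_neg_Ln[OF hol]) auto
    also have "fact n * B / (r ^ n * (1 - r\<^sup>2)) \<le> fact n * B / (1 / 3 * (1 / real k))"
    proof (intro divide_left_mono mult_mono mult_pos_pos)
      have "1 / 3 \<le> r ^ (k - 1)" unfolding r_def using n by (intro one_minus_inverse_power_ge) auto
      also have "\<dots> \<le> r ^ n" using r by (intro power_decreasing) (auto simp: n)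
      finally show "1 / 3 \<le> r ^ n" .
      have "1 / real k * 1 \<le> (1 - r) * (1 + r)"
        unfolding r_def using n by (intro mult_mono) (auto simp: field_simps)
      thus "1 / real k \<le> 1 - r\<^sup>2"
        by (simp add: algebra_simps power2_eq_square)
      show "0 < r ^ n" "0 < 1 - r\<^sup>2" "0 < 1 / real k"
        using r n by (auto simp: power2_eq_square) (metis less_1_mult mult_strict_mono' less_eq_real_def mult_1)+
      show "0 \<le> fact n * B" using A by (auto simp: B_def)
    qed (use r in auto)
    also have "\<dots> = 12 * exp 1 * fact (a + 2) * A * (fact n * real k) * real k powr \<epsilon>"
      by (simp add: B_def)
    also have "fact n * real k \<le> 2 * fact k / real k"
    proof -
      have "fact k = real k * (real (Suc n) * fact n)" by (simp add: n)
      moreover have "real k * fact n \<le> 2 * (real (Suc n) * fact n)"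
        by (simp add: n algebra_simps)
      ultimately show ?thesis using k by simp
    qed
    finally show ?thesis
      using A k by (simp add: powr_diff mult_left_mono mult_right_mono divide_right_mono mult_ac)
  qed
qed

section \<open>Inverse factorial series\<close>

text \<open>The true growth of \<open>pochhammer (x + 1) k / fact k\<close> is like k^x. This
  smaller exponent lies in (0, 1), so its half is an admissible \<epsilon>, and it allows a
  comparison factor by factor.\<close>

definition decay_exponent :: "real \<Rightarrow> real" where
  "decay_exponent x = x / (x + 1)"

lemma decay_exponent_bounds: "x > 0 \<Longrightarrow> 0 < decay_exponent x" "x > 0 \<Longrightarrow> decay_exponent x < 1"
  by (auto simp: decay_exponent_def)

text \<open>Each factor satisfies (1 + 1/j)^d \<le> 1 + x/j, because d/j \<le> x/(x + j) \<le> ln(1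
  + x/j).\<close>

lemma fact_le_pochhammer:
  assumes x: "x > (0::real)"
  shows   "fact k * real (Suc k) powr decay_exponent x \<le> pochhammer (x + 1) k"
proof (induction k)
  case (Suc k)
  define d where "d = decay_exponent x"
  define j where "j = real (Suc k)"
  have j: "j \<ge> 1" by (simp add: j_def)
  have "ln (1 + 1 / j) \<le> 1 / j"
    using j by (intro ln_add_one_self_le_self) auto
  hence "d * ln (1 + 1 / j) \<le> d * (1 / j)"
    using decay_exponent_bounds[OF x] by (intro mult_left_mono) (auto simp: d_def)
  also have "\<dots> = x / (j * x + j)"
    by (simp add: d_def decay_exponent_def field_simps)
  also have "\<dots> \<le> x / (x + j)"
    using x j mult_right_mono[of 1 j x] by (intro divide_left_mono) (auto intro!: mult_pos_pos add_pos_pos)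
  also have "\<dots> = 1 - j / (j + x)"
    using x j by (simp add: field_simps)
  also have "\<dots> \<le> - ln (j / (j + x))"
    using ln_le_minus_one[of "j / (j + x)"] x j by simp
  also have "\<dots> = ln (1 + x / j)"
    using x j by (simp add: ln_div add_divide_distrib[symmetric] field_simps)
  finally have "exp (d * ln (1 + 1 / j)) \<le> exp (ln (1 + x / j))" by simp
  hence "(1 + 1 / j) powr d \<le> 1 + x / j"
    using x j by (simp add: powr_def add_pos_pos)
  hence "(1 + 1 / j) powr d * j \<le> (1 + x / j) * j"
    using j by (intro mult_right_mono) auto
  hence *: "(1 + 1 / j) powr d * j \<le> x + 1 + real k"
    using j by (simp add: distrib_right j_def)
  have "real (Suc (Suc k)) = j * (1 + 1 / j)"
    using j by (simp add: field_simps j_def)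
  hence "real (Suc (Suc k)) powr d = j powr d * (1 + 1 / j) powr d"
    using j by (simp only:) (subst powr_mult, auto)
  hence "fact (Suc k) * real (Suc (Suc k)) powr d = (fact k * j powr d) * ((1 + 1 / j) powr d * j)"
    by (simp only: fact_Suc j_def of_nat_mult mult_ac)
  also have "\<dots> \<le> pochhammer (x + 1) k * (x + 1 + real k)"
    using Suc.IH j x by (intro mult_mono *) (auto simp: d_def j_def intro!: pochhammer_nonneg)
  finally show ?case
    by (simp add: pochhammer_Suc d_def)
qed auto

text \<open>With d the decay exponent and \<epsilon> = d/2, the growth k^d of the denominator
  against k^(d/2 - 1) leaves the summable k^(-1 - d/2).\<close>

lemma norm_div_pochhammer_le:
  fixes e :: "'a :: real_normed_field"
  assumes x: "x > 0" and k: "k > 0"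
  assumes e: "norm e \<le> K * fact k * real k powr (decay_exponent x / 2 - 1)"
  shows   "norm (e / of_real (pochhammer (x + 1) k)) \<le> K * real k powr (-1 - decay_exponent x / 2)"
proof -
  define d where "d = decay_exponent x"
  have d: "d > 0" using decay_exponent_bounds x by (simp add: d_def)
  have pp: "pochhammer (x + 1) k > 0" using x by (intro pochhammer_pos) auto
  have "0 \<le> K * (fact k * real k powr (d / 2 - 1))"
    using order_trans[OF norm_ge_zero e] by (simp add: d_def mult_ac)
  moreover have "fact k * real k powr (d / 2 - 1) > 0"
    using k by simp
  ultimately have K: "K \<ge> 0"
    by (metis zero_le_mult_iff not_le)
  have "fact k * real k powr d \<le> fact k * real (Suc k) powr d"
    using d by (intro mult_left_mono powr_mono2) auto
  also have "\<dots> \<le> pochhammer (x + 1) k"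
    unfolding d_def by (rule fact_le_pochhammer[OF x])
  finally have *: "fact k * real k powr d \<le> pochhammer (x + 1) k" .
  have "norm (e / of_real (pochhammer (x + 1) k)) = norm e / pochhammer (x + 1) k"
    using pp by (simp add: norm_divide)
  also have "\<dots> \<le> K * fact k * real k powr (d / 2 - 1) / pochhammer (x + 1) k"
    using pp e by (intro divide_right_mono) (auto simp: d_def)
  also have "\<dots> \<le> K * fact k * real k powr (d / 2 - 1) / (fact k * real k powr d)"
    using * pp K k by (intro divide_left_mono mult_pos_pos) auto
  also have "\<dots> = K * (real k powr (d / 2 - 1) / real k powr d)"
    by simp
  also have "real k powr (d / 2 - 1) / real k powr d = real k powr (-1 - d / 2)"
    by (subst powr_diff[symmetric]) (simp add: algebra_simps)
  finally show ?thesis by (simp add: d_def)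
qed

text \<open>Every \<epsilon> is demanded because a small x tolerates only a small
  \<epsilon>.\<close>

definition tame :: "(nat \<Rightarrow> 'a :: real_normed_field) \<Rightarrow> bool" where
  "tame C \<longleftrightarrow> (\<forall>\<epsilon>. 0 < \<epsilon> \<longrightarrow> \<epsilon> \<le> 1 \<longrightarrow>
     (\<exists>K. \<forall>k>0. norm (stirling_transform C k) \<le> K * fact k * real k powr (\<epsilon> - 1)))"

lemma summable_decay: "x > 0 \<Longrightarrow> summable (\<lambda>k. K * real k powr (-1 - decay_exponent x / 2))"
  using decay_exponent_bounds(1)[of x] by (intro summable_mult) (simp add: summable_real_powr_iff)

text \<open>The term k = 0 contributes C 0; it is subtracted wherever a series beginning at k = 1 is
  wanted.\<close>

definition factorial_series :: "(nat \<Rightarrow> 'a :: real_normed_field) \<Rightarrow> real \<Rightarrow> 'a" where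
  "factorial_series C x = (\<Sum>k. stirling_transform C k / of_real (pochhammer (x + 1) k))"

lemma tameE:
  fixes C :: "nat \<Rightarrow> 'a :: real_normed_field"
  assumes "tame C" "x > 0"
  obtains K where "\<And>k. k > 0 \<Longrightarrow> norm (stirling_transform C k / of_real (pochhammer (x + 1) k))
     \<le> K * real k powr (-1 - decay_exponent x / 2)"
proof -
  from assms decay_exponent_bounds[OF assms(2)] obtain K where
    "\<forall>k>0. norm (stirling_transform C k) \<le> K * fact k * real k powr (decay_exponent x / 2 - 1)"
    by (auto simp: tame_def dest!: spec[of _ "decay_exponent x / 2"])
  thus ?thesis
    using norm_div_pochhammer_le[OF assms(2)] by (intro that[of K]) blast
qed

lemma tame_summable_norm:
  assumes "tame C" "x > 0"
  shows   "summable (\<lambda>k. norm (stirling_transform C k / of_real (pochhammer (x + 1) k)))"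
proof -
  obtain K where "\<And>k. k > 0 \<Longrightarrow> norm (stirling_transform C k / of_real (pochhammer (x + 1) k))
     \<le> K * real k powr (-1 - decay_exponent x / 2)"
    using tameE[OF assms] by metis
  thus ?thesis
    by (intro summable_comparison_test_ev[OF _ summable_decay[OF assms(2), of K]])
       (auto intro!: eventually_mono[OF eventually_gt_at_top[of 0]])
qed

lemma sums_factorial_series:
  fixes C :: "nat \<Rightarrow> 'a :: {real_normed_field, banach}"
  assumes "tame C" "x > 0"
  shows   "(\<lambda>k. stirling_transform C k / of_real (pochhammer (x + 1) k)) sums factorial_series C x"
  unfolding factorial_series_def
  by (rule summable_sums[OF summable_norm_cancel[OF tame_summable_norm[OF assms]]])

lemma sums_factorial_series_Suc:
  fixes C :: "nat \<Rightarrow> 'a :: {real_normed_field, banach}"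
  assumes "tame C" "x > 0"
  shows   "(\<lambda>n. stirling_transform C (Suc n) / of_real (pochhammer (x + 1) (Suc n))) sums
             (factorial_series C x - C 0)"
  using sums_factorial_series[OF assms] by (subst sums_Suc_iff) simp

text \<open>On the Laplace side this is the rule for the transform of a derivative. It is obtained
  by telescoping, so convergence of the shifted series comes out as part of the conclusion.\<close>

lemma factorial_series_shift:
  fixes C :: "nat \<Rightarrow> 'a :: {real_normed_field, banach}"
  assumes tame: "tame C" and x: "x > 0"
  shows   "(\<lambda>k. stirling_transform (\<lambda>l. C (Suc l)) k / of_real (pochhammer (x + 1) k)) sums
             (of_real x * (factorial_series C x - C 0))"
proof -
  define e where "e = stirling_transform C"
  define e' where "e' = stirling_transform (\<lambda>l. C (Suc l))"
  define p where "p = (\<lambda>k. of_real (pochhammer (x + 1) k) :: 'a)"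
  have p0: "p k \<noteq> 0" for k
    using pochhammer_pos[of "x + 1" k] x by (auto simp: p_def)
  have pS: "p (Suc k) = p k * of_real (x + 1 + of_nat k)" for k
    unfolding p_def pochhammer_Suc by (rule of_real_mult)
  have nz: "of_real (x + 1 + of_nat k) \<noteq> (0 :: 'a)" for k
    unfolding of_real_eq_0_iff using x by linarith
  have eS: "e' k = e (Suc k) - of_nat k * e k" for k
    by (simp add: e_def e'_def stirling_transform_Suc)
  \<comment> \<open>Summation by parts from e'_k = e_(k+1) - k e_k and p_(k+1) = p_k (x + k + 1);
    the last summand is the boundary term.\<close>
  have tele: "(\<Sum>k<Suc n. e' k / p k) = of_real x * ((\<Sum>k<Suc n. e k / p k) - C 0) +
                of_real (x + of_nat (Suc n)) * (e (Suc n) / p (Suc n))" for n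
  proof (induction n)
    case 0
    show ?case using nz[of 0] by (simp add: eS pS p0) (simp add: e_def p_def)
  next
    case (Suc n)
    have "e' (Suc n) / p (Suc n) = e (Suc (Suc n)) / p (Suc n) - of_nat (Suc n) * (e (Suc n) / p (Suc n))"
      by (simp add: eS diff_divide_distrib)
    also have "e (Suc (Suc n)) / p (Suc n) = of_real (x + of_nat (Suc (Suc n))) * (e (Suc (Suc n)) / p (Suc (Suc n)))"
      unfolding pS[of "Suc n"] using nz[of "Suc n"] p0[of "Suc n"]
      by (simp add: add_ac del: of_real_add)
    finally have "e' (Suc n) / p (Suc n) = of_real (x + of_nat (Suc (Suc n))) * (e (Suc (Suc n)) / p (Suc (Suc n))) -
                    of_nat (Suc n) * (e (Suc n) / p (Suc n))" .
    moreover have "X * (S - c) + (X + N) * q + (R - N * q) = X * (S + q - c) + R" for X S c N q R :: 'a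
      by (simp add: algebra_simps)
    moreover have "of_real (x + real (Suc n)) = of_real x + (of_nat (Suc n) :: 'a)"
      by simp
    ultimately show ?case
      by (simp only: sum.lessThan_Suc[of _ "Suc n"] Suc.IH)
  qed
  \<comment> \<open>The terms are of order n^(-1 - d/2) with d the decay exponent, so a factor n
    still leaves a negative exponent.\<close>
  have "(\<lambda>n. of_real (x + of_nat n) * (e n / p n)) \<longlonglongrightarrow> 0"
  proof -
    obtain K where K: "\<And>k. k > 0 \<Longrightarrow> norm (e k / p k) \<le> K * real k powr (-1 - decay_exponent x / 2)"
      using tameE[OF tame x] unfolding e_def p_def by metis
    have "0 \<le> K" using order_trans[OF norm_ge_zero K[of 1]] by simp
    show ?thesis
    proof (rule Lim_null_comparison)
      show "eventually (\<lambda>n. norm (of_real (x + of_nat n) * (e n / p n)) \<le>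
              (x + 1) * K * real n powr (-(decay_exponent x / 2))) sequentially"
        using eventually_gt_at_top[of 0]
      proof eventually_elim
        case (elim n)
        have "norm (of_real (x + of_nat n) * (e n / p n)) = (x + real n) * norm (e n / p n)"
          unfolding norm_mult norm_of_real using x by simp
        also have "x + real n \<le> (x + 1) * real n"
          using elim x mult_left_mono[of 1 "real n" x] by (simp add: algebra_simps)
        hence "(x + real n) * norm (e n / p n) \<le> (x + 1) * real n * (K * real n powr (-1 - decay_exponent x / 2))"
          using x by (intro mult_mono K elim) auto
        also have "\<dots> = (x + 1) * K * (real n powr 1 * real n powr (-1 - decay_exponent x / 2))"
          using elim by simp
        also have "real n powr 1 * real n powr (-1 - decay_exponent x / 2) = real n powr (-(decay_exponent x / 2))"
          by (subst powr_add[symmetric]) simp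
        finally show ?case .
      qed
      have "(\<lambda>n. real n powr (-(decay_exponent x / 2))) \<longlonglongrightarrow> 0"
        using decay_exponent_bounds(1)[OF x]
        by (intro tendsto_neg_powr filterlim_real_sequentially) auto
      thus "(\<lambda>n. (x + 1) * K * real n powr (-(decay_exponent x / 2))) \<longlonglongrightarrow> 0"
        by (rule tendsto_mult_right_zero)
    qed
  qed
  from LIMSEQ_Suc[OF this]
  have lim: "(\<lambda>n. of_real (x + of_nat (Suc n)) * (e (Suc n) / p (Suc n))) \<longlonglongrightarrow> 0" .
  have "(\<lambda>n. \<Sum>k<n. e k / p k) \<longlonglongrightarrow> factorial_series C x"
    using sums_factorial_series[OF tame x] by (simp add: sums_def e_def p_def)
  from LIMSEQ_Suc[OF this]
  have "(\<lambda>n. of_real x * ((\<Sum>k<Suc n. e k / p k) - C 0) +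
                of_real (x + of_nat (Suc n)) * (e (Suc n) / p (Suc n))) \<longlonglongrightarrow>
           of_real x * (factorial_series C x - C 0) + 0"
    by (intro tendsto_add[OF _ lim] tendsto_mult tendsto_diff tendsto_const)
  hence "(\<lambda>n. \<Sum>k<Suc n. e' k / p k) \<longlonglongrightarrow> of_real x * (factorial_series C x - C 0)"
    unfolding tele by simp
  hence "(\<lambda>n. \<Sum>k<n. e' k / p k) \<longlonglongrightarrow> of_real x * (factorial_series C x - C 0)"
    by (rule LIMSEQ_imp_Suc)
  thus ?thesis
    by (simp add: sums_def e'_def p_def)
qed

corollary factorial_series_Suc:
  fixes C :: "nat \<Rightarrow> 'a :: {real_normed_field, banach}"
  assumes "tame C" "x > 0"
  shows   "factorial_series (\<lambda>l. C (Suc l)) x = of_real x * (factorial_series C x - C 0)"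
  using factorial_series_shift[OF assms] unfolding factorial_series_def by (rule sums_unique[symmetric])

section \<open>Inverse factorial series as Laplace integrals\<close>

lemma has_bochner_integral_exp_one_minus_exp_power:
  fixes x :: real
  assumes "x > 0"
  shows   "has_bochner_integral lborel
             (\<lambda>t. if t < 0 then 0 else exp (-(x * t)) * (1 - exp (-t)) ^ k)
             (fact k / pochhammer x (Suc k))"
  using assms
proof (induction k arbitrary: x)
  case 0
  have "has_bochner_integral lborel (erlang_density 0 x) 1"
    using nn_integral_erlang_ith_moment[OF 0, of 0 0] 0
    by (intro has_bochner_integral_nn_integral) auto
  hence "has_bochner_integral lborel (\<lambda>t. erlang_density 0 x t / x) (1 / x)"
    by (rule has_bochner_integral_divide_zero)
  also have "(\<lambda>t. erlang_density 0 x t / x) = (\<lambda>t. if t < 0 then 0 else exp (-(x * t)) * (1 - exp (-t)) ^ 0)"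
    using 0 by (auto simp: erlang_density_def)
  finally show ?case by simp
next
  case (Suc k)
  \<comment> \<open>Uses exp(-x t) (1 - exp(-t)) = exp(-x t) - exp(-(x + 1) t), which is why x
    varies in the induction.\<close>
  have "has_bochner_integral lborel
          (\<lambda>t. (if t < 0 then 0 else exp (-(x * t)) * (1 - exp (-t)) ^ k) -
                (if t < 0 then 0 else exp (-((x + 1) * t)) * (1 - exp (-t)) ^ k))
          (fact k / pochhammer x (Suc k) - fact k / pochhammer (x + 1) (Suc k))"
    using Suc.prems by (intro has_bochner_integral_diff Suc.IH) auto
  also have "(\<lambda>t. (if t < 0 then 0 else exp (-(x * t)) * (1 - exp (-t)) ^ k) -
                (if t < 0 then 0 else exp (-((x + 1) * t)) * (1 - exp (-t)) ^ k)) =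
             (\<lambda>t. if t < 0 then 0 else exp (-(x * t)) * (1 - exp (-t)) ^ Suc k)"
    by (auto simp: fun_eq_iff algebra_simps exp_add exp_diff exp_minus divide_inverse)
  also have "fact k / pochhammer x (Suc k) - fact k / pochhammer (x + 1) (Suc k) =
             fact (Suc k) / pochhammer x (Suc (Suc k))"
  proof -
    define q where "q = pochhammer (x + 1) k"
    have q: "q > 0" using Suc.prems by (auto simp: q_def intro!: pochhammer_pos)
    have "pochhammer x (Suc k) = x * q" "pochhammer (x + 1) (Suc k) = q * (x + 1 + real k)"
         "pochhammer x (Suc (Suc k)) = x * (q * (x + 1 + real k))"
      by (simp_all add: q_def pochhammer_rec[of x] pochhammer_Suc[of "x + 1"])
    moreover have "x + 1 + real k > 0" using Suc.prems by auto
    ultimately show ?thesis using q Suc.prems by (simp add: divide_simps) (simp add: algebra_simps)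
  qed
  finally show ?case .
qed

lemma has_bochner_integral_sums:
  fixes f :: "nat \<Rightarrow> 'b \<Rightarrow> 'a :: {banach, second_countable_topology}"
  assumes int: "\<And>i. has_bochner_integral M (f i) (I i)"
  assumes int': "\<And>i. has_bochner_integral M (\<lambda>x. norm (f i x)) (J i)"
  assumes J: "summable J"
  assumes sm: "\<And>x. summable (\<lambda>i. norm (f i x))"
  assumes G: "\<And>x. (\<lambda>i. f i x) sums G x"
  shows   "has_bochner_integral M G (suminf I)"
proof -
  have G': "G = (\<lambda>x. \<Sum>i. f i x)"
    using G by (auto simp: fun_eq_iff dest: sums_unique)
  have I: "I = (\<lambda>i. integral\<^sup>L M (f i))" and J': "J = (\<lambda>i. \<integral>x. norm (f i x) \<partial>M)"
    using int int' by (auto simp: fun_eq_iff has_bochner_integral_iff)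
  show ?thesis
    unfolding has_bochner_integral_iff G' I using int J sm
    by (intro conjI integrable_suminf integral_suminf)
       (auto simp: has_bochner_integral_iff J'[symmetric])
qed

text \<open>Termwise integration: \<open>fact k / pochhammer x (Suc k)\<close> is k! divided by
  \<open>x * pochhammer (x + 1) k\<close>, which cancels the k! of the power series and leaves the
  factor 1/x.\<close>

lemma has_bochner_integral_factorial_series:
  fixes C :: "nat \<Rightarrow> complex"
  assumes tame: "tame C" and x: "x > 0"
  assumes G: "\<And>t. t \<ge> 0 \<Longrightarrow> (\<lambda>k. stirling_transform C k / fact k * of_real ((1 - exp (-t)) ^ k)) sums G t"
  shows   "has_bochner_integral lborel (\<lambda>t. if t < 0 then 0 else of_real (exp (-(x * t))) * G t)
             (factorial_series C x / of_real x)"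
proof -
  define e where "e = stirling_transform C"
  define f where "f = (\<lambda>k t. if t < 0 then 0 else exp (-(x * t)) * (1 - exp (-t)) ^ k)"
  have f_int: "has_bochner_integral lborel (f k) (fact k / pochhammer x (Suc k))" for k
    unfolding f_def by (rule has_bochner_integral_exp_one_minus_exp_power[OF x])
  have f_nonneg: "f k t \<ge> 0" for k t
    by (auto simp: f_def)
  have "has_bochner_integral lborel (\<lambda>t. if t < 0 then 0 else of_real (exp (-(x * t))) * G t)
          (\<Sum>k. e k / fact k * of_real (fact k / pochhammer x (Suc k)))"
  proof (rule has_bochner_integral_sums)
    fix k
    show "has_bochner_integral lborel (\<lambda>t. e k / fact k * of_real (f k t)) (e k / fact k * of_real (fact k / pochhammer x (Suc k)))"
      by (intro has_bochner_integral_mult_right has_bochner_integral_of_real f_int)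
    have "has_bochner_integral lborel (\<lambda>t. norm (e k / fact k) * f k t)
            (norm (e k / fact k) * (fact k / pochhammer x (Suc k)))"
      by (intro has_bochner_integral_mult_right f_int)
    also have "norm (e k / fact k) * (fact k / pochhammer x (Suc k)) = norm (e k / of_real (pochhammer (x + 1) k)) / x"
      using x pochhammer_pos[of "x + 1" k] by (simp add: norm_divide pochhammer_rec)
    finally show "has_bochner_integral lborel (\<lambda>t. norm (e k / fact k * of_real (f k t)))
            (norm (e k / of_real (pochhammer (x + 1) k)) / x)"
      using f_nonneg by (simp only: norm_mult norm_of_real abs_of_nonneg)
  next
    show "summable (\<lambda>k. norm (e k / of_real (pochhammer (x + 1) k)) / x)"
      unfolding e_def by (intro summable_divide tame_summable_norm tame x)
  next
    fix t :: real
    show "(\<lambda>i. e i / fact i * of_real (f i t)) sums (if t < 0 then 0 else of_real (exp (-(x * t))) * G t)"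
    proof (cases "t < 0")
      case False
      have "(\<lambda>k. of_real (exp (-(x*t))) * (e k / fact k * of_real ((1 - exp (-t)) ^ k))) sums
              (of_real (exp (-(x*t))) * G t)"
        using False unfolding e_def by (intro sums_mult G) auto
      thus ?thesis using False by (simp add: f_def mult_ac)
    qed (auto simp: f_def)
  next
    fix t :: real
    show "summable (\<lambda>i. norm (e i / fact i * of_real (f i t)))"
    proof (cases "t < 0")
      case False
      \<comment> \<open>Here \<epsilon> = 1 suffices: it bounds \<open>norm (e k) / fact k\<close>,
        and the geometric factor s^k with s < 1 gives pointwise absolute convergence.\<close>
      obtain K where K: "\<And>k. k > 0 \<Longrightarrow> norm (e k) \<le> K * fact k * real k powr (1 - 1)"
        using tame unfolding tame_def e_def by (metis less_eq_real_def zero_less_one)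
      define s where "s = 1 - exp (-t)"
      have s: "0 \<le> s" "s < 1" using False by (auto simp: s_def)
      show ?thesis
      proof (rule summable_comparison_test_ev)
        show "eventually (\<lambda>i. norm (norm (e i / fact i * of_real (f i t))) \<le> K * exp (-(x * t)) * s ^ i) sequentially"
          using eventually_gt_at_top[of 0]
        proof eventually_elim
          case (elim i)
          have "norm (e i) / fact i \<le> K"
            using K[OF elim] elim by (simp add: field_simps)
          hence "norm (e i) / fact i * (exp (-(x * t)) * s ^ i) \<le> K * (exp (-(x * t)) * s ^ i)"
            using s by (intro mult_right_mono) auto
          thus ?case using False s
            by (simp add: f_def norm_mult norm_divide norm_power mult_ac flip: s_def)
        qed
        show "summable (\<lambda>i. K * exp (-(x * t)) * s ^ i)"
          using s by (intro summable_mult summable_geometric) auto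
      qed
    qed (auto simp: f_def)
  qed
  also have "(\<Sum>k. e k / fact k * of_real (fact k / pochhammer x (Suc k))) = (\<Sum>k. e k / of_real (pochhammer (x + 1) k) / of_real x)"
    using x by (intro suminf_cong) (simp add: pochhammer_rec mult_ac)
  also have "\<dots> = factorial_series C x / of_real x"
    unfolding e_def factorial_series_def
    by (intro suminf_divide sums_summable[OF sums_factorial_series[OF tame x]])
  finally show ?thesis .
qed

section \<open>The Bernoulli kernel\<close>

definition bern_coeff :: "real \<Rightarrow> nat \<Rightarrow> complex" where
  "bern_coeff \<theta> n = of_real (bernpoly n \<theta>) / fact n"

definition bern_kernel :: "real \<Rightarrow> complex \<Rightarrow> complex" where
  "bern_kernel \<theta> w = (if w = 0 then 1 else w * exp (of_real \<theta> * w) / (exp w - 1))"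

text \<open>The solutions of exp w = 1 are the integer multiples of 2 pi i, and 5 < 2 pi.\<close>

lemma exp_neq_1_strip:
  assumes "w \<in> hstrip 5" "w \<noteq> 0"
  shows   "exp w \<noteq> 1"
proof
  assume "exp w = 1"
  then obtain n :: int where n: "Re w = 0" "Im w = of_int (2 * n) * pi"
    by (auto simp: exp_eq_1)
  have "\<bar>Im w\<bar> < 5" using assms by (simp add: hstrip_def)
  hence "2 * pi * \<bar>of_int n\<bar> < 5" using n by (simp add: abs_mult mult_ac)
  moreover have "2 * pi * 1 \<le> 2 * pi * \<bar>real_of_int n\<bar>" if "n \<noteq> 0"
    using that by (intro mult_left_mono) auto
  ultimately have "n = 0" using pi_gt3 by (cases "n = 0"; linarith)
  thus False using n assms by (simp add: complex_eq_iff)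
qed

lemma bern_kernel_fps: "bern_kernel \<theta> has_fps_expansion Abs_fps (bern_coeff \<theta>)"
proof -
  have nz: "fps_exp 1 - 1 \<noteq> (0 :: complex fps)"
    by (auto simp: fps_eq_iff intro!: exI[of _ 1])
  have sd: "subdegree (fps_exp 1 - 1 :: complex fps) = 1"
    by (rule subdegreeI) auto
  have C: "Abs_fps (bern_coeff \<theta>) = fps_X * fps_exp (of_real \<theta>) / (fps_exp 1 - 1)"
    unfolding bern_coeff_def[abs_def] using nz by (simp flip: bernpoly_fps)
  show ?thesis
    unfolding bern_kernel_def[abs_def] C using nz sd
    by (intro has_fps_expansion_divide fps_expansion_intros) auto
qed

lemma holomorphic_bern_kernel: "bern_kernel \<theta> holomorphic_on hstrip 5"
proof (rule no_isolated_singularity')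
  show "bern_kernel \<theta> holomorphic_on hstrip 5 - {0}"
    unfolding bern_kernel_def[abs_def] using exp_neq_1_strip
    by (subst holomorphic_cong[OF refl, of _ _ "\<lambda>t. t * exp (of_real \<theta> * t) / (exp t - 1)"])
       (auto intro!: holomorphic_intros)
  have "isCont (bern_kernel \<theta>) 0"
    by (rule has_fps_expansion_imp_continuous[OF bern_kernel_fps])
  thus "(bern_kernel \<theta> \<longlongrightarrow> bern_kernel \<theta> z) (at z within hstrip 5)" if "z \<in> {0}" for z
    using that by (auto simp: isCont_def intro: tendsto_within_subset)
qed auto

text \<open>Division by w shifts the Taylor coefficients by one. Filling in the value
  \<open>deriv f 0\<close> at 0 keeps the quotient holomorphic on all of S, not only near 0.\<close>

lemma divided_difference_0:
  assumes hol: "f holomorphic_on S" and S: "open S" "0 \<in> S"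
  assumes fps: "f has_fps_expansion Abs_fps a"
  obtains g where "g holomorphic_on S" "g has_fps_expansion Abs_fps (\<lambda>n. a (Suc n))"
    "\<And>w. w \<noteq> 0 \<Longrightarrow> g w = (f w - a 0) / w" "\<And>w. f w = a 0 + w * g w"
proof -
  define g where "g = (\<lambda>z. if z = 0 then deriv f 0 else (f z - f 0) / (z - 0))"
  have f0: "f 0 = a 0"
    using has_fps_expansion_imp_0_eq_fps_nth_0[OF fps] by simp
  have g: "g holomorphic_on S"
    unfolding g_def using S by (intro pole_lemma hol) (auto simp: interior_open)
  have fg: "f w = a 0 + w * g w" for w
    by (simp add: g_def f0)
  have "g analytic_on {0}"
    using g S by (meson analytic_on_analytic_at analytic_on_holomorphic empty_subsetI insert_subset)
  hence "g has_fps_expansion fps_expansion g 0"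
    by (rule analytic_at_imp_has_fps_expansion_0)
  hence "(\<lambda>w. a 0 + w * g w) has_fps_expansion fps_const (a 0) + fps_X * fps_expansion g 0"
    by (intro fps_expansion_intros)
  hence "f has_fps_expansion fps_const (a 0) + fps_X * fps_expansion g 0"
    using fg by presburger
  hence "Abs_fps a = fps_const (a 0) + fps_X * fps_expansion g 0"
    using fps_expansion_unique_complex fps by blast
  hence "fps_nth (Abs_fps a) (Suc n) = fps_nth (fps_const (a 0) + fps_X * fps_expansion g 0) (Suc n)" for n
    by (rule arg_cong)
  hence "Abs_fps (\<lambda>n. a (Suc n)) = fps_expansion g 0"
    by (simp add: fps_eq_iff)
  with g fg f0 show ?thesis
    using \<open>g has_fps_expansion fps_expansion g 0\<close> by (intro that[of g]) (auto simp: g_def)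
qed

text \<open>The remaining rectangle |Re w| \<le> 1, |Im w| \<le> 4 is compact and lies inside the
  wider strip of holomorphy.\<close>

lemma bounded_strip_if_bounded_far:
  assumes hol: "g holomorphic_on hstrip 5"
  assumes far: "\<And>w. w \<in> hstrip 4 \<Longrightarrow> \<bar>Re w\<bar> \<ge> 1 \<Longrightarrow> norm (g w) \<le> B"
  obtains B' where "\<And>w. w \<in> hstrip 4 \<Longrightarrow> norm (g w) \<le> B'"
proof -
  define R where "R = cbox (Complex (-1) (-4)) (Complex 1 4)"
  have "compact (g ` R)"
    by (intro compact_continuous_image holomorphic_on_imp_continuous_on holomorphic_on_subset[OF hol])
       (auto simp: R_def hstrip_def in_cbox_complex_iff)
  then obtain B0 where B0: "\<And>w. w \<in> R \<Longrightarrow> norm (g w) \<le> B0"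
    using compact_imp_bounded[of "g ` R"] by (auto simp: bounded_iff)
  show ?thesis
  proof (rule that[of "max B B0"])
    fix w assume w: "w \<in> hstrip 4"
    show "norm (g w) \<le> max B B0"
    proof (cases "\<bar>Re w\<bar> \<ge> 1")
      case True
      thus ?thesis using far[OF w] by linarith
    next
      case False
      hence "w \<in> R" using w by (auto simp: R_def hstrip_def in_cbox_complex_iff)
      thus ?thesis using B0[of w] by linarith
    qed
  qed
qed

text \<open>For Re w \<ge> 1 the bound \<theta> \<le> 1 lets the denominator dominate exp(\<theta>
  w). For Re w \<le> -1 the bound 0 \<le> \<theta> keeps that exponential below 1, while the
  denominator is at least 1/2. Only the linear factor w survives.\<close>

lemma norm_bern_kernel_le:
  assumes \<theta>: "0 \<le> \<theta>" "\<theta> \<le> 1" and w: "\<bar>Re w\<bar> \<ge> 1"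
  shows   "norm (bern_kernel \<theta> w) \<le> 2 * norm w"
proof -
  have e2: "exp 1 \<ge> (2 :: real)" using exp_ge_add_one_self[of 1] by simp
  have w0: "w \<noteq> 0" using w by auto
  have re\<theta>: "Re (of_real \<theta> * w) = \<theta> * Re w" by simp
  have "norm (exp (of_real \<theta> * w)) \<le> 2 * norm (exp w - 1)"
  proof (cases "Re w \<ge> 1")
    case True
    have "exp (\<theta> * Re w) \<le> exp (1 * Re w)"
      using \<theta> True by (subst exp_le_cancel_iff) (intro mult_right_mono, auto)
    moreover have "exp (Re w) \<ge> exp 1" using True by simp
    moreover have "exp (Re w) - 1 \<le> norm (exp w - 1)"
      using norm_triangle_ineq2[of "exp w" 1] by simp
    ultimately show ?thesis using e2 unfolding norm_exp_eq_Re re\<theta> mult_1 by linarith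
  next
    case False
    hence w': "Re w \<le> -1" using w by auto
    have "exp (\<theta> * Re w) \<le> 1"
      using \<theta> w' by (simp add: mult_nonneg_nonpos)
    moreover have "exp (Re w) \<le> exp (-1)" using w' by simp
    moreover have "exp (-1) \<le> (1 / 2 :: real)"
      using e2 by (simp add: exp_minus field_simps)
    moreover have "1 - exp (Re w) \<le> norm (exp w - 1)"
      using norm_triangle_ineq2[of 1 "exp w"] by (simp add: norm_minus_commute)
    ultimately show ?thesis unfolding norm_exp_eq_Re re\<theta> mult_1 by linarith
  qed
  moreover from this have "norm (exp w - 1) > 0"
    by (smt (verit) norm_ge_zero exp_not_eq_zero zero_less_norm_iff)
  ultimately have "norm (exp (of_real \<theta> * w)) / norm (exp w - 1) \<le> 2"
    by (simp add: divide_le_eq)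
  hence "norm w * (norm (exp (of_real \<theta> * w)) / norm (exp w - 1)) \<le> norm w * 2"
    by (intro mult_left_mono) auto
  thus ?thesis using w0 by (simp add: bern_kernel_def norm_mult norm_divide)
qed

text \<open>The kernel grows linearly, so one division by w makes it bounded and further ones
  preserve this. Removing the first J coefficients is what later makes the Beta exponents positive
  when Re m is large.\<close>

lemma bern_kernel_tail:
  assumes \<theta>: "0 \<le> \<theta>" "\<theta> \<le> 1" and J: "J > 0"
  shows   "\<exists>g B. g holomorphic_on hstrip 5 \<and> g has_fps_expansion Abs_fps (\<lambda>n. bern_coeff \<theta> (J + n)) \<and>
             (\<forall>w\<in>hstrip 4. norm (g w) \<le> B)"
  using J
proof (induction J rule: nat_induct_non_zero)
  case 1
  have 0: "0 \<in> hstrip 5" by (simp add: hstrip_def)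
  obtain g where g: "g holomorphic_on hstrip 5" "g has_fps_expansion Abs_fps (\<lambda>n. bern_coeff \<theta> (Suc n))"
    "\<And>w. w \<noteq> 0 \<Longrightarrow> g w = (bern_kernel \<theta> w - bern_coeff \<theta> 0) / w"
    using divided_difference_0[OF holomorphic_bern_kernel _ 0 bern_kernel_fps] by (metis open_hstrip)
  have "norm (g w) \<le> 2 + norm (bern_coeff \<theta> 0)" if w: "\<bar>Re w\<bar> \<ge> 1" for w
  proof -
    have nw: "norm w \<ge> 1" using w abs_Re_le_cmod[of w] by linarith
    have "norm (g w) = norm (bern_kernel \<theta> w - bern_coeff \<theta> 0) / norm w"
      using nw by (subst g(3)) (auto simp: norm_divide)
    also have "\<dots> \<le> (2 * norm w + norm (bern_coeff \<theta> 0) * norm w) / norm w"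
      using norm_triangle_ineq4[of "bern_kernel \<theta> w" "bern_coeff \<theta> 0"] norm_bern_kernel_le[OF \<theta> w] nw
            mult_left_mono[OF nw, of "norm (bern_coeff \<theta> 0)"]
      by (intro divide_right_mono) auto
    also have "\<dots> = 2 + norm (bern_coeff \<theta> 0)"
      using nw by (subst distrib_right[symmetric]) auto
    finally show ?thesis .
  qed
  then obtain B where "\<And>w. w \<in> hstrip 4 \<Longrightarrow> norm (g w) \<le> B"
    using bounded_strip_if_bounded_far[OF g(1)] by metis
  with g show ?case by auto
next
  case (Suc J)
  then obtain f B where f: "f holomorphic_on hstrip 5" "f has_fps_expansion Abs_fps (\<lambda>n. bern_coeff \<theta> (J + n))"
    "\<And>w. w \<in> hstrip 4 \<Longrightarrow> norm (f w) \<le> B" by blast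
  have 0: "0 \<in> hstrip 5" by (simp add: hstrip_def)
  obtain g where g: "g holomorphic_on hstrip 5" "g has_fps_expansion Abs_fps (\<lambda>n. bern_coeff \<theta> (J + Suc n))"
    "\<And>w. w \<noteq> 0 \<Longrightarrow> g w = (f w - bern_coeff \<theta> (J + 0)) / w"
    using divided_difference_0[OF f(1) _ 0 f(2)] by (metis open_hstrip)
  have "norm (g w) \<le> B + norm (bern_coeff \<theta> J)" if w: "w \<in> hstrip 4" "\<bar>Re w\<bar> \<ge> 1" for w
  proof -
    have nw: "norm w \<ge> 1" using w abs_Re_le_cmod[of w] by linarith
    have "norm (g w) = norm (f w - bern_coeff \<theta> J) / norm w"
      using nw by (subst g(3)) (auto simp: norm_divide)
    also have "\<dots> \<le> norm (f w - bern_coeff \<theta> J) / 1"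
      using nw by (intro divide_left_mono) auto
    also have "\<dots> \<le> B + norm (bern_coeff \<theta> J)"
      using norm_triangle_ineq4[of "f w" "bern_coeff \<theta> J"] f(3)[OF w(1)] by simp
    finally show ?thesis .
  qed
  then obtain B where "\<And>w. w \<in> hstrip 4 \<Longrightarrow> norm (g w) \<le> B"
    using bounded_strip_if_bounded_far[OF g(1)] by metis
  with g show ?case by auto
qed

lemma power_div_fact_le_exp:
  assumes "y \<ge> (0 :: real)"
  shows   "y ^ n / fact n \<le> exp y"
proof -
  have "(\<Sum>i\<in>{n}. y ^ i /\<^sub>R fact i) \<le> (\<Sum>i. y ^ i /\<^sub>R fact i)"
    using assms by (intro sum_le_suminf summable_exp_generic) auto
  thus ?thesis by (simp add: exp_def divide_inverse mult.commute)
qed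

text \<open>Powers of t, introduced below to produce larger factorials, are paid for out of
  \<epsilon>; the 4 in the constant is the half-width of the strip.\<close>

lemma power_le_exp_strip:
  assumes "\<epsilon> > 0"
  obtains K where "K \<ge> 0" "\<And>t. t \<in> hstrip 4 \<Longrightarrow> norm t ^ n \<le> K * exp (\<epsilon> * \<bar>Re t\<bar>)"
proof -
  define K where "K = fact n / \<epsilon> ^ n * exp (4 * \<epsilon>)"
  show ?thesis
  proof (rule that[of K])
    fix t assume t: "t \<in> hstrip 4"
    have "norm t \<le> \<bar>Re t\<bar> + 4"
      using cmod_le[of t] t by (simp add: hstrip_def)
    hence "\<epsilon> * norm t \<le> \<epsilon> * (\<bar>Re t\<bar> + 4)"
      using assms by (intro mult_left_mono) auto
    have "(\<epsilon> * norm t) ^ n / fact n \<le> exp (\<epsilon> * norm t)"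
      using assms by (intro power_div_fact_le_exp) auto
    also have "\<dots> \<le> exp (\<epsilon> * (\<bar>Re t\<bar> + 4))"
      using \<open>\<epsilon> * norm t \<le> _\<close> by simp
    also have "\<dots> = exp (4 * \<epsilon>) * exp (\<epsilon> * \<bar>Re t\<bar>)"
      by (simp add: algebra_simps flip: exp_add)
    finally show "norm t ^ n \<le> K * exp (\<epsilon> * \<bar>Re t\<bar>)"
      using assms by (simp add: K_def field_simps)
  qed (use assms in \<open>auto simp: K_def\<close>)
qed

lemma higher_deriv_power_times_dilation:
  assumes hol: "g holomorphic_on hstrip 5" and fps: "g has_fps_expansion Abs_fps a"
  shows   "(deriv ^^ k) (\<lambda>t. t ^ n * g (of_real u * t)) 0 = (if k < n then 0 else fact k * a (k - n) * of_real u ^ (k - n))"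
proof -
  have an: "g analytic_on {0}"
    using has_fps_expansion_imp_analytic_0[OF fps] .
  define h where "h = (\<lambda>t. g (of_real u * t))"
  have "h analytic_on {0}"
    unfolding h_def using analytic_on_compose[of "\<lambda>t. of_real u * t" "{0}" g] an
    by (auto simp: o_def intro!: analytic_intros)
  hence h: "h has_fps_expansion fps_expansion h 0"
    by (rule analytic_at_imp_has_fps_expansion_0)
  obtain r where r: "r > 0" "g holomorphic_on ball 0 r"
    using an by (auto simp: analytic_on_def)
  \<comment> \<open>The radius r / (|u| + 1) is meaningful for u = 0 as well.\<close>
  define S :: "complex set" where "S = ball 0 (r / (\<bar>u\<bar> + 1))"
  have "of_real u * w \<in> ball 0 r" if "w \<in> S" for w
  proof -
    have "norm (of_real u * w) \<le> (\<bar>u\<bar> + 1) * norm w"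
      by (simp add: norm_mult mult_right_mono)
    also have "\<dots> < r" using that by (simp add: S_def field_simps)
    finally show ?thesis by simp
  qed
  hence "(deriv ^^ m) h 0 = of_real u ^ m * (deriv ^^ m) g (of_real u * 0)" for m
    unfolding h_def using r by (intro higher_deriv_compose_linear[of _ "ball 0 r" S]) (auto simp: S_def)
  moreover have "(deriv ^^ m) g 0 = fact m * a m" for m
    using fps_nth_fps_expansion[OF fps, of m] by simp
  ultimately have "fps_expansion h 0 = Abs_fps (\<lambda>m. a m * of_real u ^ m)"
    by (simp add: fps_expansion_def fps_eq_iff)
  with h have "(\<lambda>t. t ^ n * h t) has_fps_expansion fps_X ^ n * Abs_fps (\<lambda>m. a m * of_real u ^ m)"
    by (intro fps_expansion_intros) auto
  from fps_nth_fps_expansion[OF this, of k] show ?thesis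
    by (auto simp: h_def fps_X_power_mult_nth mult_ac split: if_splits)
qed

text \<open>The sequence consists of the derivatives of order l + a at 0 of t^n g(u t), where g is
  the kernel without its first J coefficients. One bound serves all u because u t stays in the strip
  on which g is bounded.\<close>

lemma kernel_transform_bound:
  assumes \<theta>: "0 \<le> \<theta>" "\<theta> \<le> 1" and J: "J > 0" and \<epsilon>: "0 < \<epsilon>" "\<epsilon> \<le> 1"
  shows   "\<exists>K\<ge>0. \<forall>u\<in>{0..1}. \<forall>k>0.
    norm (stirling_transform (\<lambda>l. if l + a < n then 0 else fact (l + a) * bern_coeff \<theta> (J + (l + a - n)) * of_real u ^ (l + a - n)) k)
      \<le> K * fact k * real k powr (\<epsilon> - 1)"
proof -
  obtain g B where g: "g holomorphic_on hstrip 5" "g has_fps_expansion Abs_fps (\<lambda>n. bern_coeff \<theta> (J + n))"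
    "\<And>w. w \<in> hstrip 4 \<Longrightarrow> norm (g w) \<le> B"
    using bern_kernel_tail[OF \<theta> J] by blast
  have B: "B \<ge> 0" using order_trans[OF norm_ge_zero g(3)[of 0]] by (simp add: hstrip_def)
  obtain K where K: "K \<ge> 0" "\<And>t. t \<in> hstrip 4 \<Longrightarrow> norm t ^ n \<le> K * exp (\<epsilon> * \<bar>Re t\<bar>)"
    using power_le_exp_strip[OF \<epsilon>(1)] by metis
  show ?thesis
  proof (intro exI[of _ "24 * exp 1 * fact (a + 2) * (K * B)"] conjI ballI allI impI)
    show "24 * exp 1 * fact (a + 2) * (K * B) \<ge> 0" using K B by (intro mult_nonneg_nonneg) auto
    fix u :: real and k :: nat assume u: "u \<in> {0..1}" and k: "k > 0"
    have sub: "of_real u * t \<in> hstrip r" if "t \<in> hstrip r" for t r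
    proof -
      have "\<bar>u * Im t\<bar> \<le> 1 * \<bar>Im t\<bar>"
        unfolding abs_mult using u by (intro mult_right_mono) auto
      thus ?thesis using that by (simp add: hstrip_def)
    qed
    define F where "F = (\<lambda>t. t ^ n * g (of_real u * t))"
    have "(\<lambda>t. g (of_real u * t)) holomorphic_on hstrip 4"
      using holomorphic_on_compose_gen[of "\<lambda>t. of_real u * t" "hstrip 4" g "hstrip 5"] g(1) sub
      by (auto simp: o_def hstrip_def intro!: holomorphic_intros) force
    hence hol: "F holomorphic_on hstrip 4"
      unfolding F_def by (intro holomorphic_intros)
    have "norm (F t) \<le> K * B * exp (\<epsilon> * \<bar>Re t\<bar>)" if t: "t \<in> hstrip 4" for t
    proof -
      have "norm (F t) = norm t ^ n * norm (g (of_real u * t))"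
        by (simp add: F_def norm_mult norm_power)
      also have "\<dots> \<le> (K * exp (\<epsilon> * \<bar>Re t\<bar>)) * B"
        using K B t sub by (intro mult_mono g(3)) auto
      finally show ?thesis by (simp add: mult_ac)
    qed
    from norm_stirling_transform_le[OF hol this \<epsilon> k, of a]
    show "norm (stirling_transform (\<lambda>l. if l + a < n then 0 else fact (l + a) * bern_coeff \<theta> (J + (l + a - n)) * of_real u ^ (l + a - n)) k)
      \<le> 24 * exp 1 * fact (a + 2) * (K * B) * fact k * real k powr (\<epsilon> - 1)"
      unfolding F_def higher_deriv_power_times_dilation[OF g(1,2)] .
  qed
qed

text \<open>The general estimate applied to t^l, whose only nonzero derivative at 0 is l!, so that
  its transform is a single column of Stirling numbers.\<close>

lemma stirling_bound:
  assumes \<epsilon>: "0 < \<epsilon>" "\<epsilon> \<le> 1"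
  obtains K where "K \<ge> 0" "\<And>k. k > 0 \<Longrightarrow> real (stirling k l) \<le> K * fact k * real k powr (\<epsilon> - 1)"
proof -
  obtain K where K: "K \<ge> 0" "\<And>t. t \<in> hstrip 4 \<Longrightarrow> norm t ^ l \<le> K * exp (\<epsilon> * \<bar>Re t\<bar>)"
    using power_le_exp_strip[OF \<epsilon>(1)] by metis
  show ?thesis
  proof (rule that[of "24 * exp 1 * fact (0 + 2) * K"])
    fix k :: nat assume k: "k > 0"
    have d: "(deriv ^^ (m + 0)) (\<lambda>t. t ^ l) 0 = (if m = l then fact l else 0 :: complex)" for m
    proof -
      have "(\<lambda>t. t ^ l) has_fps_expansion (fps_X ^ l :: complex fps)"
        by (intro fps_expansion_intros)
      from fps_nth_fps_expansion[OF this, of m] show ?thesis by (auto simp: fps_X_power_nth)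
    qed
    have "norm (stirling_transform (\<lambda>m. (deriv ^^ (m + 0)) (\<lambda>t::complex. t ^ l) 0) k)
            \<le> 24 * exp 1 * fact (0 + 2) * K * fact k * real k powr (\<epsilon> - 1)"
      by (rule norm_stirling_transform_le[OF _ _ \<epsilon> k])
         (use K in \<open>auto intro!: holomorphic_intros simp: norm_power\<close>)
    also have "stirling_transform (\<lambda>m. (deriv ^^ (m + 0)) (\<lambda>t::complex. t ^ l) 0) k = of_nat (stirling k l) * fact l"
      unfolding d by (auto simp: stirling_transform_def if_distrib sum.delta cong: if_cong)
    also have "norm \<dots> = real (stirling k l) * fact l"
      by (simp add: norm_mult)
    finally have "real (stirling k l) * fact l \<le> 24 * exp 1 * fact (0 + 2) * K * fact k * real k powr (\<epsilon> - 1)" .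
    moreover have "real (stirling k l) * 1 \<le> real (stirling k l) * fact l"
      by (intro mult_left_mono) (auto simp: fact_ge_1)
    ultimately show "real (stirling k l) \<le> 24 * exp 1 * fact (0 + 2) * K * fact k * real k powr (\<epsilon> - 1)"
      by simp
  qed (use K in auto)
qed

section \<open>Uniform bounds for the transformed coefficients\<close>

lemma analytic_continuation_real_interval:
  fixes a b :: real
  assumes hol: "f holomorphic_on S" and S: "open S" "connected S"
  assumes ab: "a < b" "\<And>t. a < t \<Longrightarrow> t < b \<Longrightarrow> of_real t \<in> S"
  assumes f0: "\<And>t. a < t \<Longrightarrow> t < b \<Longrightarrow> f (of_real t) = 0" and w: "w \<in> S"
  shows   "f w = 0"
proof (rule analytic_continuation[OF hol S, of "of_real ` {a<..<b}" "of_real ((a + b) / 2)"])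
  show "complex_of_real ((a + b) / 2) islimpt complex_of_real ` {a<..<b}"
    unfolding islimpt_approachable
  proof safe
    fix e :: real assume e: "e > 0"
    define t where "t = (a + b) / 2 + min (e / 2) ((b - a) / 4)"
    have "t \<in> {a<..<b}" "\<bar>t - (a + b) / 2\<bar> < e" "t \<noteq> (a + b) / 2"
      using e ab by (auto simp: t_def min_def field_simps)
    moreover have "dist (complex_of_real t) (complex_of_real ((a + b) / 2)) = \<bar>t - (a + b) / 2\<bar>"
      by (simp only: dist_norm norm_of_real flip: of_real_diff)
    ultimately show "\<exists>x'\<in>complex_of_real ` {a<..<b}. x' \<noteq> complex_of_real ((a + b) / 2) \<and>
                 dist x' (complex_of_real ((a + b) / 2)) < e"
      by (intro bexI[of _ "complex_of_real t"] conjI) (simp_all only: of_real_eq_iff image_eqI not_False_eq_True)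
  qed
  have "(a + b) / 2 > a" "(a + b) / 2 < b" using ab by auto
  thus "complex_of_real ((a + b) / 2) \<in> S" by (rule ab)
qed (use ab f0 w in auto)

text \<open>The integrand of the Beta function at (z, N - z). For 1 < Re z < N - 1 both exponents
  have positive real part, so the weight is continuous on the closed interval and bounded by 1, and
  no improper integral arises.\<close>

definition beta_weight :: "complex \<Rightarrow> nat \<Rightarrow> real \<Rightarrow> complex" where
  "beta_weight z N u = of_real u powr (z - 1) * of_real (1 - u) powr (of_nat N - z - 1)"

lemma continuous_on_beta_weight:
  assumes "1 < Re z" "Re z < real N - 1"
  shows   "continuous_on {0..1} (beta_weight z N)"
  unfolding beta_weight_def[abs_def]
  by (intro continuous_intros) (use assms in auto)

lemma norm_beta_weight_le_1:
  assumes "1 < Re z" "Re z < real N - 1" "u \<in> {0..1}"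
  shows   "norm (beta_weight z N u) \<le> 1"
proof -
  have "norm (of_real v powr w) \<le> 1" if "0 \<le> v" "v \<le> 1" "Re w > 0" for v :: real and w :: complex
  proof (cases "v = 0")
    case False
    have "v powr Re w \<le> 1 powr Re w"
      using that by (intro powr_mono2) auto
    thus ?thesis using that False by (simp add: norm_powr_real_powr)
  qed auto
  from this[of u "z - 1"] this[of "1 - u" "of_nat N - z - 1"] show ?thesis
    unfolding beta_weight_def norm_mult using assms by (intro mult_le_one) auto
qed

lemma has_integral_beta_weight_of_real:
  assumes "1 < a" "a < real N - 1"
  shows   "(beta_weight (of_real a) N has_integral Gamma (of_real a) * Gamma (of_nat N - of_real a) * rGamma (of_nat N)) {0..1}"
proof -
  have "((\<lambda>t. t powr (a - 1) * (1 - t) powr ((real N - a) - 1)) has_integral Beta a (real N - a)) {0..1}"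
    using assms by (intro has_integral_Beta_real) auto
  hence "((\<lambda>t. complex_of_real (t powr (a - 1) * (1 - t) powr ((real N - a) - 1))) has_integral
           of_real (Beta a (real N - a))) {0..1}"
    by (rule has_integral_of_real)
  also have "complex_of_real (Beta a (real N - a)) = Gamma (of_real a) * Gamma (of_nat N - of_real a) * rGamma (of_nat N)"
    unfolding Beta_altdef of_real_mult Gamma_complex_of_real[symmetric] rGamma_complex_of_real[symmetric]
    by simp
  finally show ?thesis
    by (rule has_integral_eq[rotated]) (auto simp: beta_weight_def powr_of_real[symmetric])
qed

text \<open>The z-derivative contains ln u and ln(1 - u), singular at the ends, so differentiation
  under the integral is done on [\<delta>, 1 - \<delta>]. The bound 1 on the weight makes the error
  at most 2 \<delta>, uniformly in z.\<close>

lemma holomorphic_integral_beta_weight: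
  "(\<lambda>z. integral {0..1} (beta_weight z N)) holomorphic_on {z. 1 < Re z \<and> Re z < real N - 1}"
  (is "_ holomorphic_on ?S")
proof -
  define \<delta> where "\<delta> = (\<lambda>n. 1 / (real n + 3))"
  have \<delta>: "0 < \<delta> n" "\<delta> n \<le> 1 - \<delta> n" "1 - \<delta> n < 1" for n by (auto simp: \<delta>_def field_simps)
  have opn: "open ?S"
    by (intro open_Collect_conj open_Collect_less continuous_intros)
  show ?thesis
  proof (rule holomorphic_uniform_sequence[OF opn])
    fix n :: nat
    have eq: "beta_weight z N u = exp ((z - 1) * of_real (ln u)) * exp ((of_nat N - z - 1) * of_real (ln (1 - u)))"
      if "0 < u" "u < 1" for z u
      using that by (simp add: beta_weight_def powr_def Ln_of_real[symmetric] del: Ln_of_real)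
    have "(\<lambda>z. integral (cbox (\<delta> n) (1 - \<delta> n)) (beta_weight z N)) holomorphic_on ?S"
    proof (rule leibniz_rule_holomorphic)
      fix z :: complex and u :: real assume u: "u \<in> cbox (\<delta> n) (1 - \<delta> n)"
      have u': "0 < u" "u < 1" using u \<delta>[of n] by auto
      show "((\<lambda>z. beta_weight z N u) has_field_derivative
              exp ((z - 1) * of_real (ln u)) * exp ((of_nat N - z - 1) * of_real (ln (1 - u))) *
                (of_real (ln u) - of_real (ln (1 - u)))) (at z within ?S)"
        unfolding eq[OF u'] by (rule derivative_eq_intros refl | simp add: algebra_simps)+
    next
      fix z assume z: "z \<in> ?S"
      have "continuous_on (cbox (\<delta> n) (1 - \<delta> n)) (beta_weight z N)"
        using \<delta>[of n] z by (intro continuous_on_subset[OF continuous_on_beta_weight]) auto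
      thus "beta_weight z N integrable_on cbox (\<delta> n) (1 - \<delta> n)"
        by (intro integrable_continuous)
    next
      show "continuous_on (?S \<times> cbox (\<delta> n) (1 - \<delta> n))
             (\<lambda>(z, u). exp ((z - 1) * of_real (ln u)) * exp ((of_nat N - z - 1) * of_real (ln (1 - u))) *
                (of_real (ln u) - of_real (ln (1 - u))))"
        unfolding case_prod_unfold using \<delta>[of n]
        by (intro continuous_intros) auto
    next
      have "?S = {z. 1 < Re z} \<inter> {z. Re z < real N - 1}" by auto
      also have "convex \<dots>"
        by (intro convex_Int convex_halfspace_Re_gt convex_halfspace_Re_lt)
      finally show "convex ?S" .
    qed
    thus "(\<lambda>z. integral {\<delta> n..1 - \<delta> n} (beta_weight z N)) holomorphic_on ?S" by simp
  next
    fix z assume z: "z \<in> ?S"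
    then obtain d where d: "d > 0" "cball z d \<subseteq> ?S"
      using opn open_contains_cball by metis
    have "uniform_limit (cball z d) (\<lambda>n z. integral {\<delta> n..1 - \<delta> n} (beta_weight z N))
            (\<lambda>z. integral {0..1} (beta_weight z N)) sequentially"
    proof (rule uniform_limitI)
      fix e :: real assume e: "e > 0"
      have "\<delta> \<longlonglongrightarrow> 0" unfolding \<delta>_def by real_asymp
      hence "eventually (\<lambda>n. \<delta> n < e / 2) sequentially"
        using e by (intro order_tendstoD) auto
      thus "eventually (\<lambda>n. \<forall>z\<in>cball z d. dist (integral {\<delta> n..1 - \<delta> n} (beta_weight z N))
              (integral {0..1} (beta_weight z N)) < e) sequentially"
      proof eventually_elim
        case (elim n)
        show ?case
        proof
          fix w assume "w \<in> cball z d"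
          hence w: "1 < Re w" "Re w < real N - 1" using d by auto
          have int: "beta_weight w N integrable_on {a..b}" if "0 \<le> a" "b \<le> 1" for a b
            by (intro integrable_continuous_interval continuous_on_subset[OF continuous_on_beta_weight[OF w]])
               (use that in auto)
          have bd: "norm (integral {a..b} (beta_weight w N)) \<le> 1 * (b - a)" if "0 \<le> a" "a \<le> b" "b \<le> 1" for a b
            using that by (intro integral_bound continuous_on_subset[OF continuous_on_beta_weight[OF w]]
              norm_beta_weight_le_1[OF w]) auto
          have "integral {0..1} (beta_weight w N) =
                  integral {0..\<delta> n} (beta_weight w N) + integral {\<delta> n..1} (beta_weight w N)"
            using \<delta>[of n] by (intro Henstock_Kurzweil_Integration.integral_combine[symmetric] int) auto
          also have "integral {\<delta> n..1} (beta_weight w N) =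
                  integral {\<delta> n..1 - \<delta> n} (beta_weight w N) + integral {1 - \<delta> n..1} (beta_weight w N)"
            using \<delta>[of n] by (intro Henstock_Kurzweil_Integration.integral_combine[symmetric] int) auto
          finally have eq: "integral {0..1} (beta_weight w N) = integral {0..\<delta> n} (beta_weight w N) +
            (integral {\<delta> n..1 - \<delta> n} (beta_weight w N) + integral {1 - \<delta> n..1} (beta_weight w N))" .
          have "dist (integral {\<delta> n..1 - \<delta> n} (beta_weight w N)) (integral {0..1} (beta_weight w N)) =
             norm (integral {0..\<delta> n} (beta_weight w N) + integral {1 - \<delta> n..1} (beta_weight w N))"
            unfolding eq by (subst dist_commute) (simp add: dist_norm)
          also have "\<dots> \<le> 1 * (\<delta> n - 0) + 1 * (1 - (1 - \<delta> n))"
            using \<delta>[of n] by (intro order_trans[OF norm_triangle_ineq] add_mono bd) auto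
          also have "\<dots> < e" using elim by simp
          finally show "dist (integral {\<delta> n..1 - \<delta> n} (beta_weight w N)) (integral {0..1} (beta_weight w N)) < e" .
        qed
      qed
    qed
    with d show "\<exists>d>0. cball z d \<subseteq> ?S \<and> uniform_limit (cball z d) (\<lambda>n z. integral {\<delta> n..1 - \<delta> n} (beta_weight z N))
            (\<lambda>z. integral {0..1} (beta_weight z N)) sequentially" by blast
  qed
qed

text \<open>Both sides are holomorphic in z and agree for real z by the real Beta integral, so the
  identity theorem applies.\<close>

lemma has_integral_beta_weight:
  assumes z: "1 < Re z" "Re z < real N - 1"
  shows   "(beta_weight z N has_integral Gamma z * Gamma (of_nat N - z) * rGamma (of_nat N)) {0..1}"
proof -
  define S where "S = {z. 1 < Re z \<and> Re z < real N - 1}"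
  have S: "open S" unfolding S_def
    by (intro open_Collect_conj open_Collect_less continuous_intros)
  have "S = {z. 1 < Re z} \<inter> {z. Re z < real N - 1}" by (auto simp: S_def)
  hence "convex S"
    by (auto intro!: convex_Int convex_halfspace_Re_gt convex_halfspace_Re_lt)
  have pos: "w \<notin> \<int>\<^sub>\<le>\<^sub>0" if "Re w > 0" for w :: complex
    using that by (auto elim!: nonpos_Ints_cases)
  have "integral {0..1} (beta_weight z N) - Gamma z * Gamma (of_nat N - z) * rGamma (of_nat N) = 0"
  proof (rule analytic_continuation_real_interval[where S = S and a = 1 and b = "real N - 1" and w = z and
      f = "\<lambda>z. integral {0..1} (beta_weight z N) - Gamma z * Gamma (of_nat N - z) * rGamma (of_nat N)"])
    show "(\<lambda>z. integral {0..1} (beta_weight z N) - Gamma z * Gamma (of_nat N - z) * rGamma (of_nat N)) holomorphic_on S"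
      using holomorphic_integral_beta_weight[of N] unfolding S_def
      by (intro holomorphic_intros pos) (auto intro!: pos)
    fix t assume "1 < t" "t < real N - 1"
    thus "integral {0..1} (beta_weight (of_real t) N) - Gamma (of_real t) * Gamma (of_nat N - of_real t) * rGamma (of_nat N) = 0"
      using has_integral_beta_weight_of_real[of t N] by (simp add: integral_unique)
  qed (use z S \<open>convex S\<close> in \<open>auto simp: S_def intro!: convex_connected\<close>)
  moreover have "beta_weight z N integrable_on {0..1}"
    by (intro integrable_continuous_interval continuous_on_beta_weight z)
  ultimately show ?thesis
    by (simp add: has_integral_integral)
qed

text \<open>
  For \<open>l > 0\<close> this is \<open>(-1)\<^sup>l (m+1 choose l) B\<^sub>l(\<theta>) / (m+1)\<close>, with the division carried out so that
  it is entire in \<open>m\<close>.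
\<close>
definition em_coeff :: "real \<Rightarrow> complex \<Rightarrow> nat \<Rightarrow> complex" where
  "em_coeff \<theta> m l = (if l = 0 then 0 else - pochhammer (-m) (l - 1) * bern_coeff \<theta> l)"

text \<open>The factor \<open>rGamma (-m)\<close> vanishes when \<open>m\<close> is a natural number, in agreement with the
  vanishing of the Pochhammer symbol for large \<open>l\<close>.\<close>
lemma has_integral_em_coeff:
  assumes m: "Re m + 2 < real J" "real p + Re m + 1 > 0" and l: "l \<ge> J"
  shows   "((\<lambda>u. - (rGamma (-m) * rGamma (of_nat p + m + 2)) * (beta_weight (of_nat J - 1 - m) (J + p + 1) u *
               (fact (l + p) * bern_coeff \<theta> l * of_real u ^ (l - J)))) has_integral
             (- rGamma (-m) * Gamma (of_nat l - 1 - m) * bern_coeff \<theta> l)) {0..1}"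
proof -
  define z where "z = of_nat l - 1 - m"
  have z: "1 < Re z" "Re z < real (l + p + 1) - 1"
    using m l by (auto simp: z_def)
  have nz: "Gamma (of_nat p + m + 2) \<noteq> 0"
    using m by (subst Gamma_eq_zero_iff) (auto elim!: nonpos_Ints_cases simp: complex_eq_iff)
  have "(beta_weight z (l + p + 1) has_integral Gamma z * Gamma (of_nat (l + p + 1) - z) * rGamma (of_nat (l + p + 1))) {0..1}"
    by (rule has_integral_beta_weight[OF z])
  hence "((\<lambda>u. - (rGamma (-m) * rGamma (of_nat p + m + 2)) * fact (l + p) * bern_coeff \<theta> l * beta_weight z (l + p + 1) u) has_integral
     - (rGamma (-m) * rGamma (of_nat p + m + 2)) * fact (l + p) * bern_coeff \<theta> l * (Gamma z * Gamma (of_nat (l + p + 1) - z) * rGamma (of_nat (l + p + 1)))) {0..1}"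
    by (rule has_integral_mult_right)
  \<comment> \<open>The second Gamma factor does not depend on l, so one prefactor
    \<open>rGamma (of_nat p + m + 2)\<close> removes it for all l; p keeps its argument to the right
    of the poles.\<close>
  also have "of_nat (l + p + 1) - z = of_nat p + m + 2"
    by (simp add: z_def)
  also have "rGamma (of_nat (l + p + 1) :: complex) = inverse (fact (l + p))"
    by (simp add: rGamma_inverse_Gamma Gamma_fact add_ac flip: of_nat_Suc) (metis Gamma_fact add.commute of_nat_Suc)
  also have "- (rGamma (-m) * rGamma (of_nat p + m + 2)) * fact (l + p) * bern_coeff \<theta> l * (Gamma z * Gamma (of_nat p + m + 2) * inverse (fact (l + p))) =
     - rGamma (-m) * Gamma z * bern_coeff \<theta> l"
    using nz by (simp add: rGamma_inverse_Gamma[of "m + (of_nat p + 2)"] field_simps)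
  finally have *: "((\<lambda>u. - (rGamma (-m) * rGamma (of_nat p + m + 2)) * fact (l + p) * bern_coeff \<theta> l * beta_weight z (l + p + 1) u)
     has_integral (- rGamma (-m) * Gamma z * bern_coeff \<theta> l)) {0..1}" .
  show ?thesis
  proof (rule has_integral_eq[OF _ *[unfolded z_def]], fold z_def)
    fix u :: real assume u: "u \<in> {0..1}"
    \<comment> \<open>Passing from J to l multiplies the weight by u^(l - J) and leaves the exponent
      of 1 - u unchanged, so all l are moments of one weight.\<close>
    have "beta_weight z (l + p + 1) u = beta_weight (of_nat J - 1 - m) (J + p + 1) u * of_real u ^ (l - J)"
    proof (cases "u = 0")
      case False
      have "of_real u powr (z - 1) = (of_real u powr (of_nat J - 2 - m + of_nat (l - J)) :: complex)"
        using l by (simp add: z_def of_nat_diff)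
      also have "\<dots> = of_real u powr (of_nat J - 2 - m) * of_real u ^ (l - J)"
        using False by (simp add: powr_add powr_nat')
      finally show ?thesis
        by (simp add: beta_weight_def z_def algebra_simps)
    qed (simp add: beta_weight_def)
    thus "- (rGamma (-m) * rGamma (of_nat p + m + 2)) * fact (l + p) * bern_coeff \<theta> l * beta_weight z (l + p + 1) u =
          - (rGamma (-m) * rGamma (of_nat p + m + 2)) * (beta_weight (of_nat J - 1 - m) (J + p + 1) u *
               (fact (l + p) * bern_coeff \<theta> l * of_real u ^ (l - J)))"
      by (simp add: mult_ac)
  qed
qed

text \<open>Rests on rGamma(-m) = (-m)(-m + 1)...(l - 2 - m) rGamma(l - 1 - m), which in the
  reciprocal form holds also where Gamma(-m) has a pole.\<close>

lemma em_coeff_Gamma: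
  assumes "Re m + 1 < real l" "l > 0"
  shows   "- rGamma (-m) * Gamma (of_nat l - 1 - m) * bern_coeff \<theta> l = em_coeff \<theta> m l"
proof -
  have "of_nat l - 1 - m \<notin> \<int>\<^sub>\<le>\<^sub>0"
    using assms by (auto elim!: nonpos_Ints_cases simp: complex_eq_iff)
  hence "rGamma (of_nat l - 1 - m) * Gamma (of_nat l - 1 - m) = 1"
    by (simp add: rGamma_inverse_Gamma Gamma_eq_zero_iff)
  moreover have "rGamma (-m) = pochhammer (-m) (l - 1) * rGamma (-m + of_nat (l - 1))"
    by (rule pochhammer_rGamma)
  moreover have "-m + of_nat (l - 1) = of_nat l - 1 - m"
    using assms by (simp add: of_nat_diff)
  ultimately show ?thesis
    using assms by (simp add: em_coeff_def mult.assoc)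
qed

lemma holomorphic_em_coeff [holomorphic_intros]: "(\<lambda>m. em_coeff \<theta> m l) holomorphic_on A"
  unfolding em_coeff_def by (cases "l = 0") (auto intro!: holomorphic_intros)

section \<open>Coefficient bounds locally uniform in the exponent\<close>

lemma stirling_transform_add:
  "stirling_transform (\<lambda>l. f l + g l) k = stirling_transform f k + stirling_transform g k"
  by (simp add: stirling_transform_def algebra_simps sum.distrib)

lemma stirling_transform_mult:
  "stirling_transform (\<lambda>l. c * f l) k = c * stirling_transform f k"
  by (simp add: stirling_transform_def algebra_simps sum_distrib_left)

lemma has_integral_stirling_transform:
  assumes "\<And>l. ((\<lambda>u. f u l) has_integral I l) A"
  shows   "((\<lambda>u. stirling_transform (f u) k) has_integral (stirling_transform I k :: complex)) A"
  unfolding stirling_transform_def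
  by (intro has_integral_sum has_integral_mult_right assms) auto

lemma bounded_on_compact_holomorphic:
  assumes "f holomorphic_on UNIV" "compact K"
  obtains B where "B \<ge> 0" "\<And>z. z \<in> K \<Longrightarrow> norm (f z :: complex) \<le> B"
proof -
  have "compact (f ` K)"
    using assms by (intro compact_continuous_image holomorphic_on_imp_continuous_on)
                   (auto intro: holomorphic_on_subset)
  then obtain B where "\<And>z. z \<in> K \<Longrightarrow> norm (f z) \<le> B"
    using compact_imp_bounded[of "f ` K"] by (auto simp: bounded_iff)
  thus ?thesis by (intro that[of "max 0 B"]) (auto simp: le_max_iff_disj)
qed

text \<open>Coefficients with l + a < p are finitely many and are controlled by single Stirling
  columns; the others are Beta averages of kernel data, so the bound passes through the integral. No
  constant depends on the individual m, as the Weierstrass test in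
  \<open>holomorphic_em_series\<close> requires.\<close>

lemma em_coeff_transform_bound:
  assumes \<theta>: "0 \<le> \<theta>" "\<theta> \<le> 1" and \<epsilon>: "0 < \<epsilon>" "\<epsilon> \<le> 1" and K: "compact K"
  shows   "\<exists>B. \<forall>m\<in>K. \<forall>k>0.
    norm (stirling_transform (\<lambda>l. em_coeff \<theta> m (l + a)) k) \<le> B * fact k * real k powr (\<epsilon> - 1)"
proof -
  obtain R where R: "\<And>m. m \<in> K \<Longrightarrow> norm m \<le> R"
    using compact_imp_bounded[OF K] by (auto simp: bounded_iff)
  \<comment> \<open>Large enough that the real parts p - 2 - Re m and p + Re m + 1 of the Beta
    exponents are positive for all m in K.\<close>
  define p where "p = nat \<lceil>\<bar>R\<bar> + 3\<rceil>"
  have p: "real p \<ge> \<bar>R\<bar> + 3" by (simp add: p_def)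
  hence p0: "p > 0" by (cases p) auto
  have mp: "Re m + 2 < real p" "real p + Re m + 1 > 0" if "m \<in> K" for m
    using R[OF that] abs_Re_le_cmod[of m] p by linarith+
  \<comment> \<open>The derivative of order l + a + p of t^(2p) g(u t) carries the factorial (l + a
    + p)! and the power u^(l + a - p), matching \<open>has_integral_em_coeff\<close> with J = p and
    l + a in place of l.\<close>
  obtain B1 where B1: "B1 \<ge> 0" "\<And>u k. u \<in> {0..1} \<Longrightarrow> k > 0 \<Longrightarrow>
    norm (stirling_transform (\<lambda>l. if l + (a + p) < p + p then 0 else fact (l + (a + p)) * bern_coeff \<theta> (p + (l + (a + p) - (p + p))) * of_real u ^ (l + (a + p) - (p + p))) k)
      \<le> B1 * fact k * real k powr (\<epsilon> - 1)"
    using kernel_transform_bound[OF \<theta> p0 \<epsilon>, of "a + p" "p + p"] by blast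
  obtain B2 where B2: "B2 \<ge> 0" "\<And>m. m \<in> K \<Longrightarrow> norm (- (rGamma (-m) * rGamma (of_nat p + m + 2))) \<le> B2"
    by (rule bounded_on_compact_holomorphic[OF _ K, of "\<lambda>m. - (rGamma (-m) * rGamma (of_nat p + m + 2))"])
       (auto intro!: holomorphic_intros)
  have "\<exists>B\<ge>0. \<forall>m\<in>K. norm (em_coeff \<theta> m l) \<le> B" for l
    using bounded_on_compact_holomorphic[OF holomorphic_em_coeff[of \<theta> l UNIV] K] by metis
  then obtain B3 where B3: "\<And>l. B3 l \<ge> 0" "\<And>l m. m \<in> K \<Longrightarrow> norm (em_coeff \<theta> m l) \<le> B3 l"
    by metis
  have "\<exists>B\<ge>0. \<forall>k>0. real (stirling k l) \<le> B * fact k * real k powr (\<epsilon> - 1)" for l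
    using stirling_bound[OF \<epsilon>, of l] by metis
  then obtain B4 where B4: "\<And>l. B4 l \<ge> 0" "\<And>l k. k > 0 \<Longrightarrow> real (stirling k l) \<le> B4 l * fact k * real k powr (\<epsilon> - 1)"
    by metis
  show ?thesis
  proof (intro exI[of _ "(\<Sum>l<p. B4 l * B3 (l + a)) + B2 * B1"] ballI allI impI)
    fix m and k :: nat assume m: "m \<in> K" and k: "k > 0"
    define c1 where "c1 = (\<lambda>l. if l + a < p then em_coeff \<theta> m (l + a) else 0)"
    define c2 where "c2 = (\<lambda>l. if l + a < p then 0 else em_coeff \<theta> m (l + a))"
    have "norm (stirling_transform c1 k) \<le> (\<Sum>l<p. real (stirling k l) * norm (c1 l))"
    proof -
      have "stirling_transform c1 k = (\<Sum>l\<in>{..k} \<inter> {..<p}. of_nat (stirling k l) * c1 l)"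
        unfolding stirling_transform_def by (rule sum.mono_neutral_right) (auto simp: c1_def)
      also have "norm \<dots> \<le> (\<Sum>l\<in>{..k} \<inter> {..<p}. real (stirling k l) * norm (c1 l))"
        by (intro sum_norm_le) (auto simp: norm_mult)
      also have "\<dots> \<le> (\<Sum>l<p. real (stirling k l) * norm (c1 l))"
        by (intro sum_mono2) auto
      finally show ?thesis .
    qed
    also have "\<dots> \<le> (\<Sum>l<p. (B4 l * fact k * real k powr (\<epsilon> - 1)) * B3 (l + a))"
      using B3 B4 k m by (intro sum_mono mult_mono) (auto simp: c1_def)
    also have "\<dots> = (\<Sum>l<p. B4 l * B3 (l + a)) * fact k * real k powr (\<epsilon> - 1)"
      by (simp add: sum_distrib_left sum_distrib_right mult_ac)
    finally have 1: "norm (stirling_transform c1 k) \<le> (\<Sum>l<p. B4 l * B3 (l + a)) * fact k * real k powr (\<epsilon> - 1)" .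
    define D where "D = (\<lambda>u::real. \<lambda>l. if l + (a + p) < p + p then 0 else fact (l + (a + p)) *
       bern_coeff \<theta> (p + (l + (a + p) - (p + p))) * of_real u ^ (l + (a + p) - (p + p)))"
    define \<kappa> where "\<kappa> = - (rGamma (-m) * rGamma (of_nat p + m + 2))"
    define W where "W = beta_weight (of_nat p - 1 - m) (p + p + 1)"
    have "((\<lambda>u. \<kappa> * (W u * D u l)) has_integral c2 l) {0..1}" for l
    proof (cases "l + a < p")
      case False
      have "((\<lambda>u. \<kappa> * (W u * (fact (l + a + p) * bern_coeff \<theta> (l + a) * of_real u ^ (l + a - p)))) has_integral
             (- rGamma (-m) * Gamma (of_nat (l + a) - 1 - m) * bern_coeff \<theta> (l + a))) {0..1}"
        unfolding \<kappa>_def W_def using False by (intro has_integral_em_coeff mp m) auto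
      also have "- rGamma (-m) * Gamma (of_nat (l + a) - 1 - m) * bern_coeff \<theta> (l + a) = c2 l"
        using mp[OF m] False p0 by (subst em_coeff_Gamma) (auto simp: c2_def)
      also have "(\<lambda>u. \<kappa> * (W u * (fact (l + a + p) * bern_coeff \<theta> (l + a) * of_real u ^ (l + a - p)))) = (\<lambda>u. \<kappa> * (W u * D u l))"
        using False by (simp add: D_def add_ac)
      finally show ?thesis .
    qed (auto simp: D_def c2_def)
    hence int: "((\<lambda>u. stirling_transform (\<lambda>l. \<kappa> * (W u * D u l)) k) has_integral stirling_transform c2 k) {0..1}"
      by (rule has_integral_stirling_transform)
    have "norm (stirling_transform c2 k) \<le> B2 * (1 * (B1 * fact k * real k powr (\<epsilon> - 1))) * measure lborel {0..1::real}"
    proof (rule has_integral_bound_real[OF _ finite.emptyI int])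
      fix u :: real assume "u \<in> {0..1} - {}"
      hence u: "u \<in> {0..1}" by simp
      have "norm (W u) \<le> 1"
        unfolding W_def using mp[OF m] u by (intro norm_beta_weight_le_1) auto
      thus "norm (stirling_transform (\<lambda>l. \<kappa> * (W u * D u l)) k) \<le> B2 * (1 * (B1 * fact k * real k powr (\<epsilon> - 1)))"
        unfolding stirling_transform_mult norm_mult using B1 B2 u k m
        by (intro mult_mono) (auto simp: \<kappa>_def D_def)
    qed (use B1 B2 in auto)
    hence 2: "norm (stirling_transform c2 k) \<le> B2 * B1 * fact k * real k powr (\<epsilon> - 1)"
      by simp
    have "stirling_transform (\<lambda>l. em_coeff \<theta> m (l + a)) k = stirling_transform (\<lambda>l. c1 l + c2 l) k"
      by (rule arg_cong[where f = "\<lambda>c. stirling_transform c k"]) (auto simp: c1_def c2_def)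
    also have "\<dots> = stirling_transform c1 k + stirling_transform c2 k"
      by (rule stirling_transform_add)
    finally show "norm (stirling_transform (\<lambda>l. em_coeff \<theta> m (l + a)) k) \<le>
      ((\<Sum>l<p. B4 l * B3 (l + a)) + B2 * B1) * fact k * real k powr (\<epsilon> - 1)"
      using norm_triangle_ineq[of "stirling_transform c1 k" "stirling_transform c2 k"] 1 2
      by (simp only: distrib_right)
  qed
qed

lemma tame_em_coeff:
  assumes "0 \<le> \<theta>" "\<theta> \<le> 1"
  shows   "tame (\<lambda>l. em_coeff \<theta> m (l + a))"
  unfolding tame_def
proof safe
  fix \<epsilon> :: real assume \<epsilon>: "0 < \<epsilon>" "\<epsilon> \<le> 1"
  show "\<exists>K. \<forall>k>0. norm (stirling_transform (\<lambda>l. em_coeff \<theta> m (l + a)) k) \<le> K * fact k * real k powr (\<epsilon> - 1)"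
    using em_coeff_transform_bound[OF assms \<epsilon>, of "{m}" a] by simp
qed

text \<open>The term k = 0 vanishes because \<open>em_coeff \<theta> m 0\<close> is 0. For m other
  than -1 this is the series of the first formula divided by m + 1; unlike that quotient it makes
  sense at m = -1.\<close>

definition em_series :: "real \<Rightarrow> real \<Rightarrow> complex \<Rightarrow> complex" where
  "em_series \<theta> x m = factorial_series (em_coeff \<theta> m) x"

lemma holomorphic_em_series:
  assumes \<theta>: "0 \<le> \<theta>" "\<theta> \<le> 1" and x: "x > 0"
  shows   "em_series \<theta> x holomorphic_on A"
proof -
  have "em_series \<theta> x holomorphic_on UNIV"
  proof (rule holomorphic_uniform_sequence[OF open_UNIV])
    show "(\<lambda>m. \<Sum>k<n. stirling_transform (em_coeff \<theta> m) k / of_real (pochhammer (x + 1) k)) holomorphic_on UNIV" for n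
    proof -
      have "of_real (pochhammer (x + 1) k) \<noteq> (0::complex)" for k
        using pochhammer_pos[of "x + 1" k] x by simp
      thus ?thesis unfolding stirling_transform_def
        by (intro holomorphic_intros)
    qed
    fix z :: complex
    define d where "d = decay_exponent x"
    have d: "0 < d / 2" "d / 2 \<le> 1" using decay_exponent_bounds[OF x] by (auto simp: d_def)
    obtain B where B: "\<And>m k. m \<in> cball z 1 \<Longrightarrow> k > 0 \<Longrightarrow>
        norm (stirling_transform (\<lambda>l. em_coeff \<theta> m (l + 0)) k) \<le> B * fact k * real k powr (d / 2 - 1)"
      using em_coeff_transform_bound[OF \<theta> d compact_cball] by blast
    have "uniform_limit (cball z 1) (\<lambda>n m. \<Sum>k<n. stirling_transform (em_coeff \<theta> m) k / of_real (pochhammer (x + 1) k))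
            (\<lambda>m. \<Sum>k. stirling_transform (em_coeff \<theta> m) k / of_real (pochhammer (x + 1) k)) sequentially"
    proof (rule Weierstrass_m_test_ev[OF _ summable_decay[OF x, of B]])
      show "eventually (\<lambda>k. \<forall>m\<in>cball z 1. norm (stirling_transform (em_coeff \<theta> m) k / of_real (pochhammer (x + 1) k))
              \<le> B * real k powr (- 1 - decay_exponent x / 2)) sequentially"
        using eventually_gt_at_top[of 0]
        by eventually_elim (use B in \<open>auto intro!: norm_div_pochhammer_le[OF x] simp: d_def\<close>)
    qed
    thus "\<exists>d>0. cball z d \<subseteq> UNIV \<and> uniform_limit (cball z d) (\<lambda>n m. \<Sum>k<n. stirling_transform (em_coeff \<theta> m) k / of_real (pochhammer (x + 1) k))
            (em_series \<theta> x) sequentially"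
      unfolding em_series_def[abs_def] factorial_series_def by (intro exI[of _ 1]) auto
  qed
  thus ?thesis by (rule holomorphic_on_subset) auto
qed

section \<open>The Laplace transform of the Bernoulli kernel\<close>

text \<open>The derivatives at 0 of t^2 \<open>bern_kernel \<theta>\<close> (u t): the Beta
  representation with J = 0 and p = 2. Its weight has exponents -2 - m and m + 3, both positive for
  real m exactly when -3 < m < -2.\<close>

definition window_coeff :: "real \<Rightarrow> real \<Rightarrow> nat \<Rightarrow> complex" where
  "window_coeff \<theta> u l = (if l < 2 then 0 else fact l * bern_coeff \<theta> (l - 2) * of_real u ^ (l - 2))"

context
  fixes \<theta> :: real
  assumes \<theta>: "0 \<le> \<theta>" "\<theta> < 1"
begin

text \<open>The full kernel is unbounded, so its constant coefficient b_0 is split off: t^2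
  \<open>bern_kernel \<theta>\<close> (u t) = b_0 t^2 + u t^3 g(u t) with g bounded. The 2 in
  \<open>c\<close> is 2!, and after a shift by a the term t^2 sits at index 2 - a.\<close>

lemma window_coeff_bound:
  assumes \<epsilon>: "0 < \<epsilon>" "\<epsilon> \<le> 1" and a: "a \<le> 2"
  shows   "\<exists>K\<ge>0. \<forall>u\<in>{0..1}. \<forall>k>0.
             norm (stirling_transform (\<lambda>l. window_coeff \<theta> u (l + a)) k) \<le> K * fact k * real k powr (\<epsilon> - 1)"
proof -
  define D where "D = (\<lambda>u l. if l + a < 3 then 0 else fact (l + a) * bern_coeff \<theta> (1 + (l + a - 3)) * of_real u ^ (l + a - 3))"
  have "\<theta> \<le> 1" using \<theta> by simp
  from kernel_transform_bound[OF \<theta>(1) this zero_less_one \<epsilon>, of a 3]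
  obtain K1 where K1: "\<And>u k. u \<in> {0..1} \<Longrightarrow> k > 0 \<Longrightarrow>
      norm (stirling_transform (D u) k) \<le> K1 * fact k * real k powr (\<epsilon> - 1)" "K1 \<ge> 0"
    unfolding D_def by blast
  obtain K2 where K2: "K2 \<ge> 0" "\<And>k. k > 0 \<Longrightarrow> real (stirling k (2 - a)) \<le> K2 * fact k * real k powr (\<epsilon> - 1)"
    using stirling_bound[OF \<epsilon>] by metis
  define c where "c = 2 * bern_coeff \<theta> 0"
  have eq: "window_coeff \<theta> u (l + a) = c * (if l = 2 - a then 1 else 0) + of_real u * D u l" for u l
  proof -
    consider "l + a < 2" | "l + a = 2" | "l + a \<ge> 3" by linarith
    thus ?thesis
    proof cases
      case 3
      then obtain j where j: "l + a = j + 3" by (metis add.commute le_Suc_ex)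
      hence "l \<noteq> 2 - a" using a by arith
      with j show ?thesis by (simp add: window_coeff_def D_def mult_ac eval_nat_numeral)
    next
      case 2
      hence "l = 2 - a" by arith
      with 2 show ?thesis by (simp add: window_coeff_def D_def c_def fact_2)
    next
      case 1
      hence "l \<noteq> 2 - a" using a by arith
      with 1 show ?thesis by (simp add: window_coeff_def D_def)
    qed
  qed
  show ?thesis
  proof (intro exI[of _ "norm c * K2 + K1"] conjI ballI allI impI)
    show "norm c * K2 + K1 \<ge> 0" using K1 K2 by simp
    fix u :: real and k :: nat assume u: "u \<in> {0..1}" and k: "k > 0"
    have "stirling_transform (\<lambda>l. window_coeff \<theta> u (l + a)) k = c * of_nat (stirling k (2 - a)) + of_real u * stirling_transform (D u) k"
    proof -
      have "stirling_transform (\<lambda>l. window_coeff \<theta> u (l + a)) k =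
              c * stirling_transform (\<lambda>l. if l = 2 - a then 1 else 0) k + of_real u * stirling_transform (D u) k"
        by (simp only: eq stirling_transform_add stirling_transform_mult)
      also have "stirling_transform (\<lambda>l. if l = 2 - a then 1 else 0) k = (of_nat (stirling k (2 - a)) :: complex)"
        by (auto simp: stirling_transform_def if_distrib cong: if_cong)
      finally show ?thesis .
    qed
    also have "norm \<dots> \<le> norm c * real (stirling k (2 - a)) + \<bar>u\<bar> * norm (stirling_transform (D u) k)"
      by (rule order_trans[OF norm_triangle_ineq]) (simp add: norm_mult)
    also have "\<dots> \<le> norm c * (K2 * fact k * real k powr (\<epsilon> - 1)) + 1 * (K1 * fact k * real k powr (\<epsilon> - 1))"
      using u K1 K2 k by (intro add_mono mult_mono) auto
    finally show "norm (stirling_transform (\<lambda>l. window_coeff \<theta> u (l + a)) k) \<le> (norm c * K2 + K1) * fact k * real k powr (\<epsilon> - 1)"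
      by (simp add: algebra_simps)
  qed
qed

lemma tame_window_coeff:
  assumes "u \<in> {0..1}"
  shows   "tame (window_coeff \<theta> u)"
  unfolding tame_def
proof safe
  fix \<epsilon> :: real assume "0 < \<epsilon>" "\<epsilon> \<le> 1"
  from window_coeff_bound[OF this, of 0] assms
  show "\<exists>K. \<forall>k>0. norm (stirling_transform (window_coeff \<theta> u) k) \<le> K * fact k * real k powr (\<epsilon> - 1)"
    unfolding add_0_right by blast
qed

text \<open>Normalisation of the Erlang density. The cube is t^2 from the prefactor times one t from
  the factor w of the kernel.\<close>

lemma has_bochner_integral_cubic_exp:
  fixes l :: real
  assumes "l > 0"
  shows   "has_bochner_integral lborel (\<lambda>t. if t < 0 then 0 else exp (-(l * t)) * t ^ 3) (6 / l ^ 4)"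
proof -
  have "has_bochner_integral lborel (erlang_density 3 l) 1"
    using nn_integral_erlang_ith_moment[OF assms, of 3 0] assms
    by (intro has_bochner_integral_nn_integral) auto
  hence "has_bochner_integral lborel (\<lambda>t. 6 / l ^ 4 * erlang_density 3 l t) (6 / l ^ 4 * 1)"
    by (rule has_bochner_integral_mult_right)
  also have "(\<lambda>t. 6 / l ^ 4 * erlang_density 3 l t) = (\<lambda>t. if t < 0 then 0 else exp (-(l * t)) * t ^ 3)"
    using assms by (auto simp: erlang_density_def fun_eq_iff fact_numeral eval_nat_numeral field_simps)
  finally show ?thesis by simp
qed

lemma summable_window:
  assumes x: "x > 0" and u: "u > 0"
  shows   "summable (\<lambda>j. u * (6 / (x + u * (real (Suc j) - \<theta>)) ^ 4))"
proof (rule summable_comparison_test_ev)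
  show "eventually (\<lambda>j. norm (u * (6 / (x + u * (real (Suc j) - \<theta>)) ^ 4)) \<le> (6 * u / (x\<^sup>2 * u\<^sup>2)) * inverse (real j ^ 2)) sequentially"
    using eventually_gt_at_top[of 0]
  proof eventually_elim
    case (elim j)
    have "u * real j \<le> u * (real (Suc j) - \<theta>)"
      using \<theta> u by (intro mult_left_mono) auto
    moreover have "0 < u * real j" using u elim by simp
    ultimately have *: "x \<le> x + u * (real (Suc j) - \<theta>)" "u * real j \<le> x + u * (real (Suc j) - \<theta>)"
      using x by linarith+
    have "x\<^sup>2 * (u * real j)\<^sup>2 \<le> (x + u * (real (Suc j) - \<theta>))\<^sup>2 * (x + u * (real (Suc j) - \<theta>))\<^sup>2"
      using x u * by (intro mult_mono power_mono) auto
    also have "\<dots> = (x + u * (real (Suc j) - \<theta>)) ^ 4"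
      by (simp flip: power_add)
    finally have "6 * u / (x + u * (real (Suc j) - \<theta>)) ^ 4 \<le> 6 * u / (x\<^sup>2 * (u * real j)\<^sup>2)"
      using x u elim \<open>0 < u * real j\<close> * by (intro divide_left_mono mult_pos_pos) auto
    moreover have "0 < x + u * (real (Suc j) - \<theta>)" using * x by linarith
    ultimately show ?case using u x by (simp add: power_mult_distrib field_simps)
  qed
  show "summable (\<lambda>j. (6 * u / (x\<^sup>2 * u\<^sup>2)) * inverse (real j ^ 2))"
    by (intro summable_mult inverse_power_summable) auto
qed

text \<open>The geometric series in exp(-v).\<close>

lemma sums_bern_kernel_real:
  assumes "v > 0"
  shows   "(\<lambda>j. v * exp (-(v * (real (Suc j) - \<theta>)))) sums (v * exp (\<theta> * v) / (exp v - 1))"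
proof -
  have "(\<lambda>j. exp (-v) ^ j) sums (1 / (1 - exp (-v)))"
    using assms by (intro geometric_sums) auto
  hence "(\<lambda>j. v * exp (\<theta> * v) * exp (-v) * exp (-v) ^ j) sums (v * exp (\<theta> * v) * exp (-v) * (1 / (1 - exp (-v))))"
    by (rule sums_mult)
  also have "(\<lambda>j. v * exp (\<theta> * v) * exp (-v) * exp (-v) ^ j) = (\<lambda>j. v * exp (-(v * (real (Suc j) - \<theta>))))"
    by (simp add: fun_eq_iff mult.assoc algebra_simps flip: exp_add exp_of_nat_mult)
  also have "v * exp (\<theta> * v) * exp (-v) * (1 / (1 - exp (-v))) = v * exp (\<theta> * v) / (exp v - 1)"
  proof -
    have "exp v > 1" using assms by simp
    thus ?thesis by (simp add: exp_minus divide_simps)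
  qed
  finally show ?thesis .
qed

text \<open>One Laplace integral is evaluated twice, through the inverse factorial series and
  through the expansion of the kernel into exponentials, and the values are compared.\<close>

lemma factorial_series_window_coeff:
  assumes x: "x > 0" and u: "0 < u" "u \<le> 1"
  shows   "factorial_series (window_coeff \<theta> u) x =
             of_real (x * (\<Sum>j. u * (6 / (x + u * (real (Suc j) - \<theta>)) ^ 4)))"
proof -
  define y where "y = (\<lambda>j. real (Suc j) - \<theta>)"
  have y: "y j > 0" for j using \<theta> by (simp add: y_def)
  define F where "F = (\<lambda>t. t ^ 2 * bern_kernel \<theta> (of_real u * t))"
  have "(\<lambda>t. bern_kernel \<theta> (of_real u * t)) holomorphic_on hstrip 4"
  proof (rule holomorphic_on_compose_gen[of "\<lambda>t. of_real u * t" "hstrip 4" "bern_kernel \<theta>" "hstrip 5", unfolded o_def])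
    show "(*) (complex_of_real u) ` hstrip 4 \<subseteq> hstrip 5"
    proof safe
      fix t :: complex assume "t \<in> hstrip 4"
      moreover have "\<bar>u * Im t\<bar> \<le> 1 * \<bar>Im t\<bar>"
        unfolding abs_mult using u by (intro mult_right_mono) auto
      ultimately show "complex_of_real u * t \<in> hstrip 5" by (simp add: hstrip_def)
    qed
  qed (auto intro!: holomorphic_intros holomorphic_bern_kernel)
  hence hol: "F holomorphic_on hstrip 4"
    unfolding F_def by (intro holomorphic_intros)
  have dF: "(\<lambda>l. (deriv ^^ l) F 0) = window_coeff \<theta> u"
    unfolding F_def higher_deriv_power_times_dilation[OF holomorphic_bern_kernel bern_kernel_fps]
    by (simp add: window_coeff_def[abs_def])
  have sums: "(\<lambda>k. stirling_transform (window_coeff \<theta> u) k / fact k * of_real ((1 - exp (-t)) ^ k)) sums F (of_real t)"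
    if t: "t \<ge> 0" for t :: real
  proof -
    have "norm (complex_of_real (1 - exp (-t))) < 1"
      using t by (subst norm_of_real) auto
    from sums_comp_neg_Ln[OF hol this]
    have "(\<lambda>k. stirling_transform (window_coeff \<theta> u) k / fact k * of_real ((1 - exp (-t)) ^ k)) sums
            F (-Ln (1 - of_real (1 - exp (-t))))"
      unfolding dF by simp
    also have "-Ln (1 - of_real (1 - exp (-t))) = of_real t"
      by (simp add: Ln_of_real flip: exp_of_real)
    finally show ?thesis .
  qed
  have 1: "has_bochner_integral lborel (\<lambda>t. if t < 0 then 0 else of_real (exp (-(x * t))) * F (of_real t))
             (factorial_series (window_coeff \<theta> u) x / of_real x)"
    using u by (intro has_bochner_integral_factorial_series tame_window_coeff x sums) auto
  have pos: "x + u * y j > 0" for j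
    using x u y[of j] by (simp add: add_pos_pos)
  define g where "g = (\<lambda>j t. if t < 0 then 0 else exp (-((x + u * y j) * t)) * t ^ 3)"
  \<comment> \<open>The value 0 at t = 0 agrees with both descriptions: each \<open>g j\<close> has
    the factor t^3 and \<open>F\<close> the factor t^2.\<close>
  define G where "G = (\<lambda>t. if t < 0 then 0 else exp (-(x * t)) * (if t = 0 then 0 else t ^ 2 * (u * t * exp (\<theta> * (u * t)) / (exp (u * t) - 1))))"
  have G: "(\<lambda>j. u * g j t) sums G t" for t
  proof -
    consider "t < 0" | "t = 0" | "t > 0" by linarith
    thus ?thesis
    proof cases
      case 3
      have "(\<lambda>j. exp (-(x * t)) * (t ^ 2 * (u * t * exp (-(u * t * y j))))) sums G t"
      proof -
        have "G t = exp (-(x * t)) * (t ^ 2 * (u * t * exp (\<theta> * (u * t)) / (exp (u * t) - 1)))"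
          using 3 by (simp add: G_def)
        thus ?thesis
          unfolding y_def using 3 u
          by (simp only:) (intro sums_mult sums_bern_kernel_real, simp)
      qed
      also have "(\<lambda>j. exp (-(x * t)) * (t ^ 2 * (u * t * exp (-(u * t * y j))))) = (\<lambda>j. u * g j t)"
        using 3 by (simp add: g_def fun_eq_iff algebra_simps exp_add power3_eq_cube power2_eq_square exp_diff exp_minus divide_inverse)
      finally show ?thesis .
    qed (auto simp: g_def G_def)
  qed
  have "has_bochner_integral lborel G (\<Sum>j. u * (6 / (x + u * y j) ^ 4))"
  proof (rule has_bochner_integral_sums)
    fix j
    show *: "has_bochner_integral lborel (\<lambda>t. u * g j t) (u * (6 / (x + u * y j) ^ 4))"
      unfolding g_def by (intro has_bochner_integral_mult_right has_bochner_integral_cubic_exp pos)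
    have "(\<lambda>t. norm (u * g j t)) = (\<lambda>t. u * g j t)"
      using u by (auto simp: g_def fun_eq_iff)
    with * show "has_bochner_integral lborel (\<lambda>t. norm (u * g j t)) (u * (6 / (x + u * y j) ^ 4))"
      by simp
  next
    show "summable (\<lambda>j. u * (6 / (x + u * y j) ^ 4))"
      unfolding y_def by (rule summable_window[OF x u(1)])
  next
    fix t
    have "(\<lambda>j. norm (u * g j t)) = (\<lambda>j. u * g j t)"
      using u by (auto simp: g_def fun_eq_iff)
    thus "summable (\<lambda>j. norm (u * g j t))"
      using G[of t] by (simp add: sums_iff)
  qed (fact G)
  hence 2: "has_bochner_integral lborel (\<lambda>t. complex_of_real (G t)) (of_real (\<Sum>j. u * (6 / (x + u * y j) ^ 4)))"
    by (rule has_bochner_integral_of_real)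
  have "(\<lambda>t. complex_of_real (G t)) = (\<lambda>t. if t < 0 then 0 else of_real (exp (-(x * t))) * F (of_real t))"
    using u by (auto simp: G_def F_def bern_kernel_def fun_eq_iff simp flip: exp_of_real)
  with 2 have "has_bochner_integral lborel (\<lambda>t. if t < 0 then 0 else of_real (exp (-(x * t))) * F (of_real t))
                 (of_real (\<Sum>j. u * (6 / (x + u * y j) ^ 4)))" by simp
  from has_bochner_integral_eq[OF 1 this]
  have "factorial_series (window_coeff \<theta> u) x = of_real x * of_real (\<Sum>j. u * (6 / (x + u * y j) ^ 4))"
    using x by (simp add: field_simps)
  thus ?thesis
    by (simp only: of_real_mult y_def)
qed

end

lemma has_integral_sums_uniform:
  fixes f :: "nat \<Rightarrow> real \<Rightarrow> complex"
  assumes cont: "\<And>k. continuous_on {0..1} (f k)"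
  assumes I: "\<And>k. (f k has_integral I k) {0..1}"
  assumes M: "eventually (\<lambda>k. \<forall>u\<in>{0..1}. norm (f k u) \<le> M k) sequentially" "summable M"
  assumes F: "\<And>u. u \<in> {0..1} \<Longrightarrow> (\<lambda>k. f k u) sums F u"
  shows   "(F has_integral suminf I) {0..1}" "I sums integral {0..1} F"
proof -
  have "uniform_limit {0..1} (\<lambda>n u. \<Sum>k<n. f k u) (\<lambda>u. \<Sum>k. f k u) sequentially"
    by (rule Weierstrass_m_test_ev[OF M])
  hence lim: "uniform_limit {0..1} (\<lambda>n u. \<Sum>k<n. f k u) F sequentially"
    by (rule uniform_limit_cong'[THEN iffD1, rotated 2]) (use F in \<open>auto simp: sums_iff\<close>)
  have ct: "continuous_on {0..1} (\<lambda>u. \<Sum>k<n. f k u)" for n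
    by (intro continuous_on_sum cont)
  obtain I' J where IJ: "\<And>n. ((\<lambda>u. \<Sum>k<n. f k u) has_integral I' n) {0..1}" "(F has_integral J) {0..1}" "I' \<longlonglongrightarrow> J"
    by (rule uniform_limit_integral[OF lim ct]) auto
  have "I' n = (\<Sum>k<n. I k)" for n
    using has_integral_unique[OF IJ(1) has_integral_sum[OF _ I]] by simp
  hence "I' = (\<lambda>n. \<Sum>k<n. I k)" by (rule ext)
  with IJ(3) have "I sums J" by (simp add: sums_def)
  thus "(F has_integral suminf I) {0..1}" "I sums integral {0..1} F"
    using IJ(2) by (auto simp: sums_iff integral_unique)
qed

text \<open>The substitution \<open>v = u (x + y) / (x + u y)\<close> reduces this to the Beta integral.\<close>
lemma has_integral_beta_substitution:
  fixes m x y :: real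
  assumes m: "-3 < m" "m < -2" and x: "x > 0" and y: "y > 0"
  shows   "((\<lambda>u. u powr (-1 - m) * (1 - u) powr (m + 3) / (x + u * y) ^ 4) has_integral
             (Beta (-m) (m + 4) * x powr (-m - 4) * (x + y) powr m)) {0..1}"
proof -
  define f where "f = (\<lambda>v. v powr (-m - 1) * (1 - v) powr ((m + 4) - 1))"
  define g where "g = (\<lambda>u. u * (x + y) / (x + u * y))"
  define g' where "g' = (\<lambda>u. (x + y) * x / (x + u * y) ^ 2)"
  have pos: "x + u * y > 0" if "u \<in> {0..1}" for u using that x y by (auto intro!: add_pos_nonneg)
  have "(f has_integral Beta (-m) (m + 4)) {0..1}"
    unfolding f_def using m by (intro has_integral_Beta_real) auto
  hence fi: "integral {0..1} f = Beta (-m) (m + 4)" by (rule integral_unique)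
  have one_minus_g: "1 - g u = x * (1 - u) / (x + u * y)" if "u \<in> {0..1}" for u
    using pos[OF that] by (simp add: g_def field_simps)
  have "((\<lambda>u. g' u *\<^sub>R f (g u)) has_integral (integral {g 0..g 1} f)) {0..1}"
  proof (rule has_integral_substitution[where c = 0 and d = 1])
    show "g 0 \<le> g 1" using x y by (simp add: g_def)
    show "g ` {0..1} \<subseteq> {0..1}"
    proof safe
      fix u :: real assume u: "u \<in> {0..1}"
      have "1 - g u \<ge> 0" unfolding one_minus_g[OF u] using pos[OF u] u x by auto
      moreover have "g u \<ge> 0" using pos[OF u] u x y by (auto simp: g_def)
      ultimately show "g u \<in> {0..1}" by simp
    qed
    show "continuous_on {0..1} f"
      unfolding f_def using m by (intro continuous_on_mult continuous_on_powr' continuous_intros) auto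
    fix u :: real assume u: "u \<in> {0..1}"
    show "(g has_field_derivative g' u) (at u within {0..1})"
      unfolding g_def g'_def using pos[OF u]
      by (auto intro!: derivative_eq_intros simp: field_simps power2_eq_square)
  qed auto
  moreover have "g 0 = 0" "g 1 = 1" using x y by (simp_all add: g_def)
  ultimately have "((\<lambda>u. g' u * f (g u)) has_integral Beta (-m) (m + 4)) {0..1}"
    by (simp add: fi)
  hence "((\<lambda>u. x powr (-m - 4) * (x + y) powr m * (g' u * f (g u))) has_integral
            x powr (-m - 4) * (x + y) powr m * Beta (-m) (m + 4)) {0..1}"
    by (rule has_integral_mult_right)
  hence "((\<lambda>u. u powr (-1 - m) * (1 - u) powr (m + 3) / (x + u * y) ^ 4) has_integral
            x powr (-m - 4) * (x + y) powr m * Beta (-m) (m + 4)) {0..1}"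
  proof (rule has_integral_eq[rotated])
    fix u :: real assume u: "u \<in> {0..1}"
    define q where "q = x + u * y"
    have q: "q > 0" using pos[OF u] by (simp add: q_def)
    have e1: "g u powr (-m - 1) = u powr (-m - 1) * (x + y) powr (-m - 1) / q powr (-m - 1)"
      unfolding g_def using u x y q by (simp add: q_def[symmetric] powr_mult powr_divide)
    have e2: "(1 - g u) powr (m + 4 - 1) = x powr (m + 3) * (1 - u) powr (m + 3) / q powr (m + 3)"
      unfolding one_minus_g[OF u] using u x y q by (simp add: q_def[symmetric] powr_mult powr_divide add.commute)
    have "x powr (-m - 4) * (x + y) powr m * (g' u * f (g u)) =
       (u powr (-m - 1) * (1 - u) powr (m + 3)) * ((x + y) * ((x + y) powr m * (x + y) powr (-m - 1))) *
         (x * (x powr (-m - 4) * x powr (m + 3))) / (q ^ 2 * (q powr (-m - 1) * q powr (m + 3)))"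
      unfolding g'_def f_def q_def[symmetric] e1 e2 by (simp add: mult_ac)
    also have "(x + y) powr m * (x + y) powr (-m - 1) = 1 / (x + y)"
      using x y by (simp add: powr_add[symmetric] powr_minus_divide)
    also have "x powr (-m - 4) * x powr (m + 3) = 1 / x"
      using x by (simp add: powr_add[symmetric] powr_minus_divide)
    also have "q powr (-m - 1) * q powr (m + 3) = q ^ 2"
      using q by (simp add: powr_add[symmetric])
    finally show "x powr (-m - 4) * (x + y) powr m * (g' u * f (g u)) =
                    u powr (-1 - m) * (1 - u) powr (m + 3) / (x + u * y) ^ 4"
      using x y by (simp add: q_def[symmetric] power_add[symmetric] minus_diff_commute)
  qed
  thus ?thesis by (simp add: mult_ac)
qed

lemma rGamma_mult_Gamma: "Re z > 0 \<Longrightarrow> rGamma z * Gamma z = (1 :: complex)"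
  by (subst rGamma_inverse_Gamma, subst left_inverse)
     (auto simp: Gamma_eq_zero_iff elim!: nonpos_Ints_cases)

text \<open>Only the term k = 0 sees C 0, because \<open>stirling k 0\<close> is 0 for k >
  0.\<close>

lemma factorial_series_add_delta:
  fixes C :: "nat \<Rightarrow> 'a :: {real_normed_field, banach}"
  assumes "tame C" "x > 0"
  shows   "factorial_series (\<lambda>l. C l + (if l = 0 then c else 0)) x = factorial_series C x + c"
proof -
  have "stirling_transform (\<lambda>l. if l = 0 then c else 0) k = (if k = 0 then c else 0)" for k
    by (cases k) (auto simp: stirling_transform_def intro!: sum.neutral)
  hence "stirling_transform (\<lambda>l. C l + (if l = 0 then c else 0)) k / of_real (pochhammer (x + 1) k) =
           stirling_transform C k / of_real (pochhammer (x + 1) k) + (if k = 0 then c else 0)" for k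
    by (simp add: stirling_transform_add add_divide_distrib)
  moreover have "(\<lambda>k. stirling_transform C k / of_real (pochhammer (x + 1) k) + (if k = 0 then c else 0)) sums
                   (factorial_series C x + c)"
    using sums_single[of 0 "\<lambda>_. c"] by (intro sums_add sums_factorial_series assms) simp
  ultimately show ?thesis
    unfolding factorial_series_def by (simp add: sums_iff)
qed

context
  fixes \<theta> x :: real
  assumes \<theta>: "0 \<le> \<theta>" "\<theta> < 1" and x: "x > 0"
begin

text \<open>
  In this range of \<open>m\<close> the sum converges and both exponents of the Beta weight of the second
  antiderivative are positive, so no terms of the kernel need to be removed.
\<close>
lemma tail_sum_window:
  fixes m :: real
  assumes m: "-3 < m" "m < -2"
  shows   "(\<lambda>j. of_real (x + (real (Suc j) - \<theta>)) powr of_real m) sums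
             (- (of_real x powr (of_real m + 1)) * (1 / (of_real m + 1) + em_series \<theta> x (of_real m)))"
proof -
  define M where "M = complex_of_real m"
  define \<kappa> where "\<kappa> = - (rGamma (-M) * rGamma (of_nat 2 + M + 2))"
  define W where "W = beta_weight (of_nat 0 - 1 - M) (0 + 2 + 1)"
  \<comment> \<open>Coefficients of the second antiderivative: \<open>em_coeff\<close> moved by two
    places, with 1/(M + 1) at l = 2. That is the value -Gamma(-1 - M)/Gamma(-M) of the Gamma formula
    at index 0, where \<open>em_coeff\<close> itself is set to 0.\<close>
  define C where "C = (\<lambda>l. if l < 2 then 0 else if l = 2 then 1 / (M + 1) else em_coeff \<theta> M (l - 2))"
  define y where "y = (\<lambda>j. real (Suc j) - \<theta>)"
  have y: "y j > 0" "y j \<ge> real j" for j using \<theta> by (auto simp: y_def)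
  have W_cont: "continuous_on {0..1} W"
    unfolding W_def by (rule continuous_on_beta_weight) (use m in \<open>auto simp: M_def\<close>)
  have W_le: "norm (W u) \<le> 1" if "u \<in> {0..1}" for u
    unfolding W_def by (rule norm_beta_weight_le_1) (use m that in \<open>auto simp: M_def\<close>)

  have int: "((\<lambda>u. \<kappa> * (W u * window_coeff \<theta> u l)) has_integral C l) {0..1}" for l
  proof (cases "l < 2")
    case False
    then obtain n where n: "l = n + 2" by (metis add.commute le_Suc_ex not_less)
    have "((\<lambda>u. \<kappa> * (W u * (fact (n + 2) * bern_coeff \<theta> n * of_real u ^ (n - 0)))) has_integral
             (- rGamma (-M) * Gamma (of_nat n - 1 - M) * bern_coeff \<theta> n)) {0..1}"
      unfolding \<kappa>_def W_def using m by (intro has_integral_em_coeff) (auto simp: M_def)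
    also have "- rGamma (-M) * Gamma (of_nat n - 1 - M) * bern_coeff \<theta> n = C l"
    proof (cases "n = 0")
      case True
      have b0: "bern_coeff \<theta> 0 = 1"
        using has_fps_expansion_imp_0_eq_fps_nth_0[OF bern_kernel_fps[of \<theta>]] by (simp add: bern_kernel_def)
      have e1: "rGamma (-1 - M) = (-1 - M) * rGamma (-M)"
        using rGamma_plus1[of "-1 - M"] by simp
      have e2: "rGamma (-1 - M) * Gamma (-1 - M) = 1"
        using m by (intro rGamma_mult_Gamma) (auto simp: M_def)
      have "(M + 1) * (- rGamma (-M) * Gamma (-1 - M)) = ((-1 - M) * rGamma (-M)) * Gamma (-1 - M)"
        by (simp add: algebra_simps)
      also have "\<dots> = 1" using e1 e2 by simp
      moreover have "M + 1 \<noteq> 0"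
        using m by (auto simp: M_def complex_eq_iff)
      ultimately show ?thesis using True n b0
        by (simp add: C_def eq_divide_eq mult.commute)
    next
      case False
      thus ?thesis using m n by (subst em_coeff_Gamma) (auto simp: C_def M_def)
    qed
    finally show ?thesis using n by (simp add: window_coeff_def mult_ac)
  qed (auto simp: C_def window_coeff_def)

  have int': "((\<lambda>u. \<kappa> * (W u * stirling_transform (\<lambda>l. window_coeff \<theta> u (l + a)) k)) has_integral
                stirling_transform (\<lambda>l. C (l + a)) k) {0..1}" for a k
    using has_integral_stirling_transform[of "\<lambda>u l. \<kappa> * (W u * window_coeff \<theta> u (l + a))" "\<lambda>l. C (l + a)", OF int]
    by (simp add: stirling_transform_mult)

  have tame_C: "tame (\<lambda>l. C (l + a))" if a: "a \<le> 2" for a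
    unfolding tame_def
  proof safe
    fix \<epsilon> :: real assume \<epsilon>: "0 < \<epsilon>" "\<epsilon> \<le> 1"
    obtain K where K: "K \<ge> 0" "\<And>u k. u \<in> {0..1} \<Longrightarrow> k > 0 \<Longrightarrow>
       norm (stirling_transform (\<lambda>l. window_coeff \<theta> u (l + a)) k) \<le> K * fact k * real k powr (\<epsilon> - 1)"
      using window_coeff_bound[OF \<theta> \<epsilon> a] by blast
    show "\<exists>K. \<forall>k>0. norm (stirling_transform (\<lambda>l. C (l + a)) k) \<le> K * fact k * real k powr (\<epsilon> - 1)"
    proof (intro exI[of _ "norm \<kappa> * K"] allI impI)
      fix k :: nat assume k: "k > 0"
      have "norm (stirling_transform (\<lambda>l. C (l + a)) k) \<le>
              norm \<kappa> * (1 * (K * fact k * real k powr (\<epsilon> - 1))) * measure lborel {0..1::real}"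
      proof (rule has_integral_bound_real[OF _ finite.emptyI int'])
        fix u :: real assume "u \<in> {0..1} - {}"
        thus "norm (\<kappa> * (W u * stirling_transform (\<lambda>l. window_coeff \<theta> u (l + a)) k)) \<le>
                norm \<kappa> * (1 * (K * fact k * real k powr (\<epsilon> - 1)))"
          unfolding norm_mult using K k W_le by (intro mult_mono) auto
      qed (use K in auto)
      thus "norm (stirling_transform (\<lambda>l. C (l + a)) k) \<le> norm \<kappa> * K * fact k * real k powr (\<epsilon> - 1)"
        by simp
    qed
  qed

  \<comment> \<open>Two applications of the shift rule, with C 0 = C 1 = 0, produce the factor
    x^2.\<close>
  have "em_series \<theta> x M + 1 / (M + 1) = factorial_series (\<lambda>l. em_coeff \<theta> M l + (if l = 0 then 1 / (M + 1) else 0)) x"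
    unfolding em_series_def using tame_em_coeff[of \<theta> M 0] \<theta> x by (subst factorial_series_add_delta) auto
  also have "(\<lambda>l. em_coeff \<theta> M l + (if l = 0 then 1 / (M + 1) else 0)) = (\<lambda>l. C (Suc (Suc l)))"
    by (auto simp: C_def em_coeff_def fun_eq_iff)
  also have "factorial_series \<dots> x = of_real x * (of_real x * factorial_series C x)"
    using tame_C[of 0] tame_C[of 1] x
    by (subst factorial_series_Suc[where C = "\<lambda>l. C (Suc l)"], simp_all)
       (subst factorial_series_Suc, simp_all add: C_def)
  finally have E: "em_series \<theta> x M + 1 / (M + 1) = of_real x ^ 2 * factorial_series C x"
    by (simp add: power2_eq_square mult.assoc)

  define F where "F = (\<lambda>u. \<kappa> * (W u * factorial_series (window_coeff \<theta> u) x))"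
  define d where "d = decay_exponent x"
  have d: "0 < d / 2" "d / 2 \<le> 1" using decay_exponent_bounds[OF x] by (auto simp: d_def)
  obtain K where K: "K \<ge> 0" "\<And>u k. u \<in> {0..1} \<Longrightarrow> k > 0 \<Longrightarrow>
     norm (stirling_transform (\<lambda>l. window_coeff \<theta> u (l + 0)) k) \<le> K * fact k * real k powr (d / 2 - 1)"
    using window_coeff_bound[OF \<theta> d, of 0] by blast
  \<comment> \<open>First evaluation of the integral of \<open>F\<close>: termwise in the index k of
    the inverse factorial series.\<close>
  have "(F has_integral (\<Sum>k. stirling_transform C k / of_real (pochhammer (x + 1) k))) {0..1}"
  proof (rule has_integral_sums_uniform(1))
    fix k
    define P where "P = complex_of_real (pochhammer (x + 1) k)"
    have P: "P \<noteq> 0" using pochhammer_pos[of "x + 1" k] x by (simp add: P_def)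
    show "continuous_on {0..1} (\<lambda>u. \<kappa> * (W u * (stirling_transform (window_coeff \<theta> u) k / P)))"
    proof -
      have "continuous_on {0..1} (\<lambda>u. window_coeff \<theta> u l)" for l
        unfolding window_coeff_def by (cases "l < 2") (auto intro!: continuous_intros)
      thus ?thesis
        unfolding stirling_transform_def using P by (intro continuous_intros W_cont) auto
    qed
    show "((\<lambda>u. \<kappa> * (W u * (stirling_transform (window_coeff \<theta> u) k / P))) has_integral stirling_transform C k / P) {0..1}"
      using has_integral_divide[OF int'[of 0 k], of P] by (simp add: mult.assoc)
  next
    show "eventually (\<lambda>k. \<forall>u\<in>{0..1}. norm (\<kappa> * (W u * (stirling_transform (window_coeff \<theta> u) k / of_real (pochhammer (x + 1) k)))) \<le>
            norm \<kappa> * (K * real k powr (-1 - decay_exponent x / 2))) sequentially"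
      using eventually_gt_at_top[of 0]
    proof eventually_elim
      case (elim k)
      show ?case
      proof
        fix u :: real assume u: "u \<in> {0..1}"
        have "norm (stirling_transform (window_coeff \<theta> u) k / of_real (pochhammer (x + 1) k)) \<le>
                K * real k powr (-1 - decay_exponent x / 2)"
          using K(2)[OF u elim] by (intro norm_div_pochhammer_le[OF x elim]) (simp add: d_def)
        hence "norm \<kappa> * (norm (W u) * norm (stirling_transform (window_coeff \<theta> u) k / of_real (pochhammer (x + 1) k))) \<le>
               norm \<kappa> * (1 * (K * real k powr (-1 - decay_exponent x / 2)))"
          using u by (intro mult_left_mono mult_mono W_le) auto
        thus "norm (\<kappa> * (W u * (stirling_transform (window_coeff \<theta> u) k / of_real (pochhammer (x + 1) k)))) \<le>
               norm \<kappa> * (K * real k powr (-1 - decay_exponent x / 2))"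
          by (simp only: norm_mult mult_1)
      qed
    qed
  next
    show "summable (\<lambda>k. norm \<kappa> * (K * real k powr (-1 - decay_exponent x / 2)))"
      by (intro summable_mult summable_decay x)
  next
    fix u :: real assume "u \<in> {0..1}"
    thus "(\<lambda>k. \<kappa> * (W u * (stirling_transform (window_coeff \<theta> u) k / of_real (pochhammer (x + 1) k)))) sums F u"
      unfolding F_def by (intro sums_mult sums_factorial_series tame_window_coeff \<theta> x)
  qed
  hence F_int: "integral {0..1} F = factorial_series C x"
    by (simp add: factorial_series_def integral_unique)

  have W_real: "W u = of_real (u powr (-2 - m) * (1 - u) powr (m + 3))" if "u \<in> {0..1}" for u
  proof -
    have e: "of_nat 0 - 1 - M - 1 = complex_of_real (-2 - m)"
         "of_nat (0 + 2 + 1) - (of_nat 0 - 1 - M) - 1 = complex_of_real (m + 3)"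
      by (simp_all add: M_def)
    have p: "complex_of_real u powr of_real (-2 - m) = of_real (u powr (-2 - m))"
            "complex_of_real (1 - u) powr of_real (m + 3) = of_real ((1 - u) powr (m + 3))"
      using that by (auto intro!: powr_of_real simp del: of_real_diff of_real_add)
    show ?thesis
      unfolding W_def beta_weight_def e p of_real_mult ..
  qed
  define h where "h = (\<lambda>j u. of_real (6 * x) * \<kappa> * of_real (u powr (-1 - m) * (1 - u) powr (m + 3) / (x + u * y j) ^ 4))"
  define I where "I = (\<lambda>j. of_real (6 * x) * \<kappa> * complex_of_real (Beta (-m) (m + 4) * x powr (-m - 4) * (x + y j) powr m))"
  have pos: "x + u * y j > 0" if "u \<in> {0..1}" for u j
    using that x y[of j] by (auto intro!: add_pos_nonneg)
  \<comment> \<open>Second evaluation of the same integral: termwise in the index j of the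
    exponentials.\<close>
  have "I sums integral {0..1} F"
  proof (rule has_integral_sums_uniform(2))
    fix j
    show "(h j has_integral I j) {0..1}"
      unfolding h_def I_def
      by (intro has_integral_mult_right has_integral_of_real has_integral_beta_substitution m x y)
    show "continuous_on {0..1} (h j)"
      unfolding h_def using m pos[of _ j]
      by (intro continuous_on_mult continuous_on_of_real continuous_on_powr' continuous_on_divide continuous_intros)
         (auto simp: less_imp_neq[symmetric])
  next
    \<comment> \<open>The exponent 1 + m is below -1. With q = x + u y_j, the inequality u y_j \<le>
      q gives u^(-1 - m) \<le> q^(-1 - m) y_j^(1 + m); the fourth power of q leaves q^(-m - 5), at
      most x^(-m - 5) since that exponent is negative.\<close>
    show "summable (\<lambda>j. norm (of_real (6 * x) * \<kappa>) * x powr (-m - 5) * real j powr (1 + m))"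
      using m by (intro summable_mult) (simp add: summable_real_powr_iff)
    show "eventually (\<lambda>j. \<forall>u\<in>{0..1}. norm (h j u) \<le> norm (of_real (6 * x) * \<kappa>) * x powr (-m - 5) * real j powr (1 + m)) sequentially"
      using eventually_gt_at_top[of 0]
    proof eventually_elim
      case (elim j)
      show ?case
      proof
        fix u :: real assume u: "u \<in> {0..1}"
        define q where "q = x + u * y j"
        have q: "q > 0" "u * y j \<le> q" "x \<le> q" using pos[OF u, of j] u x y[of j] by (auto simp: q_def)
        have u_eq: "u powr (-1 - m) = (u * y j) powr (-1 - m) * y j powr (1 + m)"
        proof -
          have "y j powr (-1 - m) * y j powr (1 + m) = 1"
            using y[of j] by (simp add: powr_add[symmetric])
          thus ?thesis using u y[of j] by (simp add: powr_mult)
        qed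
        have "u powr (-1 - m) * (1 - u) powr (m + 3) / q ^ 4 \<le> u powr (-1 - m) * 1 / q ^ 4"
          using u m q powr_mono2[of "m + 3" "1 - u" 1] by (intro divide_right_mono mult_left_mono) auto
        also have "\<dots> \<le> q powr (-1 - m) * real j powr (1 + m) * 1 / q ^ 4"
          unfolding u_eq using u m q y[of j] elim
          by (intro divide_right_mono mult_mono powr_mono2 powr_mono2') auto
        also have "\<dots> = q powr (-m - 5) * real j powr (1 + m)"
        proof -
          have "q powr (-m - 5) * q ^ 4 = q powr (-1 - m)"
            using q by (simp add: powr_add[symmetric] flip: powr_numeral)
          thus ?thesis using q by (simp add: field_simps)
        qed
        also have "\<dots> \<le> x powr (-m - 5) * real j powr (1 + m)"
          using q x m by (intro mult_right_mono powr_mono2') auto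
        finally have *: "u powr (-1 - m) * (1 - u) powr (m + 3) / q ^ 4 \<le> x powr (-m - 5) * real j powr (1 + m)" .
        have "norm (h j u) = norm (of_real (6 * x) * \<kappa>) * (u powr (-1 - m) * (1 - u) powr (m + 3) / q ^ 4)"
          using q unfolding h_def norm_mult norm_of_real q_def[symmetric] by simp
        also have "\<dots> \<le> norm (of_real (6 * x) * \<kappa>) * (x powr (-m - 5) * real j powr (1 + m))"
          by (intro mult_left_mono *) auto
        finally show "norm (h j u) \<le> norm (of_real (6 * x) * \<kappa>) * x powr (-m - 5) * real j powr (1 + m)"
          by (simp only: mult.assoc)
      qed
    qed
  next
    fix u :: real assume u: "u \<in> {0..1}"
    show "(\<lambda>j. h j u) sums F u"
    \<comment> \<open>The closed form of the inner series is available for u > 0; at u = 0 both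
      sides vanish because \<open>0 powr\<close> is 0.\<close>
    proof (cases "u = 0")
      case True
      thus ?thesis using W_real[OF u] by (simp add: h_def F_def)
    next
      case False
      hence u': "0 < u" "u \<le> 1" using u by auto
      have "(\<lambda>j. u * (6 / (x + u * y j) ^ 4)) sums (\<Sum>j. u * (6 / (x + u * y j) ^ 4))"
        unfolding y_def by (intro summable_sums summable_window \<theta> x u')
      hence "(\<lambda>j. \<kappa> * (W u * of_real (x * (u * (6 / (x + u * y j) ^ 4))))) sums F u"
        unfolding F_def factorial_series_window_coeff[OF \<theta> x u'] y_def
        by (intro sums_mult sums_of_real)
      also have "(\<lambda>j. \<kappa> * (W u * of_real (x * (u * (6 / (x + u * y j) ^ 4))))) = (\<lambda>j. h j u)"
      proof
        fix j
        have "u powr (-1 - m) = u powr (-2 - m) * u"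
          using u' powr_add[of u "-2 - m" 1] by simp
        thus "\<kappa> * (W u * of_real (x * (u * (6 / (x + u * y j) ^ 4)))) = h j u"
          unfolding W_real[OF u] h_def by (simp add: mult_ac)
      qed
      finally show ?thesis .
    qed
  qed
  hence "(\<lambda>j. - (of_real x powr (M + 1)) * of_real x ^ 2 * I j) sums (- (of_real x powr (M + 1)) * of_real x ^ 2 * factorial_series C x)"
    unfolding F_int by (rule sums_mult)
  also have "- (of_real x powr (M + 1)) * of_real x ^ 2 * factorial_series C x =
               - (of_real x powr (M + 1)) * (1 / (M + 1) + em_series \<theta> x M)"
    using E by (simp add: mult.assoc add.commute)
  also have "(\<lambda>j. - (of_real x powr (M + 1)) * of_real x ^ 2 * I j) = (\<lambda>j. of_real (x + y j) powr M)"
  proof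
    fix j
    have Beta: "complex_of_real (Beta (-m) (m + 4)) = Gamma (-M) * Gamma (M + 4) / 6"
      by (simp add: Beta_def M_def Gamma_complex_of_real[symmetric] Gamma_numeral fact_numeral)
    have g1: "rGamma (-M) * Gamma (-M) = 1" "rGamma (M + 4) * Gamma (M + 4) = 1"
      using m by (auto intro!: rGamma_mult_Gamma simp: M_def)
    have "\<kappa> = - (rGamma (-M) * rGamma (M + 4))"
      by (simp add: \<kappa>_def add_ac)
    \<comment> \<open>\<open>\<kappa>\<close> is made to cancel the Gamma factors of the Beta
      function; the 6 from integrating t^3 cancels Gamma 4 = 6.\<close>
    hence \<kappa>: "6 * \<kappa> * complex_of_real (Beta (-m) (m + 4)) = - ((rGamma (-M) * Gamma (-M)) * (rGamma (M + 4) * Gamma (M + 4)))"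
      unfolding Beta by simp
    have "x powr (m + 1) * x ^ 2 * x * x powr (-m - 4) = x powr (m + 1) * x powr 2 * x powr 1 * x powr (-m - 4)"
      using x by simp
    also have "\<dots> = x powr ((m + 1) + 2 + 1 + (-m - 4))"
      by (simp only: powr_add)
    also have "\<dots> = 1" using x by simp
    finally have px: "x powr (m + 1) * x ^ 2 * x * x powr (-m - 4) = 1" .
    have xM: "of_real x powr (M + 1) = complex_of_real (x powr (m + 1))"
      using x by (simp add: M_def powr_of_real[symmetric])
    have xy: "of_real (x + y j) powr M = complex_of_real ((x + y j) powr m)"
      using x y[of j] unfolding M_def by (intro powr_of_real) auto
    have "- (of_real x powr (M + 1)) * of_real x ^ 2 * I j =
            - (6 * \<kappa> * complex_of_real (Beta (-m) (m + 4))) * of_real (x powr (m + 1) * x ^ 2 * x * x powr (-m - 4)) * of_real ((x + y j) powr m)"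
      unfolding xM I_def by (simp add: mult_ac)
    also have "\<dots> = of_real (x + y j) powr M"
      unfolding \<kappa> g1 px xy by simp
    finally show "- (of_real x powr (M + 1)) * of_real x ^ 2 * I j = of_real (x + y j) powr M" .
  qed
  finally show ?thesis
    by (simp add: M_def y_def)
qed

end

section \<open>Analytic continuation in the exponent\<close>

text \<open>Both sides are holomorphic on a connected half-plane, so agreement on (-3, -2) decides.
  The whole half-plane is wanted because \<open>is_zeta\<close> prescribes the Dirichlet series for
  all Re s > 1.\<close>

lemma tail_sum:
  assumes \<theta>: "0 \<le> \<theta>" "\<theta> < 1" and x: "x > 0" and m: "Re m < -1"
  shows   "(\<lambda>j. of_real (x + (real (Suc j) - \<theta>)) powr m) sums
             (- (of_real x powr (m + 1)) * (1 / (m + 1) + em_series \<theta> x m))"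
proof -
  define S where "S = {m. Re m < -1}"
  have S: "open S" "convex S" by (simp_all add: S_def open_halfspace_Re_lt convex_halfspace_Re_lt)
  define b where "b = (\<lambda>j. x + (real (Suc j) - \<theta>))"
  have b: "b j > 0" "b j \<ge> real j" for j using \<theta> x by (auto simp: b_def)
  have bd: "norm (of_real (b j) powr m) \<le> real j powr \<sigma>" if "j > 0" "Re m \<le> \<sigma>" "\<sigma> < -1" for j m \<sigma>
  proof -
    have "norm (of_real (b j) powr m) = b j powr Re m"
      using b[of j] by (simp add: norm_powr_real_powr)
    also have "\<dots> \<le> b j powr \<sigma>"
      using that b[of j] by (intro powr_mono) auto
    also have "\<dots> \<le> real j powr \<sigma>"
      using that b[of j] by (intro powr_mono2') auto
    finally show ?thesis .
  qed
  have sm: "summable (\<lambda>j. real j powr \<sigma>)" if "\<sigma> < -1" for \<sigma> :: real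
    using that by (simp add: summable_real_powr_iff)
  define T where "T = (\<lambda>m. \<Sum>j. complex_of_real (b j) powr m)"
  have T_sums: "(\<lambda>j. of_real (b j) powr m) sums T m" if "Re m < -1" for m
    unfolding T_def
    by (intro summable_sums summable_comparison_test_ev[OF _ sm[OF that]] eventually_mono[OF eventually_gt_at_top[of 0]] bd that)
       auto
  have T_hol: "T holomorphic_on S"
  proof (rule holomorphic_uniform_sequence[OF S(1)])
    show "(\<lambda>m. \<Sum>j<n. complex_of_real (b j) powr m) holomorphic_on S" for n
      by (intro holomorphic_intros)
    fix z assume z: "z \<in> S"
    define d where "d = (-1 - Re z) / 2"
    have d: "d > 0" "Re z + d < -1" using z by (auto simp: S_def d_def field_simps)
    have re: "Re w \<le> Re z + d" if "w \<in> cball z d" for w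
      using that abs_Re_le_cmod[of "z - w"] by (auto simp: dist_norm)
    have "uniform_limit (cball z d) (\<lambda>n m. \<Sum>j<n. complex_of_real (b j) powr m) T sequentially"
      unfolding T_def
      by (rule Weierstrass_m_test_ev[OF _ sm[OF d(2)]], rule eventually_mono[OF eventually_gt_at_top[of 0]])
         (use re d in \<open>auto intro!: bd\<close>)
    moreover have "cball z d \<subseteq> S"
      using re d by (force simp: S_def)
    ultimately show "\<exists>d>0. cball z d \<subseteq> S \<and>
        uniform_limit (cball z d) (\<lambda>n m. \<Sum>j<n. complex_of_real (b j) powr m) T sequentially"
      using d by blast
  qed
  have nz: "w + 1 \<noteq> 0" if "w \<in> S" for w
    using that by (auto simp: S_def complex_eq_iff)
  have "T m - (- (of_real x powr (m + 1)) * (1 / (m + 1) + em_series \<theta> x m)) = 0"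
  proof (rule analytic_continuation_real_interval[where S = S and a = "-3" and b = "-2" and w = m and
      f = "\<lambda>m. T m - (- (of_real x powr (m + 1)) * (1 / (m + 1) + em_series \<theta> x m))"])
    show "(\<lambda>m. T m - (- (of_real x powr (m + 1)) * (1 / (m + 1) + em_series \<theta> x m))) holomorphic_on S"
      using nz x \<theta> by (intro holomorphic_intros T_hol holomorphic_em_series) auto
    fix t :: real assume t: "-3 < t" "t < -2"
    have "T (of_real t) = - (of_real x powr (of_real t + 1)) * (1 / (of_real t + 1) + em_series \<theta> x (of_real t))"
      using tail_sum_window[OF \<theta> x t] T_sums[of "of_real t"] t unfolding b_def
      by (intro sums_unique2[OF T_sums[unfolded b_def]]) auto
    thus "T (of_real t) - (- (of_real x powr (of_real t + 1)) * (1 / (of_real t + 1) + em_series \<theta> x (of_real t))) = 0"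
      by simp
  qed (use S m in \<open>auto simp: S_def intro!: convex_connected\<close>)
  hence "T m = - (of_real x powr (m + 1)) * (1 / (m + 1) + em_series \<theta> x m)"
    by (rule eq_iff_diff_eq_0[THEN iffD2])
  thus ?thesis using T_sums[OF m] unfolding b_def by (simp only:)
qed

text \<open>For x = 1 and \<theta> = 0 the tail runs over n \<ge> 2, which accounts for the leading
  1. This also supplies the existence behind the definite description \<open>zeta\<close>.\<close>

lemma is_zeta_em_series:
  "is_zeta (\<lambda>s. if s = 1 then 0 else 1 - (1 / (1 - s) + em_series 0 1 (-s)))"
  unfolding is_zeta_def
proof (intro conjI allI impI)
  have "em_series 0 1 \<circ> uminus holomorphic_on - {1}"
    by (intro holomorphic_on_compose holomorphic_em_series holomorphic_intros) auto
  hence "(\<lambda>s. 1 - (1 / (1 - s) + em_series 0 1 (-s))) holomorphic_on - {1}"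
    unfolding o_def by (intro holomorphic_intros) auto
  thus "(\<lambda>s. if s = 1 then 0 else 1 - (1 / (1 - s) + em_series 0 1 (-s))) holomorphic_on - {1}"
    by (rule holomorphic_transform) auto
next
  fix s :: complex assume s: "Re s > 1"
  have "(\<lambda>j. of_real (1 + (real (Suc j) - 0)) powr (-s)) sums
          (- (of_real 1 powr (-s + 1)) * (1 / (-s + 1) + em_series 0 1 (-s)))"
    by (rule tail_sum) (use s in auto)
  hence "(\<lambda>j. 1 / of_nat (Suc (Suc j)) powr s) sums (- (1 / (1 - s) + em_series 0 1 (-s)))"
    by (simp add: powr_minus_divide add_ac)
  hence "(\<lambda>n. 1 / of_nat (Suc n) powr s) sums (- (1 / (1 - s) + em_series 0 1 (-s)) + 1 / of_nat (Suc 0) powr s)"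
    by (subst (asm) sums_Suc_iff) simp
  moreover have "- (1 / (1 - s) + em_series 0 1 (-s)) + 1 / of_nat (Suc 0) powr s = 1 - (1 / (1 - s) + em_series 0 1 (-s))"
    by simp
  ultimately have "(\<lambda>n. 1 / of_nat (Suc n) powr s) sums (1 - (1 / (1 - s) + em_series 0 1 (-s)))"
    by (simp only:)
  thus "(\<lambda>n. 1 / of_nat (Suc n) powr s) sums (if s = 1 then 0 else 1 - (1 / (1 - s) + em_series 0 1 (-s)))"
    using s by auto
qed auto

lemma is_zeta_zeta: "is_zeta zeta"
  using zeta_eqI[OF is_zeta_em_series] is_zeta_em_series by simp

lemma zeta_eq_em_series: "m \<noteq> -1 \<Longrightarrow> zeta (-m) = 1 - (1 / (m + 1) + em_series 0 1 m)"
  unfolding zeta_eqI[OF is_zeta_em_series] by (auto simp: minus_equation_iff add.commute)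

text \<open>Shows that \<open>tail_sum\<close> with \<theta> = frac x runs over exactly the integers
  above x.\<close>

lemma frac_plus: "x \<ge> 0 \<Longrightarrow> x + (real n - frac x) = real (nat \<lfloor>x\<rfloor> + n)"
  by (simp add: frac_def)

text \<open>For -3 < m < -2 the finite sum is zeta(-m) minus the tail. Both sides are holomorphic on
  the plane without -1, which is connected.\<close>

theorem power_sum_em_series:
  assumes x: "x > 0" and m: "m \<noteq> -1"
  shows   "(\<Sum>k=1..nat \<lfloor>x\<rfloor>. of_nat k powr m) =
             of_real x powr (m + 1) / (m + 1) + zeta (-m) + of_real x powr (m + 1) * em_series (frac x) x m"
proof -
  define N where "N = nat \<lfloor>x\<rfloor>"
  have \<theta>: "0 \<le> frac x" "frac x < 1" by (auto simp: frac_lt_1)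
  have hol_zeta: "zeta holomorphic_on - {1}" and zeta_sums: "Re s > 1 \<Longrightarrow> (\<lambda>n. 1 / of_nat (Suc n) powr s) sums zeta s" for s
    using is_zeta_zeta unfolding is_zeta_def by blast+
  define f where "f = (\<lambda>m. (\<Sum>k=1..N. of_nat k powr m) -
     (of_real x powr (m + 1) / (m + 1) + zeta (-m) + of_real x powr (m + 1) * em_series (frac x) x m))"
  have "f m = 0"
  proof (rule analytic_continuation_real_interval[where S = "-{-1}" and a = "-3" and b = "-2" and w = m and f = f])
    have "zeta \<circ> uminus holomorphic_on - {-1}"
      by (intro holomorphic_on_compose holomorphic_intros holomorphic_on_subset[OF hol_zeta])
         (auto dest: arg_cong[of _ _ uminus])
    thus "f holomorphic_on -{-1}"
      unfolding f_def o_def using x \<theta>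
      by (intro holomorphic_intros holomorphic_em_series)
         (auto simp: add_eq_0_iff dest: arg_cong[of _ _ uminus])
    show "connected (-{-1::complex})"
      by (intro path_connected_imp_connected path_connected_punctured_universe) simp
    show "complex_of_real t \<in> - {- 1}" if "-3 < t" "t < -2" for t
      using that by (auto simp: complex_eq_iff)
    fix t :: real assume t: "-3 < t" "t < -2"
    have "(\<lambda>n. 1 / of_nat (Suc n) powr (- complex_of_real t)) sums zeta (- of_real t)"
      using t by (intro zeta_sums) auto
    hence 1: "(\<lambda>n. of_nat (Suc n) powr complex_of_real t) sums zeta (- of_real t)"
      by (simp add: powr_minus_divide)
    have "(\<lambda>j. of_real (x + (real (Suc j) - frac x)) powr complex_of_real t) sums
            (- (of_real x powr (of_real t + 1)) * (1 / (of_real t + 1) + em_series (frac x) x (of_real t)))"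
      using t x \<theta> by (intro tail_sum) auto
    hence 2: "(\<lambda>j. of_nat (Suc (j + N)) powr complex_of_real t) sums
            (- (of_real x powr (of_real t + 1)) * (1 / (of_real t + 1) + em_series (frac x) x (of_real t)))"
      using x by (subst (asm) frac_plus) (simp_all add: N_def add_ac)
    have "(\<Sum>k=1..N. of_nat k powr complex_of_real t) = (\<Sum>n<N. of_nat (Suc n) powr complex_of_real t)"
      by (rule sum.reindex_bij_witness[of _ Suc "\<lambda>k. k - 1"]) auto
    also have "\<dots> = zeta (- of_real t) - (- (of_real x powr (of_real t + 1)) * (1 / (of_real t + 1) + em_series (frac x) x (of_real t)))"
      using sums_unique2[OF 2 sums_split_initial_segment[OF 1, of N]] by simp
    finally show "f (of_real t) = 0"
      by (simp add: f_def algebra_simps)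
  qed (use m in auto)
  thus ?thesis by (simp add: f_def N_def)
qed

section \<open>The limit at exponent -1\<close>

lemma power_difference_quotient_tendsto:
  assumes "x > 0"
  shows   "((\<lambda>m. (of_real x powr (m + 1) - 1) / (m + 1)) \<longlongrightarrow> complex_of_real (ln x)) (at (-1))"
proof -
  have "((\<lambda>z. complex_of_real x powr z) has_field_derivative
          Ln (of_real x) * of_real x powr (-1 + 1)) (at (-1 + 1))"
    using assms by (intro has_field_derivative_powr_right) auto
  hence "((\<lambda>m. complex_of_real x powr (m + 1)) has_field_derivative
          Ln (of_real x) * of_real x powr (-1 + 1)) (at (-1))"
    by (subst (asm) DERIV_shift)
  hence "((\<lambda>m. (of_real x powr (m + 1) - of_real x powr (-1 + 1)) / (m - (-1))) \<longlongrightarrow> Ln (of_real x)) (at (-1))"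
    using assms by (simp add: has_field_derivative_iff)
  thus ?thesis using assms by (simp add: Ln_of_real)
qed

lemma em_series_tendsto:
  assumes "x > 0" "0 \<le> \<theta>" "\<theta> \<le> 1"
  shows   "(em_series \<theta> x \<longlongrightarrow> em_series \<theta> x a) (at a)"
  using holomorphic_on_imp_continuous_on[OF holomorphic_em_series[OF assms(2,3,1), of UNIV]]
  by (simp add: continuous_on_eq_continuous_at isCont_def)

text \<open>At m = -1 the pole of x^(m + 1)/(m + 1) cancels against the term -1/(m + 1) of zeta(-m).
  Joined as (x^(m + 1) - 1)/(m + 1) they tend to ln x, and what remains on the right does not
  involve x.\<close>

lemma harmonic_em_series_const:
  assumes x: "x > 0"
  shows   "(\<Sum>k=1..nat \<lfloor>x\<rfloor>. 1 / of_nat k) - of_real (ln x) - em_series (frac x) x (-1) =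
             1 - em_series 0 1 (-1)"
proof (rule tendsto_unique)
  define L where "L = (\<lambda>m. (\<Sum>k=1..nat \<lfloor>x\<rfloor>. of_nat k powr m) - (of_real x powr (m + 1) - 1) / (m + 1) -
                       of_real x powr (m + 1) * em_series (frac x) x m)"
  have "(L \<longlongrightarrow> (\<Sum>k=1..nat \<lfloor>x\<rfloor>. of_nat k powr (-1)) - of_real (ln x) - of_real x powr (-1 + 1) * em_series (frac x) x (-1)) (at (-1))"
    unfolding L_def using x
    by (intro tendsto_intros power_difference_quotient_tendsto em_series_tendsto) (auto simp: frac_lt_1 less_imp_le)
  thus "(L \<longlongrightarrow> (\<Sum>k=1..nat \<lfloor>x\<rfloor>. 1 / of_nat k) - of_real (ln x) - em_series (frac x) x (-1)) (at (-1))"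
    using x by (simp add: powr_minus_divide)
  have "eventually (\<lambda>m. m \<noteq> -1) (at (-1 :: complex))"
    by (simp add: eventually_at_filter)
  hence "eventually (\<lambda>m. 1 - em_series 0 1 m = L m) (at (-1))"
  proof eventually_elim
    case (elim m)
    hence "m + 1 \<noteq> 0" by (metis add_eq_0_iff minus_minus)
    thus ?case
      unfolding L_def power_sum_em_series[OF x elim] zeta_eq_em_series[OF elim]
      by (simp add: diff_divide_distrib)
  qed
  moreover have "((\<lambda>m. 1 - em_series 0 1 m) \<longlongrightarrow> 1 - em_series 0 1 (-1)) (at (-1))"
    by (intro tendsto_intros em_series_tendsto) auto
  ultimately show "(L \<longlongrightarrow> 1 - em_series 0 1 (-1)) (at (-1))"
    by (simp add: tendsto_cong)
qed auto

text \<open>As C 0 = 0, every denominator that matters contains the factor N + 1, and its other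
  factors are at least those for N = 1. The 2 is the first factor of
  \<open>pochhammer (1 + 1) k\<close>.\<close>

lemma norm_factorial_series_le:
  fixes C :: "nat \<Rightarrow> 'a :: {real_normed_field, banach}"
  assumes tame: "tame C" and C0: "C 0 = 0"
  shows   "\<exists>B. \<forall>N>0. norm (factorial_series C (real N)) \<le> B / (real N + 1)"
proof -
  define e where "e = stirling_transform C"
  have sm: "summable (\<lambda>k. norm (e k / of_real (pochhammer (1 + 1) k)))"
    unfolding e_def by (rule tame_summable_norm[OF tame]) simp
  show ?thesis
  proof (intro exI[of _ "2 * (\<Sum>k. norm (e k / of_real (pochhammer (1 + 1) k)))"] allI impI)
    fix N :: nat assume N: "N > 0"
    have le: "norm (e k / of_real (pochhammer (real N + 1) k)) \<le> 2 / (real N + 1) * norm (e k / of_real (pochhammer (1 + 1) k))" for k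
    proof (cases k)
      case 0
      thus ?thesis using C0 by (simp add: e_def)
    next
      case (Suc n)
      have "pochhammer (3::real) n \<le> pochhammer (real N + 2) n"
        unfolding pochhammer_prod using N by (intro prod_mono) auto
      hence "(real N + 1) * pochhammer (1 + 1) k \<le> 2 * pochhammer (real N + 1) k"
        unfolding Suc pochhammer_rec by (simp add: add_ac)
      moreover have p: "pochhammer (1 + 1 :: real) k > 0" "pochhammer (real N + 1) k > 0"
        by (intro pochhammer_pos; simp)+
      ultimately have "2 / (2 * pochhammer (real N + 1) k) \<le> 2 / ((real N + 1) * pochhammer (1 + 1) k)"
        by (intro divide_left_mono mult_pos_pos) auto
      hence "1 / pochhammer (real N + 1) k \<le> 2 / ((real N + 1) * pochhammer (1 + 1) k)"
        by simp
      hence "norm (e k) * (1 / pochhammer (real N + 1) k) \<le> norm (e k) * (2 / ((real N + 1) * pochhammer (1 + 1) k))"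
        by (intro mult_left_mono) auto
      thus ?thesis using p by (simp add: norm_divide mult.commute)
    qed
    have "norm (factorial_series C (real N)) \<le> (\<Sum>k. 2 / (real N + 1) * norm (e k / of_real (pochhammer (1 + 1) k)))"
      unfolding factorial_series_def e_def[symmetric]
      by (rule norm_suminf_le[OF le summable_mult[OF sm]])
    also have "\<dots> = 2 / (real N + 1) * (\<Sum>k. norm (e k / of_real (pochhammer (1 + 1) k)))"
      by (rule suminf_mult[OF sm])
    finally show "norm (factorial_series C (real N)) \<le> 2 * (\<Sum>k. norm (e k / of_real (pochhammer (1 + 1) k))) / (real N + 1)"
      by simp
  qed
qed

text \<open>The constant does not depend on x, so it is read off along the integers, where the
  fractional part 0 fixes a single coefficient sequence and the decay 1/(N + 1) of the series
  applies.\<close>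

theorem harmonic_sum_em_series:
  assumes x: "x > 0"
  shows   "(\<Sum>k=1..nat \<lfloor>x\<rfloor>. 1 / of_nat k) = of_real (ln x + euler_mascheroni) + em_series (frac x) x (-1)"
proof -
  define c where "c = 1 - em_series 0 1 (-1)"
  have "tame (em_coeff 0 (-1))" "em_coeff 0 (-1) 0 = 0"
  proof -
    show "tame (em_coeff 0 (-1))"
      using tame_em_coeff[of 0 "-1" 0] unfolding add_0_right by simp
  qed (simp add: em_coeff_def)
  then obtain B where B: "\<And>N. N > 0 \<Longrightarrow> norm (factorial_series (em_coeff 0 (-1)) (real N)) \<le> B / (real N + 1)"
    using norm_factorial_series_le by blast
  have "(\<lambda>N. em_series 0 (real N) (-1)) \<longlonglongrightarrow> 0"
    unfolding em_series_def
  proof (rule Lim_null_comparison)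
    show "eventually (\<lambda>N. norm (factorial_series (em_coeff 0 (-1)) (real N)) \<le> B / (real N + 1)) sequentially"
      using eventually_gt_at_top[of 0] by eventually_elim (rule B)
    show "(\<lambda>N. B / (real N + 1)) \<longlonglongrightarrow> 0" by real_asymp
  qed
  moreover have "(\<lambda>N. complex_of_real (harm N - ln (real N))) \<longlonglongrightarrow> of_real euler_mascheroni"
    using euler_mascheroni_LIMSEQ by (rule tendsto_of_real)
  ultimately have "(\<lambda>N. complex_of_real (harm N - ln (real N)) - em_series 0 (real N) (-1)) \<longlonglongrightarrow> of_real euler_mascheroni - 0"
    by (rule tendsto_diff[rotated])
  moreover have "eventually (\<lambda>N. complex_of_real (harm N - ln (real N)) - em_series 0 (real N) (-1) = c) sequentially"
    using eventually_gt_at_top[of 0]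
  proof eventually_elim
    case (elim N)
    have "complex_of_real (harm N) = (\<Sum>k=1..N. 1 / of_nat k)"
      by (simp add: harm_def inverse_eq_divide)
    moreover have fr: "frac (real N) = 0" by (simp add: frac_eq_0_iff)
    ultimately show ?case
      using harmonic_em_series_const[of "real N"] elim by (simp add: c_def fr)
  qed
  ultimately have "(\<lambda>N::nat. c) \<longlonglongrightarrow> of_real euler_mascheroni"
    by (simp add: tendsto_cong)
  hence "c = of_real euler_mascheroni"
    using LIMSEQ_unique[OF tendsto_const] by blast
  thus ?thesis
    using harmonic_em_series_const[OF x] by (simp add: c_def[symmetric] algebra_simps)
qed

section \<open>Expansion with finitely many explicit terms\<close>

definition em_remainder :: "real \<Rightarrow> real \<Rightarrow> complex \<Rightarrow> nat \<Rightarrow> complex" where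
  "em_remainder \<theta> x m a = factorial_series (\<lambda>l. em_coeff \<theta> m (l + a)) x - em_coeff \<theta> m a"

lemma sums_em_remainder:
  assumes "0 \<le> \<theta>" "\<theta> \<le> 1" "x > 0"
  shows   "(\<lambda>n. stirling_transform (\<lambda>l. em_coeff \<theta> m (l + a)) (Suc n) / of_real (pochhammer (x + 1) (Suc n)))
             sums em_remainder \<theta> x m a"
  using sums_factorial_series_Suc[OF tame_em_coeff[OF assms(1,2)] assms(3)] by (simp add: em_remainder_def)

text \<open>Each use of the shift rule peels off one explicit term and gains a factor 1/x.\<close>

lemma em_series_eq_remainder:
  assumes \<theta>: "0 \<le> \<theta>" "\<theta> \<le> 1" and x: "x > 0"
  shows   "em_series \<theta> x m = (\<Sum>k=1..a. em_coeff \<theta> m k / of_real x ^ k) + em_remainder \<theta> x m a / of_real x ^ a"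
proof (induction a)
  case 0
  thus ?case by (simp add: em_remainder_def em_series_def em_coeff_def[of _ _ 0])
next
  case (Suc a)
  have "factorial_series (\<lambda>l. em_coeff \<theta> m (Suc l + a)) x = of_real x * em_remainder \<theta> x m a"
    unfolding em_remainder_def using factorial_series_Suc[OF tame_em_coeff[OF \<theta>] x] by simp
  hence "em_remainder \<theta> x m a = (em_coeff \<theta> m (Suc a) + em_remainder \<theta> x m (Suc a)) / of_real x"
    using x by (simp add: em_remainder_def)
  hence "em_remainder \<theta> x m a / of_real x ^ a =
           em_coeff \<theta> m (Suc a) / of_real x ^ Suc a + em_remainder \<theta> x m (Suc a) / of_real x ^ Suc a"
    using x by (simp add: add_divide_distrib)
  thus ?case using Suc.IH by simp
qed

text \<open>The factor -(m + 1) is the first factor of \<open>pochhammer (-(m + 1)) l\<close>. It is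
  multiplied across because \<open>em_coeff\<close> is also defined at m = -1.\<close>

lemma em_coeff_gbinomial:
  assumes "l > 0"
  shows   "(m + 1) * em_coeff \<theta> m l = (-1) ^ l * ((m + 1) gchoose l) * of_real (bernpoly l \<theta>)"
proof -
  obtain n where l: "l = Suc n" using assms by (cases l) auto
  have "(-1) ^ l * ((m + 1) gchoose l) = pochhammer (-(m + 1)) l / fact l"
    by (simp add: gbinomial_pochhammer)
  also have "pochhammer (-(m + 1)) l = -(m + 1) * pochhammer (-m) n"
    unfolding l pochhammer_rec by simp
  finally have "(-1) ^ l * ((m + 1) gchoose l) = -(m + 1) * pochhammer (-m) n / fact l" .
  moreover have "c * (- P * (B / f)) = - c * P / f * B" for c P B f :: complex
    by simp
  ultimately show ?thesis
    by (simp only: em_coeff_def bern_coeff_def l nat.distinct if_False diff_Suc_1)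
qed

lemma stirling_transform_eq_sum:
  assumes "k > 0"
  shows   "stirling_transform C k = (\<Sum>l=1..k. of_nat (stirling k l) * C l)"
  unfolding stirling_transform_def
  by (rule sum.mono_neutral_right) (use assms in \<open>auto simp: not_less_eq_eq Suc_le_eq\<close>)

lemma of_int_stirling1: "of_int (stirling1 k l) = (-1) ^ (k + l) * (of_nat (stirling k l) :: 'a :: ring_1)"
  by (simp add: stirling1_def)

lemma em_transform_gbinomial:
  assumes "k > 0"
  shows   "(-1) ^ (k + a) * (\<Sum>l=1..k. ((m + 1) gchoose (l + a)) * of_int (stirling1 k l) * of_real (bernpoly (l + a) \<theta>)) =
             (m + 1) * stirling_transform (\<lambda>l. em_coeff \<theta> m (l + a)) k"
  unfolding stirling_transform_eq_sum[OF assms] sum_distrib_left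
proof (rule sum.cong)
  fix l assume "l \<in> {1..k}"
  hence "(m + 1) * em_coeff \<theta> m (l + a) = (-1) ^ (l + a) * ((m + 1) gchoose (l + a)) * of_real (bernpoly (l + a) \<theta>)"
    by (intro em_coeff_gbinomial) auto
  \<comment> \<open>The sign inside the signed Stirling number turns the outer (-1)^(k + a) into
    (-1)^(l + a), the sign belonging to the coefficient.\<close>
  moreover have "(-1) ^ (k + a) * (-1) ^ (k + l) = ((-1) ^ (l + a) :: complex)"
    by (simp add: power_add mult_ac flip: power_mult_distrib)
  moreover have "p * (g * (q * S) * B) = S * ((p * q) * g * B)" for p g q S B :: complex
    by (simp add: mult_ac)
  ultimately show "(-1) ^ (k + a) * (((m + 1) gchoose (l + a)) * of_int (stirling1 k l) * of_real (bernpoly (l + a) \<theta>)) =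
               (m + 1) * (of_nat (stirling k l) * em_coeff \<theta> m (l + a))"
    unfolding of_int_stirling1 by (simp only: mult.left_commute[of "m + 1"])
qed auto

text \<open>The Pochhammer symbol becomes (l - 1)!, and (l - 1)!/l! = 1/l.\<close>

lemma em_coeff_minus_one:
  assumes "l > 0"
  shows   "em_coeff \<theta> (-1) l = of_real (- bernpoly l \<theta> / real l)"
proof -
  obtain n where l: "l = Suc n" using assms by (cases l) auto
  show ?thesis unfolding l em_coeff_def bern_coeff_def
    by (simp add: pochhammer_fact[symmetric] divide_simps)
qed

lemma em_transform_minus_one:
  assumes "k > 0"
  shows   "complex_of_real ((-1) ^ (k + 1) * (\<Sum>l=1..k. (-1) ^ l / real (l + a) * of_int (stirling1 k l) * bernpoly (l + a) \<theta>)) =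
             stirling_transform (\<lambda>l. em_coeff \<theta> (-1) (l + a)) k"
  unfolding stirling_transform_eq_sum[OF assms] sum_distrib_left of_real_sum
proof (rule sum.cong)
  fix l assume "l \<in> {1..k}"
  hence em: "em_coeff \<theta> (-1) (l + a) = of_real (- bernpoly (l + a) \<theta> / real (l + a))"
    by (intro em_coeff_minus_one) auto
  have "(-1) ^ (k + 1) * ((-1) ^ l * (-1) ^ (k + l)) = (-1 :: real)"
    by (simp add: power_add mult_ac flip: power_mult_distrib)
  hence "(-1) ^ (k + 1) * ((-1) ^ l / real (l + a) * of_int (stirling1 k l) * bernpoly (l + a) \<theta>) =
         - 1 * (real (stirling k l) * bernpoly (l + a) \<theta> / real (l + a))"
    unfolding of_int_stirling1 by (simp add: mult.assoc mult.left_commute)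
  thus "complex_of_real ((-1) ^ (k + 1) * ((-1) ^ l / real (l + a) * of_int (stirling1 k l) * bernpoly (l + a) \<theta>)) =
          of_nat (stirling k l) * em_coeff \<theta> (-1) (l + a)"
    unfolding em by (simp only:) simp
qed auto

lemma prod_shift_eq_pochhammer: "(\<Prod>j=1..k. x + real j) = pochhammer (x + 1) k"
  by (induction k) (simp_all add: pochhammer_Suc add_ac)

text \<open>The witness is (m + 1) times \<open>em_remainder\<close>; the factor m + 1 compensates
  the division by m + 1 in front of the series.\<close>

lemma power_sum_expansion:
  fixes x :: real and m :: complex
  assumes x: "x > 0" and m: "m \<noteq> -1"
  shows "\<exists>s. (\<lambda>n. let k = Suc n in
               (-1) ^ (k + a) *
               (\<Sum>l=1..k. ((m + 1) gchoose (l + a)) * of_int (stirling1 k l)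
                          * of_real (bernpoly (l + a) (frac x)))
               / of_real (\<Prod>j=1..k. x + real j)) sums s \<and>
          (\<Sum>k=1..nat \<lfloor>x\<rfloor>. of_nat k powr m) =
            1 / (m + 1) * of_real x powr (m + 1) + zeta (- m)
            + 1 / (m + 1) *
              (\<Sum>k=1..a. (-1) ^ k * ((m + 1) gchoose k)
                         * of_real (bernpoly k (frac x)) * of_real x powr (m - of_nat k + 1))
            + of_real x powr (m - of_nat a + 1) / (m + 1) * s"
proof (intro exI conjI)
  have \<theta>: "0 \<le> frac x" "frac x \<le> 1" by (auto simp: frac_lt_1 less_imp_le)
  have nz: "m + 1 \<noteq> 0" using m by (metis add_eq_0_iff minus_minus)
  have "(\<lambda>n. (m + 1) * (stirling_transform (\<lambda>l. em_coeff (frac x) m (l + a)) (Suc n) / of_real (pochhammer (x + 1) (Suc n))))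
          sums ((m + 1) * em_remainder (frac x) x m a)"
    by (intro sums_mult sums_em_remainder \<theta> x)
  thus "(\<lambda>n. let k = Suc n in
               (-1) ^ (k + a) *
               (\<Sum>l=1..k. ((m + 1) gchoose (l + a)) * of_int (stirling1 k l)
                          * of_real (bernpoly (l + a) (frac x)))
               / of_real (\<Prod>j=1..k. x + real j)) sums ((m + 1) * em_remainder (frac x) x m a)"
    unfolding Let_def em_transform_gbinomial[OF zero_less_Suc] prod_shift_eq_pochhammer
    by (simp only: times_divide_eq_right)
  have px: "of_real x powr (m - of_nat k + 1) = of_real x powr (m + 1) / of_real x ^ k" for k
  proof -
    have "of_real x powr (m - of_nat k + 1) = of_real x powr ((m + 1) - of_nat k)"
      by (simp add: algebra_simps)
    also have "\<dots> = of_real x powr (m + 1) / of_real x ^ k"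
      using x by (simp add: powr_diff powr_nat')
    finally show ?thesis .
  qed
  have "of_real x powr (m + 1) * (\<Sum>k=1..a. em_coeff (frac x) m k / of_real x ^ k) =
          1 / (m + 1) * (\<Sum>k=1..a. (-1) ^ k * ((m + 1) gchoose k)
                         * of_real (bernpoly k (frac x)) * of_real x powr (m - of_nat k + 1))"
    unfolding sum_distrib_left
  proof (rule sum.cong)
    fix k assume "k \<in> {1..a}"
    hence "(-1) ^ k * ((m + 1) gchoose k) * of_real (bernpoly k (frac x)) = (m + 1) * em_coeff (frac x) m k"
      by (intro em_coeff_gbinomial[symmetric]) auto
    thus "of_real x powr (m + 1) * (em_coeff (frac x) m k / of_real x ^ k) =
            1 / (m + 1) * ((-1) ^ k * ((m + 1) gchoose k) * of_real (bernpoly k (frac x)) * of_real x powr (m - of_nat k + 1))"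
      unfolding px using nz by simp
  qed auto
  moreover have "of_real x powr (m + 1) * (em_remainder (frac x) x m a / of_real x ^ a) =
                   of_real x powr (m - of_nat a + 1) / (m + 1) * ((m + 1) * em_remainder (frac x) x m a)"
    unfolding px using nz by simp
  ultimately show "(\<Sum>k=1..nat \<lfloor>x\<rfloor>. of_nat k powr m) =
            1 / (m + 1) * of_real x powr (m + 1) + zeta (- m)
            + 1 / (m + 1) *
              (\<Sum>k=1..a. (-1) ^ k * ((m + 1) gchoose k)
                         * of_real (bernpoly k (frac x)) * of_real x powr (m - of_nat k + 1))
            + of_real x powr (m - of_nat a + 1) / (m + 1) * ((m + 1) * em_remainder (frac x) x m a)"
    unfolding power_sum_em_series[OF x m] em_series_eq_remainder[OF \<theta> x, of m a] distrib_left by simp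
qed

lemma harmonic_sum_expansion:
  fixes x :: real
  assumes x: "x > 0"
  shows "\<exists>s::real. (\<lambda>n. let k = Suc n in
               (-1) ^ (k + 1) *
               (\<Sum>l=1..k. (-1) ^ l / real (l + a) * of_int (stirling1 k l)
                          * bernpoly (l + a) (frac x))
               / (\<Prod>j=1..k. x + real j)) sums s \<and>
          (\<Sum>k=1..nat \<lfloor>x\<rfloor>. 1 / real k) =
            ln x + euler_mascheroni
            - (\<Sum>k=1..a. bernpoly k (frac x) / (real k * x ^ k))
            + 1 / x ^ a * s"
proof (intro exI conjI)
  have \<theta>: "0 \<le> frac x" "frac x \<le> 1" by (auto simp: frac_lt_1 less_imp_le)
  define R where "R = em_remainder (frac x) x (-1) a"
  define f where "f = (\<lambda>n. (-1) ^ (Suc n + 1) * (\<Sum>l=1..Suc n. (-1) ^ l / real (l + a) * of_int (stirling1 (Suc n) l)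
                          * bernpoly (l + a) (frac x)) / pochhammer (x + 1) (Suc n))"
  have "(\<lambda>n. complex_of_real (f n)) sums R"
    using sums_em_remainder[OF \<theta> x, of "-1" a]
    unfolding f_def R_def of_real_divide em_transform_minus_one[OF zero_less_Suc] .
  \<comment> \<open>The identities so far are complex although every term is real; real parts give
    the real statement and its witness.\<close>
  from sums_Re[OF this] have "f sums Re R" by simp
  thus "(\<lambda>n. let k = Suc n in
               (-1) ^ (k + 1) *
               (\<Sum>l=1..k. (-1) ^ l / real (l + a) * of_int (stirling1 k l)
                          * bernpoly (l + a) (frac x))
               / (\<Prod>j=1..k. x + real j)) sums Re R"
    unfolding Let_def prod_shift_eq_pochhammer f_def .
  have "(\<Sum>k=1..a. em_coeff (frac x) (-1) k / of_real x ^ k) =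
          of_real (- (\<Sum>k=1..a. bernpoly k (frac x) / (real k * x ^ k)))"
    unfolding sum_negf[symmetric] of_real_sum
    by (intro sum.cong refl) (simp add: em_coeff_minus_one)
  hence "complex_of_real (\<Sum>k=1..nat \<lfloor>x\<rfloor>. 1 / real k) =
          of_real (ln x + euler_mascheroni) + (of_real (- (\<Sum>k=1..a. bernpoly k (frac x) / (real k * x ^ k))) + R / of_real (x ^ a))"
    using harmonic_sum_em_series[OF x] em_series_eq_remainder[OF \<theta> x, of "-1" a] by (simp add: R_def)
  from arg_cong[OF this, of Re] show "(\<Sum>k=1..nat \<lfloor>x\<rfloor>. 1 / real k) =
            ln x + euler_mascheroni
            - (\<Sum>k=1..a. bernpoly k (frac x) / (real k * x ^ k))
            + 1 / x ^ a * Re R"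
    by (simp only: Re_divide_of_real plus_complex.sel Re_complex_of_real) simp
qed

theorem theorem14:
  fixes x :: real
  assumes "x > 0"
  shows
    "(\<forall>m::complex. m \<noteq> -1 \<longrightarrow>
       (\<exists>s. (\<lambda>n. let k = Suc n in
               (-1) ^ k *
               (\<Sum>l=1..k. ((m + 1) gchoose l) * of_int (stirling1 k l)
                          * of_real (bernpoly l (frac x)))
               / of_real (\<Prod>j=1..k. x + real j)) sums s \<and>
          (\<Sum>k=1..nat \<lfloor>x\<rfloor>. of_nat k powr m) =
            1 / (m + 1) * of_real x powr (m + 1) + zeta (- m)
            + of_real x powr (m + 1) / (m + 1) * s))
     \<and>
     (\<forall>m::complex. m \<noteq> -1 \<longrightarrow> (\<forall>a::nat.
       (\<exists>s. (\<lambda>n. let k = Suc n in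
               (-1) ^ (k + a) *
               (\<Sum>l=1..k. ((m + 1) gchoose (l + a)) * of_int (stirling1 k l)
                          * of_real (bernpoly (l + a) (frac x)))
               / of_real (\<Prod>j=1..k. x + real j)) sums s \<and>
          (\<Sum>k=1..nat \<lfloor>x\<rfloor>. of_nat k powr m) =
            1 / (m + 1) * of_real x powr (m + 1) + zeta (- m)
            + 1 / (m + 1) *
              (\<Sum>k=1..a. (-1) ^ k * ((m + 1) gchoose k)
                         * of_real (bernpoly k (frac x)) * of_real x powr (m - of_nat k + 1))
            + of_real x powr (m - of_nat a + 1) / (m + 1) * s)))
     \<and>
     (\<forall>m::complex. m \<noteq> -1 \<longrightarrow> Re m \<ge> -1 \<longrightarrow>
       (let r = nat \<lfloor>Re m + 1\<rfloor> in
        \<exists>s. (\<lambda>n. let k = Suc n in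
               (-1) ^ k *
               (\<Sum>l=1..k. ((m + 1) gchoose (l + r)) * of_int (stirling1 k l)
                          * of_real (bernpoly (l + r) (frac x)))
               / of_real (\<Prod>j=1..k. x + real j)) sums s \<and>
          (\<Sum>k=1..nat \<lfloor>x\<rfloor>. of_nat k powr m) =
            1 / (m + 1) * of_real x powr (m + 1) + zeta (- m)
            + 1 / (m + 1) *
              (\<Sum>k=1..r. (-1) ^ k * ((m + 1) gchoose k)
                         * of_real (bernpoly k (frac x)) * of_real x powr (m - of_nat k + 1))
            + (-1) ^ r * (of_real x powr (m - of_nat r + 1) / (m + 1)) * s))
     \<and>
     (\<forall>a::nat.
       (\<exists>s::real. (\<lambda>n. let k = Suc n in
               (-1) ^ (k + 1) *
               (\<Sum>l=1..k. (-1) ^ l / real (l + a) * of_int (stirling1 k l)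
                          * bernpoly (l + a) (frac x))
               / (\<Prod>j=1..k. x + real j)) sums s \<and>
          (\<Sum>k=1..nat \<lfloor>x\<rfloor>. 1 / real k) =
            ln x + euler_mascheroni
            - (\<Sum>k=1..a. bernpoly k (frac x) / (real k * x ^ k))
            + 1 / x ^ a * s))
     \<and>
     (\<exists>s::real. (\<lambda>n. let k = Suc n in
               (-1) ^ (k + 1) *
               (\<Sum>l=1..k. (-1) ^ l / real l * of_int (stirling1 k l) * bernpoly l (frac x))
               / (\<Prod>j=1..k. x + real j)) sums s \<and>
        (\<Sum>k=1..nat \<lfloor>x\<rfloor>. 1 / real k) = ln x + euler_mascheroni + s)
     \<and>
     (\<exists>s::real. (\<lambda>n. let k = Suc n in
               (-1) ^ (k + 1) *
               (\<Sum>l=1..k. (-1) ^ l / real (l + 1) * of_int (stirling1 k l)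
                          * bernpoly (l + 1) (frac x))
               / (\<Prod>j=0..k. x + real j)) sums s \<and>
        (\<Sum>k=1..nat \<lfloor>x\<rfloor>. 1 / real k) =
          ln x + euler_mascheroni - bernpoly 1 (frac x) / x + s)"
proof (intro conjI allI impI)
  fix m :: complex assume m: "m \<noteq> -1"
  show "\<exists>s. (\<lambda>n. let k = Suc n in
               (-1) ^ k *
               (\<Sum>l=1..k. ((m + 1) gchoose l) * of_int (stirling1 k l)
                          * of_real (bernpoly l (frac x)))
               / of_real (\<Prod>j=1..k. x + real j)) sums s \<and>
          (\<Sum>k=1..nat \<lfloor>x\<rfloor>. of_nat k powr m) =
            1 / (m + 1) * of_real x powr (m + 1) + zeta (- m)
            + of_real x powr (m + 1) / (m + 1) * s"
    using power_sum_expansion[OF assms m, of 0] by simp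
next
  fix m :: complex and a :: nat assume m: "m \<noteq> -1"
  show "\<exists>s. (\<lambda>n. let k = Suc n in
               (-1) ^ (k + a) *
               (\<Sum>l=1..k. ((m + 1) gchoose (l + a)) * of_int (stirling1 k l)
                          * of_real (bernpoly (l + a) (frac x)))
               / of_real (\<Prod>j=1..k. x + real j)) sums s \<and>
          (\<Sum>k=1..nat \<lfloor>x\<rfloor>. of_nat k powr m) =
            1 / (m + 1) * of_real x powr (m + 1) + zeta (- m)
            + 1 / (m + 1) *
              (\<Sum>k=1..a. (-1) ^ k * ((m + 1) gchoose k)
                         * of_real (bernpoly k (frac x)) * of_real x powr (m - of_nat k + 1))
            + of_real x powr (m - of_nat a + 1) / (m + 1) * s"
    by (rule power_sum_expansion[OF assms m])
next
  fix m :: complex assume m: "m \<noteq> -1"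
  define r where "r = nat \<lfloor>Re m + 1\<rfloor>"
  obtain s where s: "(\<lambda>n. let k = Suc n in
               (-1) ^ (k + r) *
               (\<Sum>l=1..k. ((m + 1) gchoose (l + r)) * of_int (stirling1 k l)
                          * of_real (bernpoly (l + r) (frac x)))
               / of_real (\<Prod>j=1..k. x + real j)) sums s"
          "(\<Sum>k=1..nat \<lfloor>x\<rfloor>. of_nat k powr m) =
            1 / (m + 1) * of_real x powr (m + 1) + zeta (- m)
            + 1 / (m + 1) *
              (\<Sum>k=1..r. (-1) ^ k * ((m + 1) gchoose k)
                         * of_real (bernpoly k (frac x)) * of_real x powr (m - of_nat k + 1))
            + of_real x powr (m - of_nat r + 1) / (m + 1) * s"
    using power_sum_expansion[OF assms m, of r] by blast
  \<comment> \<open>This clause carries (-1)^r outside the series, so its witness is (-1)^r times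
    the sum of the general case with a = r.\<close>
  have sgn: "(-1) ^ r * ((-1) ^ r * z) = (z :: complex)" for z
    by (simp flip: mult.assoc power_mult_distrib)
  have sgn': "(-1) ^ r * ((-1) ^ (k + r) * z / w) = (-1) ^ k * z / (w :: complex)" for k z w
    using sgn[of "(-1) ^ k * z / w"] by (simp add: power_add mult_ac)
  show "let r = nat \<lfloor>Re m + 1\<rfloor> in
        \<exists>s. (\<lambda>n. let k = Suc n in
               (-1) ^ k *
               (\<Sum>l=1..k. ((m + 1) gchoose (l + r)) * of_int (stirling1 k l)
                          * of_real (bernpoly (l + r) (frac x)))
               / of_real (\<Prod>j=1..k. x + real j)) sums s \<and>
          (\<Sum>k=1..nat \<lfloor>x\<rfloor>. of_nat k powr m) =
            1 / (m + 1) * of_real x powr (m + 1) + zeta (- m)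
            + 1 / (m + 1) *
              (\<Sum>k=1..r. (-1) ^ k * ((m + 1) gchoose k)
                         * of_real (bernpoly k (frac x)) * of_real x powr (m - of_nat k + 1))
            + (-1) ^ r * (of_real x powr (m - of_nat r + 1) / (m + 1)) * s"
    unfolding r_def[symmetric] Let_def
  proof (intro exI conjI)
    show "(\<lambda>n. (-1) ^ Suc n *
               (\<Sum>l=1..Suc n. ((m + 1) gchoose (l + r)) * of_int (stirling1 (Suc n) l)
                          * of_real (bernpoly (l + r) (frac x)))
               / of_real (\<Prod>j=1..Suc n. x + real j)) sums ((-1) ^ r * s)"
      using sums_mult[OF s(1)[unfolded Let_def], of "(-1) ^ r"] unfolding sgn' .
    show "(\<Sum>k=1..nat \<lfloor>x\<rfloor>. of_nat k powr m) =
            1 / (m + 1) * of_real x powr (m + 1) + zeta (- m)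
            + 1 / (m + 1) *
              (\<Sum>k=1..r. (-1) ^ k * ((m + 1) gchoose k)
                         * of_real (bernpoly k (frac x)) * of_real x powr (m - of_nat k + 1))
            + (-1) ^ r * (of_real x powr (m - of_nat r + 1) / (m + 1)) * ((-1) ^ r * s)"
      unfolding s(2) using sgn[of "of_real x powr (m - of_nat r + 1) / (m + 1) * s"]
      by (simp only: mult_ac)
  qed
next
  fix a :: nat
  show "\<exists>s::real. (\<lambda>n. let k = Suc n in
               (-1) ^ (k + 1) *
               (\<Sum>l=1..k. (-1) ^ l / real (l + a) * of_int (stirling1 k l)
                          * bernpoly (l + a) (frac x))
               / (\<Prod>j=1..k. x + real j)) sums s \<and>
          (\<Sum>k=1..nat \<lfloor>x\<rfloor>. 1 / real k) =
            ln x + euler_mascheroni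
            - (\<Sum>k=1..a. bernpoly k (frac x) / (real k * x ^ k))
            + 1 / x ^ a * s"
    by (rule harmonic_sum_expansion[OF assms])
next
  show "\<exists>s::real. (\<lambda>n. let k = Suc n in
               (-1) ^ (k + 1) *
               (\<Sum>l=1..k. (-1) ^ l / real l * of_int (stirling1 k l) * bernpoly l (frac x))
               / (\<Prod>j=1..k. x + real j)) sums s \<and>
        (\<Sum>k=1..nat \<lfloor>x\<rfloor>. 1 / real k) = ln x + euler_mascheroni + s"
    using harmonic_sum_expansion[OF assms, of 0] by simp
next
  obtain s where s: "(\<lambda>n. let k = Suc n in
               (-1) ^ (k + 1) *
               (\<Sum>l=1..k. (-1) ^ l / real (l + 1) * of_int (stirling1 k l)
                          * bernpoly (l + 1) (frac x))
               / (\<Prod>j=1..k. x + real j)) sums s"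
          "(\<Sum>k=1..nat \<lfloor>x\<rfloor>. 1 / real k) = ln x + euler_mascheroni
            - (\<Sum>k=1..1. bernpoly k (frac x) / (real k * x ^ k)) + 1 / x ^ 1 * s"
    using harmonic_sum_expansion[OF assms, of 1] by blast
  \<comment> \<open>The product from j = 0 has the extra factor x, which absorbs the 1/x in front of
    the series for a = 1.\<close>
  have p: "(\<Prod>j=0..k. x + real j) = (\<Prod>j=1..k. x + real j) * x" for k
    by (simp add: prod.atLeast_Suc_atMost mult.commute)
  show "\<exists>s::real. (\<lambda>n. let k = Suc n in
               (-1) ^ (k + 1) *
               (\<Sum>l=1..k. (-1) ^ l / real (l + 1) * of_int (stirling1 k l)
                          * bernpoly (l + 1) (frac x))
               / (\<Prod>j=0..k. x + real j)) sums s \<and>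
        (\<Sum>k=1..nat \<lfloor>x\<rfloor>. 1 / real k) =
          ln x + euler_mascheroni - bernpoly 1 (frac x) / x + s"
  proof (intro exI conjI)
    show "(\<lambda>n. let k = Suc n in
               (-1) ^ (k + 1) *
               (\<Sum>l=1..k. (-1) ^ l / real (l + 1) * of_int (stirling1 k l)
                          * bernpoly (l + 1) (frac x))
               / (\<Prod>j=0..k. x + real j)) sums (s / x)"
      using sums_divide[OF s(1), of x] unfolding Let_def p by (simp only: divide_divide_eq_left)
    show "(\<Sum>k=1..nat \<lfloor>x\<rfloor>. 1 / real k) =
            ln x + euler_mascheroni - bernpoly 1 (frac x) / x + s / x"
      using s(2) by simp
  qed
qed

end
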